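(* Let $d=1$, $\Omega\subset\mathbb R$ a bounded open interval, $p\in\mathbb N_0$, $q\in\mathbb N$. Consider a family of partitions $\mathcal P^\delta$ of $\overline\Sigma$ into squares with edge lengths ranging from $h_\delta$ to $H_\delta$, where $p+2\le H_\delta/h_\delta\in\mathbb N$, such that for some points $\alpha=\alpha_\delta,\beta=\beta_\delta\in\Omega$ the rectangle $[0,H_\delta]\times[\alpha-H_\delta,\alpha+H_\delta]$ is partitioned uniformly into squares of $\mathcal P^\delta$ with edge length $h_\delta$, the rectangle $[0,H_\delta]\times[\beta-H_\delta,\beta+H_\delta]$ is the union of the two squares $[0,H_\delta]\times[\beta-H_\delta,\beta]$ and $[0,H_\delta]\times[\beta,\beta+H_\delta]$ of $\mathcal P^\delta$, $0<(\beta-H_\delta)-(\alpha+H_\delta)\le CH_\delta$, and $\operatorname{dist}(\alpha,\partial\Omega)\ge c$, with constants $C,c>0$ independent of $\delta$. Let $$X^\delta:=C(\overline\Sigma)\cap L_2(\Xi;H_0^1(\Omega))\cap Q_{1,1}(\mathcal P^\delta),\qquad Y^\delta:=L_2(\Xi;H_0^1(\Omega))\cap Q_{p,q}(\mathcal P^\delta).$$ Then $$\gamma_\delta^{\mathrm d_t}\to0\quad\text{as }H_\delta\to0,\qquad\text{and}\qquad\gamma_\delta^{B_e}\to0\quad\text{as }H_\delta\to0\text{ and }\frac{h_\delta}{H_\delta\sqrt{H_\delta}}\to0 .$$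
   Context: $\Xi=(0,1)$ (so $\mathrm T=1$), $\Sigma=\Xi\times\Omega$, with first variable $t\in\Xi$ and second variable $x\in\Omega$. $H=L_2(\Omega)$, $V=H_0^1(\Omega)$, $Y=L_2(\Xi;H_0^1(\Omega))$ equipped with $\|v\|_Y:=\|\nabla_xv\|_{L_2(\Sigma)}$, $Y'$ with the dual norm, $X=Y\cap H^1(\Xi;H^{-1}(\Omega))$. $\mathrm d_t\in\mathcal L(X,Y')$, $(\mathrm d_tw)(v)=\int_\Xi(\frac{dw}{dt}(t))(v(t))\,dt$. $A(t)\in\mathcal L(V,V')$ is bounded and coercive uniformly in a.e. $t\in\Xi$, $A\in\mathcal L(Y,Y')$ is $(Aw)(v)=\int_\Xi(A(t)w(t))(v(t))\,dt$, $B:=\mathrm d_t+A$, $\gamma_0w:=w(0)$, $B_e:=(B,\gamma_0)\colon X\to Y'\times H$. $Q_{p,q}(\mathcal P^\delta)$ is the space of functions whose restriction to each square $I\times T\in\mathcal P^\delta$ belongs to $P_p(I)\otimes P_q(T)$ (degree $\le p$ in $t$, $\le q$ in $x$). For $g\in Y'$, $\|g\|_{(Y^\delta)'}:=\sup_{0\ne v\in Y^\delta}g(v)/\|v\|_Y$. Define $$\gamma_\delta^{\mathrm d_t}:=\inf_{\{w\in X^\delta:\ \mathrm d_tw\ne0\}}\frac{\|\mathrm d_tw\|_{(Y^\delta)'}}{\|\mathrm d_tw\|_{Y'}},\qquad(\gamma_\delta^{B_e})^2:=\inf_{0\ne w\in X^\delta}\frac{\|Bw\|_{(Y^\delta)'}^2+\|\gamma_0w\|_H^2}{\|Bw\|_{Y'}^2+\|\gamma_0w\|_H^2}.$$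 *)

theory Defs
  imports "HOL-Analysis.Analysis"
begin

text \<open>
  Elements of \<open>L\<^sub>2\<close>-type spaces are represented by functions on the whole type; only the values
  almost everywhere on the domain matter, and ``\<open>= 0\<close>'' is understood in that sense. Functionals
  on such spaces are functions of representatives.
\<close>

section \<open>Sobolev spaces in one space variable\<close>

definition L2 :: "'a::euclidean_space set \<Rightarrow> ('a \<Rightarrow> real) set" where
  "L2 S = {f. f \<in> borel_measurable (lebesgue_on S) \<and> integrable (lebesgue_on S) (\<lambda>x. (f x)\<^sup>2)}"

definition L2_norm :: "'a::euclidean_space set \<Rightarrow> ('a \<Rightarrow> real) \<Rightarrow> real" where
  "L2_norm S f = sqrt (LINT x|lebesgue_on S. (f x)\<^sup>2)"

definition ae_zero :: "'a::euclidean_space set \<Rightarrow> ('a \<Rightarrow> real) \<Rightarrow> bool" where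
  "ae_zero S f \<longleftrightarrow> (AE x in lebesgue_on S. f x = 0)"

definition test_functions :: "real set \<Rightarrow> (real \<Rightarrow> real) set" where
  "test_functions S = {\<phi>. (\<forall>k x. (deriv ^^ k) \<phi> field_differentiable at x) \<and>
     compact (closure {x. \<phi> x \<noteq> 0}) \<and> closure {x. \<phi> x \<noteq> 0} \<subseteq> S}"

definition weak_deriv :: "real set \<Rightarrow> (real \<Rightarrow> real) \<Rightarrow> (real \<Rightarrow> real) \<Rightarrow> bool" where
  "weak_deriv \<Omega> u g \<longleftrightarrow> (\<forall>\<phi>\<in>test_functions \<Omega>.
     (LINT x|lebesgue_on \<Omega>. u x * deriv \<phi> x) = - (LINT x|lebesgue_on \<Omega>. g x * \<phi> x))"

definition H1 :: "real set \<Rightarrow> (real \<Rightarrow> real) set" where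
  "H1 \<Omega> = {u \<in> L2 \<Omega>. \<exists>g\<in>L2 \<Omega>. weak_deriv \<Omega> u g}"

definition D :: "real set \<Rightarrow> (real \<Rightarrow> real) \<Rightarrow> real \<Rightarrow> real" where
  "D \<Omega> u = (SOME g. g \<in> L2 \<Omega> \<and> weak_deriv \<Omega> u g)"

definition H01 :: "real set \<Rightarrow> (real \<Rightarrow> real) set" where
  "H01 \<Omega> = {u \<in> H1 \<Omega>. \<exists>\<phi>. (\<forall>n. \<phi> n \<in> test_functions \<Omega>) \<and>
     (\<lambda>n. L2_norm \<Omega> (\<lambda>x. \<phi> n x - u x)) \<longlonglongrightarrow> 0 \<and>
     (\<lambda>n. L2_norm \<Omega> (\<lambda>x. deriv (\<phi> n) x - D \<Omega> u x)) \<longlonglongrightarrow> 0}"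

definition H01_norm :: "real set \<Rightarrow> (real \<Rightarrow> real) \<Rightarrow> real" where
  "H01_norm \<Omega> u = L2_norm \<Omega> (D \<Omega> u)"

text \<open>Linearity on \<open>H\<^sub>0\<^sup>1\<close> together with the bound forces a functional to be independent of the
  choice of representatives.\<close>

definition linear_on_H01 :: "real set \<Rightarrow> ((real \<Rightarrow> real) \<Rightarrow> real) \<Rightarrow> bool" where
  "linear_on_H01 \<Omega> l \<longleftrightarrow> (\<forall>u\<in>H01 \<Omega>. \<forall>v\<in>H01 \<Omega>. \<forall>r s.
     l (\<lambda>x. r * u x + s * v x) = r * l u + s * l v)"

definition Hm1 :: "real set \<Rightarrow> ((real \<Rightarrow> real) \<Rightarrow> real) set" where
  "Hm1 \<Omega> = {l. linear_on_H01 \<Omega> l \<and> (\<exists>K. \<forall>u\<in>H01 \<Omega>. \<bar>l u\<bar> \<le> K * H01_norm \<Omega> u)}"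

definition Hm1_norm :: "real set \<Rightarrow> ((real \<Rightarrow> real) \<Rightarrow> real) \<Rightarrow> real" where
  "Hm1_norm \<Omega> l = (SUP u\<in>{u \<in> H01 \<Omega>. \<not> ae_zero \<Omega> u}. l u / H01_norm \<Omega> u)"

section \<open>Space-time function spaces and operators\<close>

definition \<Xi> :: "real set" where
  "\<Xi> = {0<..<1}"

abbreviation \<Sigma> :: "real set \<Rightarrow> (real \<times> real) set" where
  "\<Sigma> \<Omega> \<equiv> \<Xi> \<times> \<Omega>"

abbreviation slice :: "(real \<times> real \<Rightarrow> real) \<Rightarrow> real \<Rightarrow> real \<Rightarrow> real" where
  "slice v t \<equiv> (\<lambda>x. v (t, x))"

definition weak_grad_x ::
    "real set \<Rightarrow> (real \<times> real \<Rightarrow> real) \<Rightarrow> (real \<times> real \<Rightarrow> real) \<Rightarrow> bool" where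
  "weak_grad_x \<Omega> v g \<longleftrightarrow> g \<in> L2 (\<Sigma> \<Omega>) \<and>
     (AE t in lebesgue_on \<Xi>. slice g t \<in> L2 \<Omega> \<and> weak_deriv \<Omega> (slice v t) (slice g t))"

text \<open>\<open>L\<^sub>2(\<Xi>; H\<^sub>0\<^sup>1(\<Omega>))\<close>, with \<open>L\<^sub>2(\<Xi>; L\<^sub>2(\<Omega>))\<close> identified with \<open>L\<^sub>2(\<Xi> \<times> \<Omega>)\<close>.\<close>

definition Y :: "real set \<Rightarrow> (real \<times> real \<Rightarrow> real) set" where
  "Y \<Omega> = {v \<in> L2 (\<Sigma> \<Omega>). (AE t in lebesgue_on \<Xi>. slice v t \<in> H01 \<Omega>) \<and> (\<exists>g. weak_grad_x \<Omega> v g)}"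

definition grad_x :: "real set \<Rightarrow> (real \<times> real \<Rightarrow> real) \<Rightarrow> real \<times> real \<Rightarrow> real" where
  "grad_x \<Omega> v = (SOME g. weak_grad_x \<Omega> v g)"

definition Y_norm :: "real set \<Rightarrow> (real \<times> real \<Rightarrow> real) \<Rightarrow> real" where
  "Y_norm \<Omega> v = L2_norm (\<Sigma> \<Omega>) (grad_x \<Omega> v)"

text \<open>The supremum over a subspace \<open>S\<close> of \<open>Y\<close>: \<open>S = Y\<close> gives the norm of \<open>Y'\<close>, and \<open>S = Y\<^sup>\<delta>\<close>
  the discrete dual norm.\<close>

definition dual_norm ::
    "real set \<Rightarrow> (real \<times> real \<Rightarrow> real) set \<Rightarrow> ((real \<times> real \<Rightarrow> real) \<Rightarrow> real) \<Rightarrow> real" where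
  "dual_norm \<Omega> S g = (SUP v\<in>{v \<in> S. \<not> ae_zero (\<Sigma> \<Omega>) v}. g v / Y_norm \<Omega> v)"

text \<open>\<open>L\<^sub>2(\<Xi>; H\<^sup>-\<^sup>1(\<Omega>))\<close>; since \<open>H\<^sub>0\<^sup>1(\<Omega>)\<close> is separable and reflexive, strong measurability is the
  same as measurability of all \<open>t \<mapsto> g(t)(u)\<close>.\<close>

definition L2_Hm1 :: "real set \<Rightarrow> (real \<Rightarrow> (real \<Rightarrow> real) \<Rightarrow> real) set" where
  "L2_Hm1 \<Omega> = {g. (\<forall>u\<in>H01 \<Omega>. (\<lambda>t. g t u) \<in> borel_measurable (lebesgue_on \<Xi>)) \<and>
     (AE t in lebesgue_on \<Xi>. g t \<in> Hm1 \<Omega>) \<and>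
     integrable (lebesgue_on \<Xi>) (\<lambda>t. (Hm1_norm \<Omega> (g t))\<^sup>2)}"

text \<open>Weak time derivative with respect to the Gelfand triple \<open>H\<^sub>0\<^sup>1 \<subseteq> L\<^sub>2 \<subseteq> H\<^sup>-\<^sup>1\<close>.\<close>

definition weak_time_deriv ::
    "real set \<Rightarrow> (real \<times> real \<Rightarrow> real) \<Rightarrow> (real \<Rightarrow> (real \<Rightarrow> real) \<Rightarrow> real) \<Rightarrow> bool" where
  "weak_time_deriv \<Omega> w g \<longleftrightarrow> g \<in> L2_Hm1 \<Omega> \<and> (\<forall>u\<in>H01 \<Omega>. \<forall>\<phi>\<in>test_functions \<Xi>.
     (LINT t|lebesgue_on \<Xi>. g t u * \<phi> t) =
     - (LINT t|lebesgue_on \<Xi>. (LINT x|lebesgue_on \<Omega>. w (t, x) * u x) * deriv \<phi> t))"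

definition time_deriv ::
    "real set \<Rightarrow> (real \<times> real \<Rightarrow> real) \<Rightarrow> real \<Rightarrow> (real \<Rightarrow> real) \<Rightarrow> real" where
  "time_deriv \<Omega> w = (SOME g. weak_time_deriv \<Omega> w g)"

definition d_t :: "real set \<Rightarrow> (real \<times> real \<Rightarrow> real) \<Rightarrow> (real \<times> real \<Rightarrow> real) \<Rightarrow> real" where
  "d_t \<Omega> w v = (LINT t|lebesgue_on \<Xi>. time_deriv \<Omega> w t (slice v t))"

text \<open>\<open>A t u v\<close> stands for \<open>(A(t)u)(v)\<close>.\<close>

definition bounded_coercive ::
    "real set \<Rightarrow> (real \<Rightarrow> (real \<Rightarrow> real) \<Rightarrow> (real \<Rightarrow> real) \<Rightarrow> real) \<Rightarrow> bool" where
  "bounded_coercive \<Omega> A \<longleftrightarrow>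
     (\<forall>u\<in>H01 \<Omega>. \<forall>v\<in>H01 \<Omega>. (\<lambda>t. A t u v) \<in> borel_measurable (lebesgue_on \<Xi>)) \<and>
     (\<exists>M m. m > 0 \<and> (AE t in lebesgue_on \<Xi>.
        (\<forall>u\<in>H01 \<Omega>. linear_on_H01 \<Omega> (\<lambda>v. A t u v)) \<and>
        (\<forall>v\<in>H01 \<Omega>. linear_on_H01 \<Omega> (\<lambda>u. A t u v)) \<and>
        (\<forall>u\<in>H01 \<Omega>. \<forall>v\<in>H01 \<Omega>. \<bar>A t u v\<bar> \<le> M * H01_norm \<Omega> u * H01_norm \<Omega> v) \<and>
        (\<forall>u\<in>H01 \<Omega>. A t u u \<ge> m * (H01_norm \<Omega> u)\<^sup>2)))"

definition A_op :: "(real \<Rightarrow> (real \<Rightarrow> real) \<Rightarrow> (real \<Rightarrow> real) \<Rightarrow> real) \<Rightarrow>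
    (real \<times> real \<Rightarrow> real) \<Rightarrow> (real \<times> real \<Rightarrow> real) \<Rightarrow> real" where
  "A_op A w v = (LINT t|lebesgue_on \<Xi>. A t (slice w t) (slice v t))"

definition B_op :: "real set \<Rightarrow> (real \<Rightarrow> (real \<Rightarrow> real) \<Rightarrow> (real \<Rightarrow> real) \<Rightarrow> real) \<Rightarrow>
    (real \<times> real \<Rightarrow> real) \<Rightarrow> (real \<times> real \<Rightarrow> real) \<Rightarrow> real" where
  "B_op \<Omega> A w v = d_t \<Omega> w v + A_op A w v"

text \<open>Pointwise evaluation at \<open>t = 0\<close> is the trace because it is only applied to functions that
  are continuous on the closure of \<open>\<Xi> \<times> \<Omega>\<close>.\<close>

definition gamma_0 :: "(real \<times> real \<Rightarrow> real) \<Rightarrow> real \<Rightarrow> real" where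
  "gamma_0 w = slice w 0"

section \<open>Discrete spaces and stability constants\<close>

definition Q :: "nat \<Rightarrow> nat \<Rightarrow> (real \<times> real) set set \<Rightarrow> (real \<times> real \<Rightarrow> real) set" where
  "Q p q P = {v. \<forall>K\<in>P. \<exists>c :: nat \<Rightarrow> nat \<Rightarrow> real. AE z in lebesgue_on K.
     v z = (\<Sum>i\<le>p. \<Sum>j\<le>q. c i j * fst z ^ i * snd z ^ j)}"

definition X_disc :: "real set \<Rightarrow> (real \<times> real) set set \<Rightarrow> (real \<times> real \<Rightarrow> real) set" where
  "X_disc \<Omega> P = {w. continuous_on (closure (\<Sigma> \<Omega>)) w} \<inter> Y \<Omega> \<inter> Q 1 1 P"

definition Y_disc ::
    "real set \<Rightarrow> nat \<Rightarrow> nat \<Rightarrow> (real \<times> real) set set \<Rightarrow> (real \<times> real \<Rightarrow> real) set" where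
  "Y_disc \<Omega> p q P = Y \<Omega> \<inter> Q p q P"

definition gamma_dt :: "real set \<Rightarrow> nat \<Rightarrow> nat \<Rightarrow> (real \<times> real) set set \<Rightarrow> real" where
  "gamma_dt \<Omega> p q P = (INF w\<in>{w \<in> X_disc \<Omega> P. \<exists>v\<in>Y \<Omega>. d_t \<Omega> w v \<noteq> 0}.
     dual_norm \<Omega> (Y_disc \<Omega> p q P) (d_t \<Omega> w) / dual_norm \<Omega> (Y \<Omega>) (d_t \<Omega> w))"

definition gamma_Be :: "real set \<Rightarrow> (real \<Rightarrow> (real \<Rightarrow> real) \<Rightarrow> (real \<Rightarrow> real) \<Rightarrow> real) \<Rightarrow>
    nat \<Rightarrow> nat \<Rightarrow> (real \<times> real) set set \<Rightarrow> real" where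
  "gamma_Be \<Omega> A p q P = sqrt (INF w\<in>{w \<in> X_disc \<Omega> P. \<not> ae_zero (\<Sigma> \<Omega>) w}.
     ((dual_norm \<Omega> (Y_disc \<Omega> p q P) (B_op \<Omega> A w))\<^sup>2 + (L2_norm \<Omega> (gamma_0 w))\<^sup>2) /
     ((dual_norm \<Omega> (Y \<Omega>) (B_op \<Omega> A w))\<^sup>2 + (L2_norm \<Omega> (gamma_0 w))\<^sup>2))"

end

theory Submission
  imports Defs
begin

text \<open>
  Let \<open>w(t,x) = W(t) \<phi>(x)\<close>, where \<open>\<phi>\<close> is the hat function at \<open>\<alpha>\<close> of half-width \<open>H\<close> and \<open>W\<close> is the
  spline on the fine time mesh whose derivative \<open>\<theta>\<close> takes the values \<open>(-1)\<^sup>i (p+1 choose i)\<close>,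
  so that \<open>\<theta>\<close> is orthogonal to all polynomials of degree \<open>p\<close>. On the big square left of \<open>\<beta>\<close> a test
  function \<open>v \<in> Y\<^sup>\<delta>\<close> is a polynomial of degree \<open>p\<close> in \<open>t\<close>; hence so is its integral over
  \<open>J = [\<beta>-H,\<beta>]\<close>, and \<open>(d\<^sub>t w)(v) = \<integral> \<theta>(t) \<integral> (\<phi> - 1\<^sub>J)(x) v(t,x) dx dt\<close>. Since \<open>\<phi> - 1\<^sub>J\<close> has zero mean and
  support of length \<open>O(H)\<close>, this is at most of order \<open>H\<^sup>3\<^sup>/\<^sup>2 \<parallel>\<theta>\<parallel> \<parallel>v\<parallel>\<close>, whereas \<open>v = \<theta>(t) g(x)\<close> with a fixed
  bump \<open>g\<close> shows that the norm of \<open>d\<^sub>t w\<close> in \<open>Y'\<close> is at least of order \<open>H \<parallel>\<theta>\<parallel>\<close>. Finally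
  \<open>\<parallel>w\<parallel>\<close> in \<open>Y\<close> is of order \<open>h H\<^sup>-\<^sup>1\<^sup>/\<^sup>2 \<parallel>\<theta>\<parallel>\<close> and \<open>w(0) = 0\<close>, so the perturbation by \<open>A\<close> is negligible
  if \<open>h / H\<^sup>3\<^sup>/\<^sup>2\<close> is small.
\<close>

section \<open>Square-integrable functions\<close>

text \<open>Why the discrete norm collapses: a discrete v can follow the oscillation \<theta> on the
  fine cells around \<alpha>, but not on the large square beside \<beta>. The two places are O(H)
  apart, and a function with square-integrable derivative changes by at most O(sqrt(H)) between
  them, so the freedom near \<alpha> is worth only a factor sqrt(H). The fixed bump has no such tie
  and loses nothing; it must not depend on the mesh, hence the distance c to the boundary.
  Orthogonality to degree p means p + 1 conditions, so p + 2 cells are the fewest that admit a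
  nonzero step function, and the solution is a finite difference of order p + 1. Since its
  coefficients sum to 0, W returns to 0 and w stays inside the fine rectangle. The formal obstacle
  lies in the definitions: derivatives are picked by \<open>SOME\<close>, and suprema and integrals
  have default values. A time derivative can be computed only after uniqueness is known for all
  spatial test functions off one null set, which takes separability of \<open>H01\<close>, and a
  supremum can be used only after some bound has been shown.\<close>

lemma borel_imp_lebesgue_on: "f \<in> borel_measurable borel \<Longrightarrow> f \<in> borel_measurable (lebesgue_on S)"
  by (intro measurable_restrict_space1 measurable_completion) simp

lemma L2_norm_nonneg [simp]: "0 \<le> L2_norm S f"
  by (simp add: L2_norm_def)

lemma L2_norm_power2: "(L2_norm S f)\<^sup>2 = (LINT x|lebesgue_on S. (f x)\<^sup>2)"
  by (simp add: L2_norm_def)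

lemma L2_mult_integrable:
  assumes "f \<in> L2 S" "g \<in> L2 S"
  shows "integrable (lebesgue_on S) (\<lambda>x. f x * g x)"
proof (rule Bochner_Integration.integrable_bound)
  show "integrable (lebesgue_on S) (\<lambda>x. (f x)\<^sup>2 + (g x)\<^sup>2)"
    using assms by (auto simp: L2_def)
  show "(\<lambda>x. f x * g x) \<in> borel_measurable (lebesgue_on S)"
    using assms by (auto simp: L2_def)
  have "\<bar>f x * g x\<bar> \<le> (f x)\<^sup>2 + (g x)\<^sup>2" for x
    using sum_squares_bound[of "\<bar>f x\<bar>" "\<bar>g x\<bar>"] abs_ge_zero[of "f x * g x"]
    unfolding abs_mult power2_abs by linarith
  then show "AE x in lebesgue_on S. norm (f x * g x) \<le> norm ((f x)\<^sup>2 + (g x)\<^sup>2)"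
    by (auto intro!: AE_I2)
qed

lemma L2_abs: "f \<in> L2 S \<Longrightarrow> (\<lambda>x. \<bar>f x\<bar>) \<in> L2 S"
  by (auto simp: L2_def)

lemma L2_norm_abs [simp]: "L2_norm S (\<lambda>x. \<bar>f x\<bar>) = L2_norm S f"
  by (simp add: L2_norm_def)

lemma L2_lincomb:
  assumes "f \<in> L2 S" "g \<in> L2 S"
  shows "(\<lambda>x. r * f x + s * g x) \<in> L2 S"
proof -
  have "integrable (lebesgue_on S) (\<lambda>x. r\<^sup>2 * (f x)\<^sup>2 + 2 * r * s * (f x * g x) + s\<^sup>2 * (g x)\<^sup>2)"
    using assms L2_mult_integrable[OF assms] by (auto simp: L2_def)
  also have "(\<lambda>x. r\<^sup>2 * (f x)\<^sup>2 + 2 * r * s * (f x * g x) + s\<^sup>2 * (g x)\<^sup>2) = (\<lambda>x. (r * f x + s * g x)\<^sup>2)"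
    by (auto simp: power2_eq_square algebra_simps)
  finally show ?thesis using assms by (auto simp: L2_def)
qed

lemma L2_scale: "f \<in> L2 S \<Longrightarrow> (\<lambda>x. r * f x) \<in> L2 S"
  using L2_lincomb[of f S f r 0] by simp

lemma L2_add: "f \<in> L2 S \<Longrightarrow> g \<in> L2 S \<Longrightarrow> (\<lambda>x. f x + g x) \<in> L2 S"
  using L2_lincomb[of f S g 1 1] by simp

lemma L2_diff: "f \<in> L2 S \<Longrightarrow> g \<in> L2 S \<Longrightarrow> (\<lambda>x. f x - g x) \<in> L2 S"
  using L2_lincomb[of f S g 1 "-1"] by simp

lemma L2_norm_scale: "L2_norm S (\<lambda>x. r * f x) = \<bar>r\<bar> * L2_norm S f"
  by (simp add: L2_norm_def power_mult_distrib real_sqrt_mult)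

lemma L2_norm_cong_AE:
  assumes "f \<in> L2 S" "g \<in> L2 S" "AE x in lebesgue_on S. f x = g x"
  shows "L2_norm S f = L2_norm S g"
  unfolding L2_norm_def using assms by (intro arg_cong[where f=sqrt] integral_cong_AE) (auto simp: L2_def)

text \<open>The squared norm of \<open>r * f + g\<close> is a nonnegative quadratic in r, and its
  value at the minimiser gives the inequality. For \<open>?F = 0\<close> it degenerates to an affine
  function, which is nonnegative only if its slope vanishes.\<close>

lemma L2_Cauchy_Schwarz:
  assumes f: "f \<in> L2 S" and g: "g \<in> L2 S"
  shows "\<bar>LINT x|lebesgue_on S. f x * g x\<bar> \<le> L2_norm S f * L2_norm S g"
proof -
  let ?I = "LINT x|lebesgue_on S. f x * g x"
  have "0 \<le> (L2_norm S f)\<^sup>2 * r\<^sup>2 + 2 * ?I * r + (L2_norm S g)\<^sup>2" for r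
  proof -
    have "0 \<le> (LINT x|lebesgue_on S. (r * f x + g x)\<^sup>2)" by simp
    also have "\<dots> = (LINT x|lebesgue_on S. r\<^sup>2 * (f x)\<^sup>2 + 2 * r * (f x * g x) + (g x)\<^sup>2)"
      by (simp add: power2_eq_square algebra_simps)
    also have "\<dots> = r\<^sup>2 * (LINT x|lebesgue_on S. (f x)\<^sup>2) + 2 * r * ?I + (LINT x|lebesgue_on S. (g x)\<^sup>2)"
      using f g L2_mult_integrable[OF f g] by (simp add: L2_def)
    finally show ?thesis by (simp add: L2_norm_power2 algebra_simps)
  qed note q = this
  let ?F = "L2_norm S f" and ?G = "L2_norm S g"
  have "?I\<^sup>2 \<le> (?F * ?G)\<^sup>2"
  proof (cases "?F = 0")
    case True
    have "?I = 0"
    proof (rule ccontr)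
      assume "?I \<noteq> 0"
      moreover have "2 * ?I * (- (?G\<^sup>2 + 1) / (2 * ?I)) = - (?G\<^sup>2 + 1)" using \<open>?I \<noteq> 0\<close> by simp
      ultimately show False using q[of "- (?G\<^sup>2 + 1) / (2 * ?I)"] True by simp
    qed
    then show ?thesis by simp
  next
    case False
    have "0 \<le> ?F\<^sup>2 * (?F\<^sup>2 * (- ?I / ?F\<^sup>2)\<^sup>2 + 2 * ?I * (- ?I / ?F\<^sup>2) + ?G\<^sup>2)"
      using q[of "- ?I / ?F\<^sup>2"] by simp
    also have "\<dots> = (?F * ?G)\<^sup>2 - ?I\<^sup>2"
      using False by (simp add: field_simps power2_eq_square)
    finally show ?thesis by simp
  qed
  then show ?thesis
    using power2_le_imp_le[of "\<bar>?I\<bar>" "?F * ?G"] by simp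
qed

lemma L2_norm_triangle:
  assumes f: "f \<in> L2 S" and g: "g \<in> L2 S"
  shows "L2_norm S (\<lambda>x. f x + g x) \<le> L2_norm S f + L2_norm S g"
proof (rule power2_le_imp_le)
  have "(L2_norm S (\<lambda>x. f x + g x))\<^sup>2 = (LINT x|lebesgue_on S. (f x)\<^sup>2 + 2 * (f x * g x) + (g x)\<^sup>2)"
    unfolding L2_norm_power2 by (simp add: power2_eq_square algebra_simps)
  also have "\<dots> = (L2_norm S f)\<^sup>2 + 2 * (LINT x|lebesgue_on S. f x * g x) + (L2_norm S g)\<^sup>2"
    using f g L2_mult_integrable[OF f g] by (simp add: L2_def L2_norm_power2)
  also have "\<dots> \<le> (L2_norm S f + L2_norm S g)\<^sup>2"
    using L2_Cauchy_Schwarz[OF f g] by (simp add: power2_sum)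
  finally show "(L2_norm S (\<lambda>x. f x + g x))\<^sup>2 \<le> (L2_norm S f + L2_norm S g)\<^sup>2" .
qed simp

lemma L2_norm_diff_commute: "L2_norm S (\<lambda>x. f x - g x) = L2_norm S (\<lambda>x. g x - f x)"
  by (simp add: L2_norm_def power2_commute)

lemma L2_norm_reverse_triangle:
  assumes f: "f \<in> L2 S" and g: "g \<in> L2 S"
  shows "\<bar>L2_norm S f - L2_norm S g\<bar> \<le> L2_norm S (\<lambda>x. f x - g x)"
  using L2_norm_triangle[OF L2_diff[OF f g] g] L2_norm_triangle[OF L2_diff[OF g f] f]
  by (simp add: L2_norm_diff_commute[of S f g])

lemma L2_norm_tendsto:
  assumes f: "\<And>n. f n \<in> L2 S" and g: "g \<in> L2 S"
    and lim: "(\<lambda>n. L2_norm S (\<lambda>x. f n x - g x)) \<longlonglongrightarrow> 0"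
  shows "(\<lambda>n. L2_norm S (f n)) \<longlonglongrightarrow> L2_norm S g"
  by (rule LIM_zero_cancel, rule Lim_null_comparison[OF _ lim])
     (use L2_norm_reverse_triangle[OF f g] in auto)

lemma L2_inner_tendsto:
  assumes f: "\<And>n. f n \<in> L2 S" and g: "g \<in> L2 S" and k: "k \<in> L2 S"
    and lim: "(\<lambda>n. L2_norm S (\<lambda>x. f n x - g x)) \<longlonglongrightarrow> 0"
  shows "(\<lambda>n. LINT x|lebesgue_on S. f n x * k x) \<longlonglongrightarrow> (LINT x|lebesgue_on S. g x * k x)"
proof (rule LIM_zero_cancel, rule Lim_null_comparison)
  show "(\<lambda>n. L2_norm S (\<lambda>x. f n x - g x) * L2_norm S k) \<longlonglongrightarrow> 0"
    using tendsto_mult_left_zero[OF lim] .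
  show "\<forall>\<^sub>F n in sequentially. norm ((LINT x|lebesgue_on S. f n x * k x) - (LINT x|lebesgue_on S. g x * k x))
     \<le> L2_norm S (\<lambda>x. f n x - g x) * L2_norm S k"
    using L2_Cauchy_Schwarz[OF L2_diff[OF f g] k] L2_mult_integrable[OF f k] L2_mult_integrable[OF g k]
    by (auto simp: algebra_simps)
qed

lemma bounded_L2:
  assumes "S \<in> lmeasurable" "f \<in> borel_measurable (lebesgue_on S)" "\<And>x. x \<in> S \<Longrightarrow> \<bar>f x\<bar> \<le> B"
  shows "f \<in> L2 S"
proof -
  interpret finite_measure "lebesgue_on S" by (rule finite_measure_lebesgue_on) fact
  have "integrable (lebesgue_on S) (\<lambda>x. (f x)\<^sup>2)"
  proof (rule integrable_const_bound)
    show "AE x in lebesgue_on S. norm ((f x)\<^sup>2) \<le> B\<^sup>2"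
    proof (rule AE_I2)
      fix x assume "x \<in> space (lebesgue_on S)"
      then have "\<bar>f x\<bar> \<le> \<bar>B\<bar>" using assms(3)[of x] by simp
      then show "norm ((f x)\<^sup>2) \<le> B\<^sup>2" by (simp add: abs_le_square_iff)
    qed
  qed (use assms in auto)
  then show ?thesis using assms by (auto simp: L2_def)
qed

lemma indicator_L2:
  assumes "S \<in> lmeasurable" "A \<in> sets borel"
  shows "indicat_real A \<in> L2 S"
  by (rule bounded_L2[OF assms(1) borel_imp_lebesgue_on, of _ 1]) (use assms(2) in \<open>auto split: split_indicator\<close>)

lemma L2_integrable:
  assumes "S \<in> lmeasurable" "f \<in> L2 S"
  shows "integrable (lebesgue_on S) f"
  using L2_mult_integrable[OF assms(2) bounded_L2[OF assms(1), of "\<lambda>_. 1" 1]] by simp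

lemma L2_norm_le_bound:
  assumes "S \<in> lmeasurable" "f \<in> L2 S" "\<And>x. x \<in> S \<Longrightarrow> \<bar>f x\<bar> \<le> B" "0 \<le> B"
  shows "L2_norm S f \<le> B * sqrt (measure lebesgue S)"
proof -
  interpret finite_measure "lebesgue_on S" by (rule finite_measure_lebesgue_on) fact
  have "(LINT x|lebesgue_on S. (f x)\<^sup>2) \<le> (LINT x|lebesgue_on S. B\<^sup>2)"
  proof (rule integral_mono)
    fix x assume "x \<in> space (lebesgue_on S)"
    then show "(f x)\<^sup>2 \<le> B\<^sup>2" using assms(3)[of x] by (simp flip: abs_le_square_iff)
  qed (use assms in \<open>auto simp: L2_def\<close>)
  also have "\<dots> = B\<^sup>2 * measure lebesgue S"
    using assms by (simp add: measure_restrict_space fmeasurableD)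
  finally have "L2_norm S f \<le> sqrt (B\<^sup>2 * measure lebesgue S)"
    unfolding L2_norm_def by (rule real_sqrt_le_mono)
  then show ?thesis
    using assms by (simp add: real_sqrt_mult)
qed

lemma L2_norm_mono:
  assumes "f \<in> L2 S" "g \<in> L2 S" "\<And>x. x \<in> S \<Longrightarrow> \<bar>f x\<bar> \<le> \<bar>g x\<bar>"
  shows "L2_norm S f \<le> L2_norm S g"
  unfolding L2_norm_def
proof (intro real_sqrt_le_mono integral_mono)
  fix x assume "x \<in> space (lebesgue_on S)"
  then show "(f x)\<^sup>2 \<le> (g x)\<^sup>2" using assms(3)[of x] by (simp add: abs_le_square_iff)
qed (use assms in \<open>auto simp: L2_def\<close>)

text \<open>f is not assumed measurable. If it fails to be integrable its integral is 0 by
  convention and the bound still holds, so pairings whose measurability in t is unknown are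
  covered.\<close>

lemma weighted_Cauchy_Schwarz:
  assumes g: "g \<in> L2 S" and k: "k \<in> L2 S" and K: "0 \<le> K"
    and bnd: "AE t in lebesgue_on S. \<bar>f t\<bar> \<le> K * (\<bar>g t\<bar> * \<bar>k t\<bar>)"
  shows "\<bar>LINT t|lebesgue_on S. f t\<bar> \<le> K * (L2_norm S g * L2_norm S k)"
proof (cases "integrable (lebesgue_on S) f")
  case True
  have i: "integrable (lebesgue_on S) (\<lambda>t. \<bar>g t\<bar> * \<bar>k t\<bar>)" by (rule L2_mult_integrable[OF L2_abs[OF g] L2_abs[OF k]])
  have "\<bar>LINT t|lebesgue_on S. f t\<bar> \<le> (LINT t|lebesgue_on S. \<bar>f t\<bar>)" by (rule integral_abs_bound)
  also have "\<dots> \<le> (LINT t|lebesgue_on S. K * (\<bar>g t\<bar> * \<bar>k t\<bar>))"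
    using True i bnd by (intro integral_mono_AE) auto
  also have "\<dots> = K * (LINT t|lebesgue_on S. \<bar>g t\<bar> * \<bar>k t\<bar>)" by simp
  also have "\<dots> \<le> K * (L2_norm S g * L2_norm S k)"
    using L2_Cauchy_Schwarz[OF L2_abs[OF g] L2_abs[OF k]] K by (intro mult_left_mono) (simp_all del: abs_mult)
  finally show ?thesis .
next
  case False
  then show ?thesis using K by (simp add: not_integrable_integral_eq)
qed

text \<open>f itself may fail to be integrable: then f + g fails too, since g can be subtracted
  again, and both integrals take the default value 0.\<close>

lemma integral_add_null:
  fixes f g :: "'a \<Rightarrow> real"
  assumes g: "integrable M g" "integral\<^sup>L M g = 0"
  shows "(LINT x|M. f x + g x) = (LINT x|M. f x)"
proof (cases "integrable M f")
  case True
  then show ?thesis using g by simp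
next
  case False
  have "\<not> integrable M (\<lambda>x. f x + g x)"
  proof
    assume "integrable M (\<lambda>x. f x + g x)"
    then have "integrable M (\<lambda>x. (f x + g x) - g x)" using g(1) by (rule Bochner_Integration.integrable_diff)
    then show False using False by simp
  qed
  then show ?thesis using False by (simp add: not_integrable_integral_eq)
qed

section \<open>Smooth bumps\<close>

text \<open>Smoothness graded by order: the product and chain rules cost one derivative, so closure
  properties go by induction on k and then hold for all k.\<close>

definition diffk :: "nat \<Rightarrow> (real \<Rightarrow> real) \<Rightarrow> bool" where
  "diffk k f \<longleftrightarrow> (\<forall>j<k. \<forall>x. (deriv ^^ j) f field_differentiable at x)"

definition smooth :: "(real \<Rightarrow> real) \<Rightarrow> bool" where
  "smooth f \<longleftrightarrow> (\<forall>k x. (deriv ^^ k) f field_differentiable at x)"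

lemma diffk_0 [simp]: "diffk 0 f"
  by (simp add: diffk_def)

lemma diffk_Suc: "diffk (Suc k) f \<longleftrightarrow> (\<forall>x. f field_differentiable at x) \<and> diffk k (deriv f)"
  by (auto simp: diffk_def less_Suc_eq_0_disj funpow_swap1)

lemma smooth_iff_diffk: "smooth f \<longleftrightarrow> (\<forall>k. diffk k f)"
  by (auto simp: smooth_def diffk_def)

lemma diffk_SucD: "diffk (Suc k) f \<Longrightarrow> diffk k f"
  by (auto simp: diffk_def)

lemma diffk_SucI:
  assumes "\<And>x. (f has_real_derivative f' x) (at x)" "diffk k f'"
  shows "diffk (Suc k) f"
proof -
  have "deriv f = f'" using assms(1) by (auto intro!: ext DERIV_imp_deriv)
  then show ?thesis using assms by (auto simp: diffk_Suc field_differentiable_def)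
qed

lemma diffk_SucE:
  assumes "diffk (Suc k) f"
  shows "(f has_real_derivative deriv f x) (at x)" "diffk k (deriv f)"
  using assms by (auto simp: diffk_Suc DERIV_deriv_iff_field_differentiable)

lemma diffk_lincomb: "diffk k f \<Longrightarrow> diffk k g \<Longrightarrow> diffk k (\<lambda>x. r * f x + s * g x)"
proof (induction k arbitrary: f g)
  case (Suc k)
  note f' = diffk_SucE[OF Suc.prems(1)]
  note g' = diffk_SucE[OF Suc.prems(2)]
  show ?case
    by (rule diffk_SucI[OF _ Suc.IH[OF f'(2) g'(2)]]) (auto intro!: derivative_eq_intros f' g')
qed simp

lemma diffk_mult: "diffk k f \<Longrightarrow> diffk k g \<Longrightarrow> diffk k (\<lambda>x. f x * g x)"
proof (induction k arbitrary: f g)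
  case (Suc k)
  note f' = diffk_SucE[OF Suc.prems(1)]
  note g' = diffk_SucE[OF Suc.prems(2)]
  have "diffk k (\<lambda>x. 1 * (deriv f x * g x) + 1 * (f x * deriv g x))"
    using Suc f' g' by (intro diffk_lincomb Suc.IH) (auto dest: diffk_SucD)
  then show ?case
    by (rule diffk_SucI[rotated]) (auto intro!: derivative_eq_intros f' g')
qed simp

lemma diffk_affine: "diffk k f \<Longrightarrow> diffk k (\<lambda>x. f (c * x + d))"
proof (induction k arbitrary: f)
  case (Suc k)
  note f' = diffk_SucE[OF Suc.prems]
  have "diffk k (\<lambda>x. c * deriv f (c * x + d) + 0 * deriv f (c * x + d))"
    using Suc f' by (intro diffk_lincomb Suc.IH)
  then have "diffk k (\<lambda>x. deriv f (c * x + d) * c)" by (simp add: mult.commute)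
  then show ?case
    by (rule diffk_SucI[rotated]) (auto intro!: derivative_eq_intros DERIV_chain2[OF f'(1)])
qed simp

text \<open>The standard cutoff exp(-1/x) times a power of 1/x. The powers are carried along because
  differentiation produces them; up to linear combinations the family is closed under it.\<close>

definition flat :: "nat \<Rightarrow> real \<Rightarrow> real" where
  "flat n x = (if x > 0 then (1 / x) ^ n * exp (- (1 / x)) else 0)"

text \<open>A single term of the exponential series at u = 1/x, of order n + 1, beats the power of
  order n and leaves a factor 1/u = x.\<close>

lemma flat_le: "\<bar>flat n x\<bar> \<le> fact (Suc n) * \<bar>x\<bar>"
proof (cases "x > 0")
  case True
  define u where "u = 1 / x"
  have u: "u > 0" using True by (simp add: u_def)
  have "u ^ Suc n / fact (Suc n) \<le> exp u"
  proof -
    have "(\<Sum>k\<in>{Suc n}. u ^ k /\<^sub>R fact k) \<le> (\<Sum>k. u ^ k /\<^sub>R fact k)"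
      using u by (intro sum_le_suminf summable_exp_generic) auto
    then show ?thesis by (simp add: exp_def divide_inverse mult.commute)
  qed
  then have "u ^ n * exp (- u) \<le> fact (Suc n) / u"
    using u by (simp add: field_simps exp_minus del: fact_Suc)
  then show ?thesis using True u by (simp add: flat_def flip: u_def del: fact_Suc) (simp add: u_def)
qed (simp add: flat_def mult_nonneg_nonpos del: fact_Suc)

lemma flat_has_derivative: "(flat n has_real_derivative flat (n + 2) x - real n * flat (Suc n) x) (at x)"
proof -
  consider "x > 0" | "x < 0" | "x = 0" by linarith
  then show ?thesis
  proof cases
    case 1
    have "((\<lambda>x. (1 / x) ^ n * exp (- (1 / x))) has_real_derivative flat (n + 2) x - real n * flat (Suc n) x) (at x)"
    proof -
      define u where "u = 1 / x"
      have d: "((\<lambda>x. 1 / x) has_real_derivative - (u\<^sup>2)) (at x)"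
        using 1 by (auto intro!: derivative_eq_intros simp: u_def power2_eq_square)
      have "((\<lambda>x. (1 / x) ^ n * exp (- (1 / x))) has_real_derivative
          real n * u ^ (n - 1) * (- (u\<^sup>2)) * exp (- u) + u ^ n * (exp (- u) * u\<^sup>2)) (at x)"
        by (intro DERIV_cong[OF DERIV_mult[OF DERIV_power[OF d, of n] DERIV_chain2[OF DERIV_exp DERIV_minus[OF d]]]])
           (simp add: u_def algebra_simps)
      moreover have "real n * u ^ (n - 1) * (- (u\<^sup>2)) * exp (- u) + u ^ n * (exp (- u) * u\<^sup>2) =
          flat (n + 2) x - real n * flat (Suc n) x"
        using 1 by (cases n) (simp_all add: flat_def power2_eq_square algebra_simps flip: u_def)
      ultimately show ?thesis by simp
    qed
    then show ?thesis
      by (rule has_field_derivative_transform_within_open[of _ _ _ "{0<..}"]) (use 1 in \<open>auto simp: flat_def\<close>)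
  next
    case 2
    have "((\<lambda>x. 0) has_real_derivative 0) (at x)" by simp
    then have "(flat n has_real_derivative 0) (at x)"
      by (rule has_field_derivative_transform_within_open[of _ _ _ "{..<0}"]) (use 2 in \<open>auto simp: flat_def\<close>)
    then show ?thesis using 2 by (simp add: flat_def)
  next
    case 3
    \<comment> \<open>At the origin the difference quotient is the next member of the family, which
      vanishes at least linearly by \<open>flat_le\<close>.\<close>
    have "((\<lambda>h. flat n h / h) \<longlongrightarrow> 0) (at 0)"
    proof (rule Lim_null_comparison)
      have "flat n h / h = flat (Suc n) h" for h by (simp add: flat_def)
      then show "\<forall>\<^sub>F h in at 0. norm (flat n h / h) \<le> fact (Suc (Suc n)) * \<bar>h\<bar>"
        using flat_le[of "Suc n"] by (simp del: fact_Suc)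
      show "((\<lambda>h::real. fact (Suc (Suc n)) * \<bar>h\<bar>) \<longlongrightarrow> 0) (at 0)"
        by (auto intro!: tendsto_eq_intros)
    qed
    moreover have "flat m 0 = 0" for m by (simp add: flat_def)
    ultimately show ?thesis using 3 by (simp add: DERIV_def)
  qed
qed

lemma diffk_flat: "diffk k (flat n)"
proof (induction k arbitrary: n)
  case (Suc k)
  have "diffk k (\<lambda>x. 1 * flat (n + 2) x + (- real n) * flat (Suc n) x)"
    by (intro diffk_lincomb Suc)
  then show ?case
    by (intro diffk_SucI[OF flat_has_derivative]) simp
qed simp

text \<open>For r > 0 the support lies in [s, t], and r is a steepness, not a height: values stay in
  [0, 1] and tend to the indicator of (s, t) as r grows.\<close>

definition bump :: "real \<Rightarrow> real \<Rightarrow> real \<Rightarrow> real \<Rightarrow> real" where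
  "bump r s t x = flat 0 (r * (x - s)) * flat 0 (r * (t - x))"

lemma smooth_lincomb: "smooth f \<Longrightarrow> smooth g \<Longrightarrow> smooth (\<lambda>x. r * f x + s * g x)"
  by (auto simp: smooth_iff_diffk intro!: diffk_lincomb)

lemma smooth_bump: "smooth (bump r s t)"
  unfolding smooth_iff_diffk
proof
  fix k
  have "diffk k (\<lambda>x. flat 0 (r * x + (- r * s)) * flat 0 ((- r) * x + r * t))"
    by (intro diffk_mult diffk_affine diffk_flat)
  then show "diffk k (bump r s t)"
    by (simp add: bump_def[abs_def] algebra_simps)
qed

lemma smoothI: "(\<And>x. (f has_real_derivative f' x) (at x)) \<Longrightarrow> smooth f' \<Longrightarrow> smooth f"
  unfolding smooth_iff_diffk by (metis diffk_SucI diffk_SucD)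

lemma smooth_deriv: "smooth f \<Longrightarrow> smooth (deriv f)"
  unfolding smooth_iff_diffk using diffk_Suc by blast

lemma smooth_DERIV: "smooth f \<Longrightarrow> (f has_real_derivative deriv f x) (at x)"
  unfolding smooth_iff_diffk by (metis diffk_Suc DERIV_deriv_iff_field_differentiable)

lemma smooth_continuous: "smooth f \<Longrightarrow> continuous_on S f"
  by (meson DERIV_isCont continuous_at_imp_continuous_on smooth_DERIV)

lemma bump_bounds: "0 \<le> bump r s t x" "bump r s t x \<le> 1"
  by (auto simp: bump_def flat_def intro!: mult_le_one)

lemma bump_zero: "0 < r \<Longrightarrow> x \<le> s \<or> t \<le> x \<Longrightarrow> bump r s t x = 0"
  by (auto simp: bump_def flat_def zero_less_mult_iff)

lemma flat_0_mono: "x \<le> y \<Longrightarrow> flat 0 x \<le> flat 0 y"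
  by (auto simp: flat_def frac_le)

text \<open>Both factors are monotone, so a margin d from either end of the support gives a bound
  independent of x. It supplies a lower bound that no mesh influences.\<close>

lemma bump_lower:
  assumes "0 < r" "0 \<le> d" "s + d \<le> x" "x \<le> t - d"
  shows "(flat 0 (r * d))\<^sup>2 \<le> bump r s t x"
  unfolding bump_def power2_eq_square using assms
  by (intro mult_mono flat_0_mono) (auto simp: flat_def)

lemma bump_tendsto: "(\<lambda>n. bump (real (Suc n)) s t x) \<longlonglongrightarrow> indicator {s<..<t} x"
proof (cases "x \<in> {s<..<t}")
  case True
  have *: "(\<lambda>n. flat 0 (real (Suc n) * d)) \<longlonglongrightarrow> 1" if "d > 0" for d
  proof -
    have "(\<lambda>n. exp (- (1 / d * (1 / real (Suc n))))) \<longlonglongrightarrow> exp (- (1 / d * 0))"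
      by (intro tendsto_intros lim_1_over_n[THEN LIMSEQ_Suc])
    moreover have "flat 0 (real (Suc n) * d) = exp (- (1 / d * (1 / real (Suc n))))" for n
      using that by (simp add: flat_def zero_less_mult_iff)
    ultimately show ?thesis by simp
  qed
  have "(\<lambda>n. bump (real (Suc n)) s t x) \<longlonglongrightarrow> 1 * 1"
    unfolding bump_def using True by (intro tendsto_mult *) auto
  then show ?thesis using True by simp
next
  case False
  then have "bump (real (Suc n)) s t x = 0" for n by (intro bump_zero) auto
  then show ?thesis using False by simp
qed

section \<open>Test functions on an interval\<close>

lemma test_functionsI:
  assumes "smooth \<phi>" "\<And>x. x \<notin> {s..t} \<Longrightarrow> \<phi> x = 0" "{s..t} \<subseteq> S"
  shows "\<phi> \<in> test_functions S"
proof -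
  have "closure {x. \<phi> x \<noteq> 0} \<subseteq> {s..t}"
    using assms(2) by (intro closure_minimal) (force, simp)
  moreover from this have "compact (closure {x. \<phi> x \<noteq> 0})"
    by (meson bounded_closed_interval bounded_subset closed_closure compact_eq_bounded_closed)
  ultimately show ?thesis
    using assms(1,3) by (auto simp: test_functions_def smooth_def)
qed

lemma test_functionsD:
  assumes "\<phi> \<in> test_functions {a<..<b}" "a < b"
  obtains s t where "a < s" "s \<le> t" "t < b" "smooth \<phi>" "\<And>x. x \<notin> {s..t} \<Longrightarrow> \<phi> x = 0"
    "\<And>x. x \<notin> {s..t} \<Longrightarrow> deriv \<phi> x = 0"
proof -
  let ?K = "closure {x. \<phi> x \<noteq> 0}"
  have K: "compact ?K" "?K \<subseteq> {a<..<b}" and sm: "smooth \<phi>"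
    using assms by (auto simp: test_functions_def smooth_def)
  obtain s t where st: "a < s" "s \<le> t" "t < b" "?K \<subseteq> {s..t}"
  proof (cases "?K = {}")
    case True
    then show ?thesis using that[of "(a+b)/2" "(a+b)/2"] assms(2) by (auto simp: field_simps)
  next
    case False
    obtain s where "s \<in> ?K" "\<forall>x\<in>?K. s \<le> x" using compact_attains_inf[OF K(1) False] by blast
    moreover obtain t where "t \<in> ?K" "\<forall>x\<in>?K. x \<le> t" using compact_attains_sup[OF K(1) False] by blast
    ultimately show ?thesis using K(2) that[of s t] by force
  qed
  have z: "\<phi> x = 0" if "x \<notin> {s..t}" for x
    using st(4) that closure_subset[of "{x. \<phi> x \<noteq> 0}"] by auto
  have "deriv \<phi> x = 0" if "x \<notin> {s..t}" for x
  proof (rule DERIV_imp_deriv)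
    have "((\<lambda>_. 0) has_real_derivative 0) (at x)" by simp
    then show "(\<phi> has_real_derivative 0) (at x)"
      by (rule has_field_derivative_transform_within_open[of _ _ _ "- {s..t}"])
         (use that z in \<open>auto intro!: open_Compl\<close>)
  qed
  then show ?thesis using that st sm z by blast
qed

lemma test_functions_smooth: "\<phi> \<in> test_functions S \<Longrightarrow> smooth \<phi>"
  by (auto simp: test_functions_def smooth_def)

lemma test_functions_lincomb:
  assumes "\<phi> \<in> test_functions {a<..<b}" "\<psi> \<in> test_functions {a<..<b}" "a < b"
  shows "(\<lambda>x. r * \<phi> x + s * \<psi> x) \<in> test_functions {a<..<b}"
proof -
  obtain s1 t1 where 1: "a < s1" "s1 \<le> t1" "t1 < b" "\<And>x. x \<notin> {s1..t1} \<Longrightarrow> \<phi> x = 0"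
    using test_functionsD[OF assms(1,3)] by metis
  obtain s2 t2 where 2: "a < s2" "s2 \<le> t2" "t2 < b" "\<And>x. x \<notin> {s2..t2} \<Longrightarrow> \<psi> x = 0"
    using test_functionsD[OF assms(2,3)] by metis
  show ?thesis
  proof (rule test_functionsI[of _ "min s1 s2" "max t1 t2"])
    show "smooth (\<lambda>x. r * \<phi> x + s * \<psi> x)"
      using assms by (intro smooth_lincomb test_functions_smooth)
    fix x assume "x \<notin> {min s1 s2..max t1 t2}"
    then have "x \<notin> {s1..t1}" "x \<notin> {s2..t2}" by auto
    then show "r * \<phi> x + s * \<psi> x = 0" using 1(4) 2(4) by simp
  qed (use 1 2 in auto)
qed

lemma deriv_lincomb:
  "smooth \<phi> \<Longrightarrow> smooth \<psi> \<Longrightarrow> deriv (\<lambda>x. r * \<phi> x + s * \<psi> x) x = r * deriv \<phi> x + s * deriv \<psi> x"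
  by (auto intro!: DERIV_imp_deriv derivative_eq_intros smooth_DERIV)

lemma bump_test: "a < s \<Longrightarrow> t < b \<Longrightarrow> 0 < r \<Longrightarrow> bump r s t \<in> test_functions {a<..<b}"
  by (rule test_functionsI[of _ s t, OF smooth_bump]) (auto intro!: bump_zero)

lemma continuous_imp_L2:
  fixes f :: "real \<Rightarrow> real"
  assumes "continuous_on UNIV f"
  shows "f \<in> L2 {a<..<b}"
proof -
  have "continuous_on {a..b} f" using assms continuous_on_subset by blast
  then have "bounded (f ` {a..b})" by (intro compact_imp_bounded compact_continuous_image) auto
  then obtain B where "\<forall>x\<in>{a..b}. \<bar>f x\<bar> \<le> B" by (auto simp: bounded_iff)
  then show ?thesis
    using assms borel_measurable_continuous_onI[OF assms]
    by (intro bounded_L2[of _ _ B]) (auto intro!: borel_imp_lebesgue_on)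
qed

lemma test_function_L2: "\<phi> \<in> test_functions S \<Longrightarrow> \<phi> \<in> L2 {a<..<b}"
  by (intro continuous_imp_L2 smooth_continuous test_functions_smooth)

lemma test_function_deriv_L2: "\<phi> \<in> test_functions S \<Longrightarrow> deriv \<phi> \<in> L2 {a<..<b}"
  by (intro continuous_imp_L2 smooth_continuous smooth_deriv test_functions_smooth)

section \<open>The fundamental lemma of the calculus of variations\<close>

text \<open>Smooth bumps tend pointwise to the indicator and stay below 1, so the absolute value of
  f dominates. The interval lies strictly inside (a, b) to make the bumps test functions.\<close>

lemma integral_interval_eq_0:
  assumes f: "integrable (lebesgue_on {a<..<b}) f" and st: "a < s" "t < b"
    and z: "\<And>\<phi>. \<phi> \<in> test_functions {a<..<b} \<Longrightarrow> (LINT x|lebesgue_on {a<..<b}. f x * \<phi> x) = 0"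
  shows "(LINT x|lebesgue_on {a<..<b}. f x * indicator {s<..<t} x) = (0::real)"
proof -
  have "(\<lambda>n. LINT x|lebesgue_on {a<..<b}. f x * bump (real (Suc n)) s t x)
      \<longlonglongrightarrow> (LINT x|lebesgue_on {a<..<b}. f x * indicator {s<..<t} x)"
  proof (rule integral_dominated_convergence[where w = "\<lambda>x. norm (f x)"])
    show "integrable (lebesgue_on {a<..<b}) (\<lambda>x. norm (f x))" using f by simp
    show "AE x in lebesgue_on {a<..<b}. (\<lambda>n. f x * bump (real (Suc n)) s t x) \<longlonglongrightarrow> f x * indicator {s<..<t} x"
      by (intro AE_I2 tendsto_mult_left bump_tendsto)
    show "AE x in lebesgue_on {a<..<b}. norm (f x * bump (real (Suc n)) s t x) \<le> norm (f x)" for n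
      by (intro AE_I2) (auto simp: abs_mult bump_bounds intro!: mult_left_le)
    have "bump (real (Suc n)) s t \<in> borel_measurable (lebesgue_on {a<..<b})" for n
      by (intro borel_imp_lebesgue_on)
         (simp add: borel_measurable_continuous_onI smooth_bump smooth_continuous)
    then show "(\<lambda>x. f x * bump (real (Suc n)) s t x) \<in> borel_measurable (lebesgue_on {a<..<b})" for n
      using f by (intro borel_measurable_times) auto
    have "indicator {s<..<t} \<in> borel_measurable (lebesgue_on {a<..<b})"
      by (intro borel_imp_lebesgue_on) auto
    then show "(\<lambda>x. f x * indicator {s<..<t} x) \<in> borel_measurable (lebesgue_on {a<..<b})"
      using f by (intro borel_measurable_times) auto
  qed
  moreover have "(LINT x|lebesgue_on {a<..<b}. f x * bump (real (Suc n)) s t x) = 0" for n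
    using st by (intro z bump_test) auto
  ultimately show ?thesis
    by (simp add: LIMSEQ_const_iff)
qed

lemma integral_ray_eq_0:
  assumes ab: "a < b" and f: "integrable (lebesgue_on {a<..<b}) f"
    and z: "\<And>\<phi>. \<phi> \<in> test_functions {a<..<b} \<Longrightarrow> (LINT x|lebesgue_on {a<..<b}. f x * \<phi> x) = 0"
  shows "(LINT y|lebesgue_on {a<..<b}. f y * indicator {x<..} y) = (0::real)"
proof -
  \<comment> \<open>Intervals strictly inside (a, b) that exhaust the part of the ray lying there.
    The maximum takes care of rays starting left of a.\<close>
  define s t where "s n = max x a + 1 / real (Suc n)" and "t n = b - 1 / real (Suc n)" for n
  have "(\<lambda>n. LINT x|lebesgue_on {a<..<b}. f x * indicator {s n<..<t n} x)
      \<longlonglongrightarrow> (LINT y|lebesgue_on {a<..<b}. f y * indicator {x<..} y)"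
  proof (rule integral_dominated_convergence[where w = "\<lambda>x. norm (f x)"])
    show "integrable (lebesgue_on {a<..<b}) (\<lambda>x. norm (f x))" using f by simp
    show "AE y in lebesgue_on {a<..<b}. (\<lambda>n. f y * indicator {s n<..<t n} y) \<longlonglongrightarrow> f y * indicator {x<..} y"
    proof (intro AE_I2 tendsto_mult_left)
      fix y assume y: "y \<in> space (lebesgue_on {a<..<b})"
      have st: "s \<longlonglongrightarrow> max x a + 0" "t \<longlonglongrightarrow> b - 0"
        unfolding s_def t_def by (intro tendsto_intros lim_1_over_n[THEN LIMSEQ_Suc])+
      show "(\<lambda>n. indicator {s n<..<t n} y :: real) \<longlonglongrightarrow> indicator {x<..} y"
      proof (cases "x < y")
        case True
        then have "\<forall>\<^sub>F n in sequentially. s n < y" "\<forall>\<^sub>F n in sequentially. y < t n"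
          using y st by (auto intro!: order_tendstoD)
        then have "\<forall>\<^sub>F n in sequentially. indicator {s n<..<t n} y = (indicator {x<..} y :: real)"
          by eventually_elim (use True in auto)
        then show ?thesis by (rule tendsto_eventually)
      next
        case False
        have "max x a < s n" for n by (simp add: s_def)
        then have "\<not> s n < y" for n using False by (smt (verit) max_def)
        then show ?thesis using False by simp
      qed
    qed
    show "AE x in lebesgue_on {a<..<b}. norm (f x * indicator {s n<..<t n} x) \<le> norm (f x)" for n
      by (intro AE_I2) (auto simp: indicator_def)
    have "indicat_real A \<in> borel_measurable (lebesgue_on {a<..<b})" if "A \<in> sets borel" for A
      using that by (intro borel_imp_lebesgue_on) auto
    then show "(\<lambda>y. f y * indicator {x<..} y) \<in> borel_measurable (lebesgue_on {a<..<b})"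
      "(\<lambda>y. f y * indicator {s n<..<t n} y) \<in> borel_measurable (lebesgue_on {a<..<b})" for n
      using f by (auto intro!: borel_measurable_times)
  qed
  moreover have "(LINT x|lebesgue_on {a<..<b}. f x * indicator {s n<..<t n} x) = 0" for n
  proof (rule integral_interval_eq_0[OF f _ _ z])
    have "max x a < s n" by (simp add: s_def)
    then show "a < s n" by simp
  qed (simp_all add: t_def)
  ultimately show ?thesis
    by (simp add: LIMSEQ_const_iff)
qed

text \<open>The positive and the negative part of f serve as densities of two measures. These are
  finite and equal on all rays, hence equal, so the densities agree almost everywhere.\<close>

lemma weak_zero_imp_AE_zero:
  fixes f :: "real \<Rightarrow> real"
  assumes ab: "a < b" and f: "integrable (lebesgue_on {a<..<b}) f"
    and z: "\<And>\<phi>. \<phi> \<in> test_functions {a<..<b} \<Longrightarrow> (LINT x|lebesgue_on {a<..<b}. f x * \<phi> x) = 0"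
  shows "AE x in lebesgue_on {a<..<b}. f x = 0"
proof -
  let ?f = "\<lambda>x. if x \<in> {a<..<b} then f x else 0"
  have f': "integrable lebesgue ?f"
    by (rule iffD2[OF Lebesgue_Measure.integrable_restrict_UNIV f]) simp
  \<comment> \<open>f is only Lebesgue measurable, while uniqueness of densities is applied over
    \<open>lborel\<close>; hence a Borel version.\<close>
  then obtain g where g: "g \<in> borel_measurable lborel" "AE x in lborel. ?f x = g x"
    using completion_ex_borel_measurable_real by blast
  have "integrable lebesgue g"
    by (rule integrable_cong_AE_imp[OF f']) (use g AE_completion[OF g(2)] in \<open>auto intro: measurable_completion\<close>)
  then have gi: "integrable lborel g" using g(1) integrable_completion by blast
  have fin: "(\<integral>\<^sup>+x. ennreal \<bar>g x\<bar> \<partial>lborel) < \<infinity>"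
    using gi by (simp add: integrable_iff_bounded)
  let ?M = "density lborel (\<lambda>x. ennreal (g x))" and ?N = "density lborel (\<lambda>x. ennreal (- g x))"
  have ray: "emeasure ?M {x<..} = emeasure ?N {x<..}" "emeasure ?M {x<..} < \<infinity>" for x
  proof -
    have gx: "integrable lborel (\<lambda>y. indicator {x<..} y * g y)"
      using integrable_mult_indicator[OF _ gi, of "{x<..}"] by simp
    have "(LINT y|lborel. indicator {x<..} y * g y) = (LINT y|lebesgue. indicator {x<..} y * g y)"
      using gx by (intro integral_completion[symmetric]) auto
    also have "\<dots> = (LINT y|lebesgue. (if y \<in> {a<..<b} then f y * indicator {x<..} y else 0))"
    proof (rule integral_cong_AE)
      show "(\<lambda>y. indicator {x<..} y * g y) \<in> borel_measurable lebesgue"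
        using gx by (intro measurable_completion) auto
      have "(\<lambda>y. ?f y * indicator {x<..} y) \<in> borel_measurable lebesgue"
        using f' by (intro borel_measurable_times) (auto intro: measurable_completion)
      also have "(\<lambda>y. ?f y * indicator {x<..} y) = (\<lambda>y. if y \<in> {a<..<b} then f y * indicator {x<..} y else 0)"
        by auto
      finally show "(\<lambda>y. if y \<in> {a<..<b} then f y * indicator {x<..} y else 0) \<in> borel_measurable lebesgue" .
      show "AE y in lebesgue. indicator {x<..} y * g y = (if y \<in> {a<..<b} then f y * indicator {x<..} y else 0)"
        using AE_completion[OF g(2)] by eventually_elim (auto simp: indicator_def split: if_splits)
    qed
    also have "\<dots> = 0"
      by (rule trans[OF Lebesgue_Measure.integral_restrict_UNIV integral_ray_eq_0[OF ab f z]]) auto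
    finally have 0: "(LINT y|lborel. indicator {x<..} y * g y) = 0" .
    have M: "emeasure ?M {x<..} = (\<integral>\<^sup>+y. ennreal (indicator {x<..} y * g y) \<partial>lborel)"
      using g(1) by (subst emeasure_density) (auto intro!: nn_integral_cong simp: indicator_def)
    have N: "emeasure ?N {x<..} = (\<integral>\<^sup>+y. ennreal (- (indicator {x<..} y * g y)) \<partial>lborel)"
      using g(1) by (subst emeasure_density) (auto intro!: nn_integral_cong simp: indicator_def)
    have finM: "(\<integral>\<^sup>+y. ennreal (indicator {x<..} y * g y) \<partial>lborel) < \<infinity>"
      by (rule le_less_trans[OF nn_integral_mono fin]) (auto simp: indicator_def intro!: ennreal_leI)
    have finN: "(\<integral>\<^sup>+y. ennreal (- (indicator {x<..} y * g y)) \<partial>lborel) < \<infinity>"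
      by (rule le_less_trans[OF nn_integral_mono fin]) (auto simp: indicator_def intro!: ennreal_leI)
    show "emeasure ?M {x<..} < \<infinity>" using M finM by simp
    show "emeasure ?M {x<..} = emeasure ?N {x<..}"
    proof -
      have "enn2real (emeasure ?M {x<..}) = enn2real (emeasure ?N {x<..})"
        using 0 unfolding M N real_lebesgue_integral_def[OF gx] by simp
      then show ?thesis
        using finM finN M N ennreal_enn2real by (metis infinity_ennreal_def)
    qed
  qed
  have "?M = ?N"
    by (rule measure_eqI_lessThan) (use ray in auto)
  then have "AE x in lborel. ennreal (g x) = ennreal (- g x)"
    using g(1) by (intro sigma_finite_measure.density_unique[OF sigma_finite_lborel]) auto
  \<comment> \<open>\<open>ennreal\<close> truncates negative numbers to 0, so one of the two sides
    is 0 and therefore both are.\<close>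
  then have "AE x in lborel. g x = 0"
    by eventually_elim (metis ennreal_eq_0_iff ennreal_inj linorder_le_cases neg_le_0_iff_le neg_0_le_iff_le antisym)
  then have "AE x in lebesgue. ?f x = 0"
    using g(2) by (intro AE_completion) (auto elim: eventually_elim2)
  then show ?thesis
    by (simp add: AE_restrict_space_iff) (auto elim: eventually_mono)
qed

section \<open>The space \<open>H\<^sub>0\<^sup>1\<close> of a bounded interval\<close>

locale bounded_interval =
  fixes a b :: real
  assumes ab: "a < b"
begin

abbreviation "\<Omega> \<equiv> {a<..<b}"

lemma Omega_lmeasurable: "\<Omega> \<in> lmeasurable"
  by simp

lemma test_L2: "\<phi> \<in> test_functions \<Omega> \<Longrightarrow> \<phi> \<in> L2 \<Omega>" "\<phi> \<in> test_functions \<Omega> \<Longrightarrow> deriv \<phi> \<in> L2 \<Omega>"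
  by (auto intro: test_function_L2 test_function_deriv_L2)

lemma weak_deriv_unique:
  assumes "g \<in> L2 \<Omega>" "g' \<in> L2 \<Omega>" "weak_deriv \<Omega> u g" "weak_deriv \<Omega> u g'"
  shows "AE x in lebesgue_on \<Omega>. g x = g' x"
proof -
  have "AE x in lebesgue_on \<Omega>. g x - g' x = 0"
  proof (rule weak_zero_imp_AE_zero[OF ab])
    show "integrable (lebesgue_on \<Omega>) (\<lambda>x. g x - g' x)"
      by (rule L2_integrable[OF Omega_lmeasurable L2_diff]) (use assms in auto)
    fix \<phi> assume \<phi>: "\<phi> \<in> test_functions \<Omega>"
    have "(LINT x|lebesgue_on \<Omega>. (g x - g' x) * \<phi> x)
        = (LINT x|lebesgue_on \<Omega>. g x * \<phi> x) - (LINT x|lebesgue_on \<Omega>. g' x * \<phi> x)"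
      using L2_mult_integrable[OF assms(1) test_L2(1)[OF \<phi>]] L2_mult_integrable[OF assms(2) test_L2(1)[OF \<phi>]]
      by (simp add: left_diff_distrib)
    also have "\<dots> = 0" using assms(3,4) \<phi> by (simp add: weak_deriv_def)
    finally show "(LINT x|lebesgue_on \<Omega>. (g x - g' x) * \<phi> x) = 0" .
  qed
  then show ?thesis by eventually_elim simp
qed

text \<open>\<open>D\<close> is an arbitrary choice. By uniqueness any explicitly known weak
  derivative has the same norm, which is how norms get computed.\<close>

lemma D_props:
  assumes "g \<in> L2 \<Omega>" "weak_deriv \<Omega> u g"
  shows "D \<Omega> u \<in> L2 \<Omega>" "weak_deriv \<Omega> u (D \<Omega> u)" "AE x in lebesgue_on \<Omega>. D \<Omega> u x = g x"
    "H01_norm \<Omega> u = L2_norm \<Omega> g"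
proof -
  have *: "D \<Omega> u \<in> L2 \<Omega> \<and> weak_deriv \<Omega> u (D \<Omega> u)"
    unfolding D_def by (rule someI[where x = g]) (use assms in auto)
  then show "D \<Omega> u \<in> L2 \<Omega>" "weak_deriv \<Omega> u (D \<Omega> u)" by auto
  then show "AE x in lebesgue_on \<Omega>. D \<Omega> u x = g x"
    using weak_deriv_unique assms by blast
  then show "H01_norm \<Omega> u = L2_norm \<Omega> g"
    unfolding H01_norm_def using * assms by (intro L2_norm_cong_AE) auto
qed

lemma H01_norm_nonneg [simp]: "0 \<le> H01_norm \<Omega> u"
  by (simp add: H01_norm_def)

lemma weak_deriv_limit:
  assumes u: "u \<in> L2 \<Omega>" and g: "g \<in> L2 \<Omega>"
    and v: "\<And>n. v n \<in> L2 \<Omega>" "\<And>n. v' n \<in> L2 \<Omega>" "\<And>n. weak_deriv \<Omega> (v n) (v' n)"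
    and lim: "(\<lambda>n. L2_norm \<Omega> (\<lambda>x. v n x - u x)) \<longlonglongrightarrow> 0" "(\<lambda>n. L2_norm \<Omega> (\<lambda>x. v' n x - g x)) \<longlonglongrightarrow> 0"
  shows "weak_deriv \<Omega> u g"
  unfolding weak_deriv_def
proof
  fix \<psi> assume \<psi>: "\<psi> \<in> test_functions \<Omega>"
  have "(\<lambda>n. LINT x|lebesgue_on \<Omega>. v n x * deriv \<psi> x) \<longlonglongrightarrow> (LINT x|lebesgue_on \<Omega>. u x * deriv \<psi> x)"
    by (intro L2_inner_tendsto test_L2 \<psi> u v lim)
  moreover have "(\<lambda>n. - (LINT x|lebesgue_on \<Omega>. v' n x * \<psi> x)) \<longlonglongrightarrow> - (LINT x|lebesgue_on \<Omega>. g x * \<psi> x)"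
    by (intro tendsto_minus L2_inner_tendsto test_L2 \<psi> g v lim)
  ultimately show "(LINT x|lebesgue_on \<Omega>. u x * deriv \<psi> x) = - (LINT x|lebesgue_on \<Omega>. g x * \<psi> x)"
    using v(3) \<psi> by (simp add: weak_deriv_def LIMSEQ_unique)
qed

lemma continuous_on_Icc_L2:
  assumes "continuous_on {a..b} f"
  shows "f \<in> L2 \<Omega>"
proof -
  have "bounded (f ` {a..b})" using assms by (intro compact_imp_bounded compact_continuous_image) auto
  then obtain B where B: "\<forall>x\<in>{a..b}. \<bar>f x\<bar> \<le> B" by (auto simp: bounded_iff)
  have "continuous_on \<Omega> f" using assms by (rule continuous_on_subset) auto
  then have "f \<in> borel_measurable (lebesgue_on \<Omega>)"
    by (rule continuous_imp_measurable_on_sets_lebesgue) auto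
  with B show ?thesis
    by (intro bounded_L2[of _ _ B]) auto
qed

text \<open>The finite set S accommodates kinks, such as those of time sections of piecewise
  bilinear functions. No boundary terms remain because \<phi> vanishes near the endpoints.\<close>

lemma integration_by_parts_test:
  assumes S: "finite S" and f: "continuous_on {a..b} f"
    and f': "\<And>x. x \<in> \<Omega> - S \<Longrightarrow> (f has_real_derivative f' x) (at x)" "f' \<in> L2 \<Omega>"
    and \<phi>: "\<phi> \<in> test_functions \<Omega>"
  shows "(LINT x|lebesgue_on \<Omega>. f x * deriv \<phi> x) = - (LINT x|lebesgue_on \<Omega>. f' x * \<phi> x)"
proof -
  obtain s t where st: "a < s" "s \<le> t" "t < b" "smooth \<phi>" "\<And>x. x \<notin> {s..t} \<Longrightarrow> \<phi> x = 0"
    using test_functionsD[OF \<phi> ab] by metis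
  have fi: "integrable (lebesgue_on \<Omega>) (\<lambda>x. f x * deriv \<phi> x)" "integrable (lebesgue_on \<Omega>) (\<lambda>x. f' x * \<phi> x)"
    by (intro L2_mult_integrable continuous_on_Icc_L2 f f' test_L2 \<phi>)+
  have "((\<lambda>x. f' x * \<phi> x + f x * deriv \<phi> x) has_integral f b * \<phi> b - f a * \<phi> a) {a..b}"
  proof (rule fundamental_theorem_of_calculus_interior_strong[OF S])
    show "continuous_on {a..b} (\<lambda>x. f x * \<phi> x)"
      by (intro continuous_on_mult f smooth_continuous st(4))
    fix x assume "x \<in> \<Omega> - S"
    from DERIV_mult[OF f'(1)[OF this] smooth_DERIV[OF st(4)]]
    show "((\<lambda>x. f x * \<phi> x) has_vector_derivative f' x * \<phi> x + f x * deriv \<phi> x) (at x)"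
      by (simp add: mult.commute flip: has_real_derivative_iff_has_vector_derivative)
  qed (use ab in auto)
  then have "((\<lambda>x. f' x * \<phi> x + f x * deriv \<phi> x) has_integral 0) \<Omega>"
    using st by (simp add: has_integral_Icc_iff_Ioo)
  moreover have "((\<lambda>x. f' x * \<phi> x + f x * deriv \<phi> x) has_integral
      (LINT x|lebesgue_on \<Omega>. f' x * \<phi> x + f x * deriv \<phi> x)) \<Omega>"
    using fi by (intro has_integral_integral_lebesgue_on) auto
  ultimately have "(LINT x|lebesgue_on \<Omega>. f' x * \<phi> x + f x * deriv \<phi> x) = 0"
    by (rule has_integral_unique[symmetric])
  then show ?thesis using fi by simp
qed

lemma weak_deriv_test: "\<phi> \<in> test_functions \<Omega> \<Longrightarrow> weak_deriv \<Omega> \<phi> (deriv \<phi>)"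
  unfolding weak_deriv_def
  by (intro ballI integration_by_parts_test[where S = "{}"] test_L2)
     (auto intro: smooth_continuous smooth_DERIV test_functions_smooth)

text \<open>Weak differentiability of u is a conclusion here: the relation between a function and
  its weak derivative survives limits in \<open>L2\<close>.\<close>

lemma H01I:
  assumes u: "u \<in> L2 \<Omega>" and g: "g \<in> L2 \<Omega>"
    and \<phi>: "\<And>n. \<phi> n \<in> test_functions \<Omega>"
    and lim: "(\<lambda>n. L2_norm \<Omega> (\<lambda>x. \<phi> n x - u x)) \<longlonglongrightarrow> 0"
      "(\<lambda>n. L2_norm \<Omega> (\<lambda>x. deriv (\<phi> n) x - g x)) \<longlonglongrightarrow> 0"
  shows "u \<in> H01 \<Omega>" "weak_deriv \<Omega> u g" "H01_norm \<Omega> u = L2_norm \<Omega> g"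
proof -
  show w: "weak_deriv \<Omega> u g"
    by (rule weak_deriv_limit[OF u g _ _ _ lim]) (auto intro: test_L2 \<phi> weak_deriv_test)
  note Du = D_props[OF g w]
  show "H01_norm \<Omega> u = L2_norm \<Omega> g" by (rule Du)
  have "L2_norm \<Omega> (\<lambda>x. deriv (\<phi> n) x - D \<Omega> u x) = L2_norm \<Omega> (\<lambda>x. deriv (\<phi> n) x - g x)" for n
    by (rule L2_norm_cong_AE) (use Du(3) L2_diff[OF test_L2(2)[OF \<phi>] Du(1)] L2_diff[OF test_L2(2)[OF \<phi>] g] in auto)
  then show "u \<in> H01 \<Omega>"
    unfolding H01_def H1_def using u g w \<phi> lim by (auto intro!: exI[of _ \<phi>])
qed

lemma H01D:
  assumes "u \<in> H01 \<Omega>"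
  shows "u \<in> L2 \<Omega>" "D \<Omega> u \<in> L2 \<Omega>" "weak_deriv \<Omega> u (D \<Omega> u)"
    "\<exists>\<phi>. (\<forall>n. \<phi> n \<in> test_functions \<Omega>) \<and> (\<lambda>n. L2_norm \<Omega> (\<lambda>x. \<phi> n x - u x)) \<longlonglongrightarrow> 0 \<and>
     (\<lambda>n. L2_norm \<Omega> (\<lambda>x. deriv (\<phi> n) x - D \<Omega> u x)) \<longlonglongrightarrow> 0"
proof -
  obtain g where "g \<in> L2 \<Omega>" "weak_deriv \<Omega> u g" using assms by (auto simp: H01_def H1_def)
  from D_props[OF this] show "D \<Omega> u \<in> L2 \<Omega>" "weak_deriv \<Omega> u (D \<Omega> u)" by auto
qed (use assms in \<open>auto simp: H01_def H1_def\<close>)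

lemma L2_norm_lincomb_tendsto:
  assumes "\<And>n. f n \<in> L2 S" "\<And>n. g n \<in> L2 S" "f' \<in> L2 S" "g' \<in> L2 S"
    "(\<lambda>n. L2_norm S (\<lambda>x. f n x - f' x)) \<longlonglongrightarrow> 0" "(\<lambda>n. L2_norm S (\<lambda>x. g n x - g' x)) \<longlonglongrightarrow> 0"
  shows "(\<lambda>n. L2_norm S (\<lambda>x. (r * f n x + s * g n x) - (r * f' x + s * g' x))) \<longlonglongrightarrow> 0"
proof (rule Lim_null_comparison)
  have eq: "(\<lambda>x. (r * f n x + s * g n x) - (r * f' x + s * g' x)) = (\<lambda>x. r * (f n x - f' x) + s * (g n x - g' x))" for n
    by (auto simp: algebra_simps)
  have "L2_norm S (\<lambda>x. (r * f n x + s * g n x) - (r * f' x + s * g' x))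
     \<le> \<bar>r\<bar> * L2_norm S (\<lambda>x. f n x - f' x) + \<bar>s\<bar> * L2_norm S (\<lambda>x. g n x - g' x)" for n
    using L2_norm_triangle[OF L2_scale[OF L2_diff[OF assms(1)[of n] assms(3)], of r] L2_scale[OF L2_diff[OF assms(2)[of n] assms(4)], of s]]
    unfolding eq by (simp only: L2_norm_scale)
  then show "\<forall>\<^sub>F n in sequentially. norm (L2_norm S (\<lambda>x. (r * f n x + s * g n x) - (r * f' x + s * g' x)))
     \<le> \<bar>r\<bar> * L2_norm S (\<lambda>x. f n x - f' x) + \<bar>s\<bar> * L2_norm S (\<lambda>x. g n x - g' x)" by simp
  show "(\<lambda>n. \<bar>r\<bar> * L2_norm S (\<lambda>x. f n x - f' x) + \<bar>s\<bar> * L2_norm S (\<lambda>x. g n x - g' x)) \<longlonglongrightarrow> 0"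
    using assms(5,6) by (auto intro!: tendsto_eq_intros)
qed

lemma H01_lincomb:
  assumes u: "u \<in> H01 \<Omega>" and v: "v \<in> H01 \<Omega>"
  shows "(\<lambda>x. r * u x + s * v x) \<in> H01 \<Omega>"
    "H01_norm \<Omega> (\<lambda>x. r * u x + s * v x) = L2_norm \<Omega> (\<lambda>x. r * D \<Omega> u x + s * D \<Omega> v x)"
proof -
  note u = H01D[OF u] and v = H01D[OF v]
  obtain \<phi> where \<phi>: "\<And>n. \<phi> n \<in> test_functions \<Omega>" "(\<lambda>n. L2_norm \<Omega> (\<lambda>x. \<phi> n x - u x)) \<longlonglongrightarrow> 0"
     "(\<lambda>n. L2_norm \<Omega> (\<lambda>x. deriv (\<phi> n) x - D \<Omega> u x)) \<longlonglongrightarrow> 0" using u(4) by blast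
  obtain \<psi> where \<psi>: "\<And>n. \<psi> n \<in> test_functions \<Omega>" "(\<lambda>n. L2_norm \<Omega> (\<lambda>x. \<psi> n x - v x)) \<longlonglongrightarrow> 0"
     "(\<lambda>n. L2_norm \<Omega> (\<lambda>x. deriv (\<psi> n) x - D \<Omega> v x)) \<longlonglongrightarrow> 0" using v(4) by blast
  have T: "(\<lambda>x. r * \<phi> n x + s * \<psi> n x) \<in> test_functions \<Omega>" for n
    by (intro test_functions_lincomb \<phi> \<psi> ab)
  have l1: "(\<lambda>n. L2_norm \<Omega> (\<lambda>x. (r * \<phi> n x + s * \<psi> n x) - (r * u x + s * v x))) \<longlonglongrightarrow> 0"
    by (intro L2_norm_lincomb_tendsto test_L2 \<phi> \<psi> u v)
  have l2: "(\<lambda>n. L2_norm \<Omega> (\<lambda>x. (r * deriv (\<phi> n) x + s * deriv (\<psi> n) x) - (r * D \<Omega> u x + s * D \<Omega> v x))) \<longlonglongrightarrow> 0"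
    by (intro L2_norm_lincomb_tendsto test_L2 \<phi> \<psi> u v)
  have d: "deriv (\<lambda>x. r * \<phi> n x + s * \<psi> n x) = (\<lambda>x. r * deriv (\<phi> n) x + s * deriv (\<psi> n) x)" for n
    by (intro ext deriv_lincomb test_functions_smooth[OF \<phi>(1)] test_functions_smooth[OF \<psi>(1)])
  have "(\<lambda>x. r * u x + s * v x) \<in> L2 \<Omega>" "(\<lambda>x. r * D \<Omega> u x + s * D \<Omega> v x) \<in> L2 \<Omega>"
    by (intro L2_lincomb u v)+
  from H01I[OF this T l1] l2 show "(\<lambda>x. r * u x + s * v x) \<in> H01 \<Omega>"
    "H01_norm \<Omega> (\<lambda>x. r * u x + s * v x) = L2_norm \<Omega> (\<lambda>x. r * D \<Omega> u x + s * D \<Omega> v x)"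
    by (auto simp: d)
qed

lemma H01_test: "\<phi> \<in> test_functions \<Omega> \<Longrightarrow> \<phi> \<in> H01 \<Omega>"
  by (rule H01I(1)[of \<phi> "deriv \<phi>" "\<lambda>_. \<phi>"]) (auto intro: test_L2 simp: L2_norm_def)

lemma H01_scale: "u \<in> H01 \<Omega> \<Longrightarrow> (\<lambda>x. r * u x) \<in> H01 \<Omega>"
  using H01_lincomb(1)[of u u r 0] by simp

lemma H01_norm_scale: "u \<in> H01 \<Omega> \<Longrightarrow> H01_norm \<Omega> (\<lambda>x. r * u x) = \<bar>r\<bar> * H01_norm \<Omega> u"
  using H01_lincomb(2)[of u u r 0] by (simp add: L2_norm_scale H01_norm_def)

lemma H01_diff: "u \<in> H01 \<Omega> \<Longrightarrow> v \<in> H01 \<Omega> \<Longrightarrow> (\<lambda>x. u x - v x) \<in> H01 \<Omega>"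
  using H01_lincomb(1)[of u v 1 "-1"] by simp

lemma H01_norm_diff:
  "u \<in> H01 \<Omega> \<Longrightarrow> v \<in> H01 \<Omega> \<Longrightarrow> H01_norm \<Omega> (\<lambda>x. u x - v x) = L2_norm \<Omega> (\<lambda>x. D \<Omega> u x - D \<Omega> v x)"
  using H01_lincomb(2)[of u v 1 "-1"] by simp

lemma H01_norm_ae_zero:
  assumes "u \<in> L2 \<Omega>" "ae_zero \<Omega> u"
  shows "H01_norm \<Omega> u = 0"
proof -
  have 0: "(\<lambda>_. 0) \<in> L2 \<Omega>" by (simp add: L2_def)
  have "weak_deriv \<Omega> u (\<lambda>_. 0)"
    unfolding weak_deriv_def
  proof
    fix \<phi> assume "\<phi> \<in> test_functions \<Omega>"
    have "(LINT x|lebesgue_on \<Omega>. u x * deriv \<phi> x) = 0"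
      using assms(2) by (intro integral_eq_zero_AE) (auto simp: ae_zero_def)
    then show "(LINT x|lebesgue_on \<Omega>. u x * deriv \<phi> x) = - (LINT x|lebesgue_on \<Omega>. 0 * \<phi> x)" by simp
  qed
  from D_props(4)[OF 0 this] show ?thesis by (simp add: L2_norm_def)
qed

text \<open>The one-dimensional Sobolev embedding into Hoelder functions of exponent 1/2: the
  fundamental theorem of calculus, then Cauchy-Schwarz against the indicator of (x, y), whose norm
  is sqrt(y - x).\<close>

lemma derivative_diff_bound:
  assumes S: "finite S" and f: "continuous_on {a..b} f" and f': "f' \<in> L2 \<Omega>"
    and d: "\<And>x. x \<in> \<Omega> - S \<Longrightarrow> (f has_real_derivative f' x) (at x)"
    and xy: "a \<le> x" "x \<le> y" "y \<le> b"
  shows "\<bar>f y - f x\<bar> \<le> sqrt (y - x) * L2_norm \<Omega> f'"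
proof -
  have ind: "indicat_real {x<..<y} \<in> L2 \<Omega>"
    by (rule indicator_L2) auto
  have sub: "{x<..<y} \<subseteq> \<Omega>" using xy by auto
  have norm: "L2_norm \<Omega> (indicat_real {x<..<y}) = sqrt (y - x)"
  proof -
    have "(LINT z|lebesgue_on \<Omega>. (indicat_real {x<..<y} z)\<^sup>2) = (LINT z|lebesgue_on \<Omega>. (if z \<in> {x<..<y} then 1 else 0))"
      by (intro Bochner_Integration.integral_cong) (auto simp: indicator_def)
    also have "\<dots> = (LINT z|lebesgue_on {x<..<y}. 1)"
      using sub by (intro Lebesgue_Measure.integral_restrict) auto
    also have "\<dots> = y - x"
      using xy by (simp add: measure_restrict_space)
    finally show ?thesis by (simp add: L2_norm_def)
  qed
  have e: "(\<lambda>z. indicator {x<..<y} z * f' z) = (\<lambda>z. if z \<in> {x<..<y} then f' z else 0)"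
    by (auto simp: indicator_def)
  have "integrable (lebesgue_on \<Omega>) (\<lambda>z. indicator {x<..<y} z * f' z)" by (rule L2_mult_integrable[OF ind f'])
  then have "((\<lambda>z. if z \<in> {x<..<y} then f' z else 0) has_integral (LINT z|lebesgue_on \<Omega>. indicator {x<..<y} z * f' z)) \<Omega>"
    unfolding e by (intro has_integral_integral_lebesgue_on) auto
  then have "(f' has_integral (LINT z|lebesgue_on \<Omega>. indicator {x<..<y} z * f' z)) {x<..<y}"
    using sub by (simp only: has_integral_restrict)
  moreover have "(f' has_integral f y - f x) {x..y}"
  proof (rule fundamental_theorem_of_calculus_interior_strong[OF S xy(2)])
    show "continuous_on {x..y} f" using f by (rule continuous_on_subset) (use xy in auto)
    show "(f has_vector_derivative f' z) (at z)" if "z \<in> {x<..<y} - S" for z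
      using d[of z] that sub by (auto simp flip: has_real_derivative_iff_has_vector_derivative)
  qed
  ultimately have "f y - f x = (LINT z|lebesgue_on \<Omega>. indicator {x<..<y} z * f' z)"
    unfolding has_integral_Icc_iff_Ioo by (auto intro: has_integral_unique)
  then show ?thesis
    using L2_Cauchy_Schwarz[OF ind f'] by (simp add: norm)
qed

lemma test_function_diff_bound:
  assumes \<phi>: "\<phi> \<in> test_functions \<Omega>" and "a \<le> x" "x \<le> y" "y \<le> b"
  shows "\<bar>\<phi> y - \<phi> x\<bar> \<le> sqrt (y - x) * L2_norm \<Omega> (deriv \<phi>)"
  using assms
  by (intro derivative_diff_bound[of "{}"] smooth_continuous test_functions_smooth[OF \<phi>] test_L2
      smooth_DERIV finite.emptyI)

text \<open>\<open>H01\<close> is a closure, so an estimate for test functions extends by limits: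
  the left side is continuous in the \<open>L2\<close> norm, the right side in the norm of the
  derivative. This avoids pointwise values of u.\<close>

lemma H01_functional_bound:
  assumes k: "k \<in> L2 \<Omega>" and u: "u \<in> H01 \<Omega>"
    and bnd: "\<And>\<phi>. \<phi> \<in> test_functions \<Omega> \<Longrightarrow> \<bar>LINT x|lebesgue_on \<Omega>. \<phi> x * k x\<bar> \<le> K * L2_norm \<Omega> (deriv \<phi>)"
  shows "\<bar>LINT x|lebesgue_on \<Omega>. u x * k x\<bar> \<le> K * H01_norm \<Omega> u"
proof -
  note u = H01D[OF u]
  obtain \<phi> where \<phi>: "\<And>n. \<phi> n \<in> test_functions \<Omega>" "(\<lambda>n. L2_norm \<Omega> (\<lambda>x. \<phi> n x - u x)) \<longlonglongrightarrow> 0"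
     "(\<lambda>n. L2_norm \<Omega> (\<lambda>x. deriv (\<phi> n) x - D \<Omega> u x)) \<longlonglongrightarrow> 0" using u(4) by blast
  have "(\<lambda>n. \<bar>LINT x|lebesgue_on \<Omega>. \<phi> n x * k x\<bar>) \<longlonglongrightarrow> \<bar>LINT x|lebesgue_on \<Omega>. u x * k x\<bar>"
    by (intro tendsto_rabs L2_inner_tendsto test_L2 \<phi> u k)
  moreover have "(\<lambda>n. K * L2_norm \<Omega> (deriv (\<phi> n))) \<longlonglongrightarrow> K * L2_norm \<Omega> (D \<Omega> u)"
    by (intro tendsto_mult_left L2_norm_tendsto test_L2 \<phi> u)
  ultimately show ?thesis
    unfolding H01_norm_def by (rule LIMSEQ_le) (use bnd \<phi>(1) in auto)
qed

text \<open>Poincare's inequality in dual form. One factor sqrt(b - a) bounds \<phi> pointwise,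
  starting from \<phi>(a) = 0; the other comes from integrating over the interval.\<close>

lemma Poincare_functional:
  assumes k: "k \<in> L2 \<Omega>" and u: "u \<in> H01 \<Omega>"
  shows "\<bar>LINT x|lebesgue_on \<Omega>. u x * k x\<bar> \<le> (b - a) * L2_norm \<Omega> k * H01_norm \<Omega> u"
proof (rule H01_functional_bound[OF k u])
  fix \<phi> assume \<phi>: "\<phi> \<in> test_functions \<Omega>"
  have "\<phi> a = 0" using test_functionsD[OF \<phi> ab] by (metis atLeastAtMost_iff not_less)
  have "\<bar>\<phi> x\<bar> \<le> sqrt (b - a) * L2_norm \<Omega> (deriv \<phi>)" if "x \<in> \<Omega>" for x
  proof -
    have "\<bar>\<phi> x\<bar> \<le> sqrt (x - a) * L2_norm \<Omega> (deriv \<phi>)"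
      using test_function_diff_bound[OF \<phi>, of a x] that \<open>\<phi> a = 0\<close> by simp
    also have "\<dots> \<le> sqrt (b - a) * L2_norm \<Omega> (deriv \<phi>)"
      using that by (intro mult_right_mono) auto
    finally show ?thesis .
  qed
  then have "L2_norm \<Omega> \<phi> \<le> sqrt (b - a) * L2_norm \<Omega> (deriv \<phi>) * sqrt (measure lebesgue \<Omega>)"
    using ab by (intro L2_norm_le_bound test_L2 \<phi>) auto
  also have "\<dots> = (b - a) * L2_norm \<Omega> (deriv \<phi>)"
    using ab by (simp add: mult.commute)
  finally have "L2_norm \<Omega> \<phi> * L2_norm \<Omega> k \<le> (b - a) * L2_norm \<Omega> (deriv \<phi>) * L2_norm \<Omega> k"
    by (intro mult_right_mono) auto
  with L2_Cauchy_Schwarz[OF test_L2(1)[OF \<phi>] k]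
  show "\<bar>LINT x|lebesgue_on \<Omega>. \<phi> x * k x\<bar> \<le> (b - a) * L2_norm \<Omega> k * L2_norm \<Omega> (deriv \<phi>)"
    by (simp add: algebra_simps)
qed

text \<open>Zero mean allows \<phi>(c) to be subtracted from \<phi>, and over the support of k the
  oscillation of \<phi> is at most sqrt(d - c) times the norm of its derivative. This square root is
  the whole gain of the discrete dual norm over the continuous one.\<close>

lemma mean_zero_functional_bound:
  assumes k: "k \<in> L2 \<Omega>" and u: "u \<in> H01 \<Omega>" and cd: "a \<le> c" "c \<le> d" "d \<le> b"
    and supp: "\<And>x. x \<in> \<Omega> - {c..d} \<Longrightarrow> k x = 0" and mean: "(LINT x|lebesgue_on \<Omega>. k x) = 0"
  shows "\<bar>LINT x|lebesgue_on \<Omega>. u x * k x\<bar> \<le> sqrt (d - c) * (LINT x|lebesgue_on \<Omega>. \<bar>k x\<bar>) * H01_norm \<Omega> u"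
proof (rule H01_functional_bound[OF k u])
  fix \<phi> assume \<phi>: "\<phi> \<in> test_functions \<Omega>"
  have ki: "integrable (lebesgue_on \<Omega>) k" by (intro L2_integrable k) auto
  let ?K = "sqrt (d - c) * L2_norm \<Omega> (deriv \<phi>)"
  have "(LINT x|lebesgue_on \<Omega>. \<phi> x * k x) = (LINT x|lebesgue_on \<Omega>. \<phi> x * k x) - \<phi> c * (LINT x|lebesgue_on \<Omega>. k x)"
    by (simp add: mean)
  also have "\<dots> = (LINT x|lebesgue_on \<Omega>. (\<phi> x - \<phi> c) * k x)"
    using L2_mult_integrable[OF test_L2(1)[OF \<phi>] k] ki by (simp add: left_diff_distrib)
  also have "\<bar>\<dots>\<bar> \<le> (LINT x|lebesgue_on \<Omega>. \<bar>(\<phi> x - \<phi> c) * k x\<bar>)"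
    by (rule integral_abs_bound)
  also have "\<dots> \<le> (LINT x|lebesgue_on \<Omega>. ?K * \<bar>k x\<bar>)"
  proof (rule integral_mono)
    show "integrable (lebesgue_on \<Omega>) (\<lambda>x. \<bar>(\<phi> x - \<phi> c) * k x\<bar>)"
      using L2_mult_integrable[OF test_L2(1)[OF \<phi>] k] ki by (auto simp: left_diff_distrib intro!: integrable_abs)
    show "integrable (lebesgue_on \<Omega>) (\<lambda>x. ?K * \<bar>k x\<bar>)" using ki by auto
    fix x assume x: "x \<in> space (lebesgue_on \<Omega>)"
    show "\<bar>(\<phi> x - \<phi> c) * k x\<bar> \<le> ?K * \<bar>k x\<bar>"
    proof (cases "x \<in> {c..d}")
      case True
      then have "\<bar>\<phi> x - \<phi> c\<bar> \<le> sqrt (x - c) * L2_norm \<Omega> (deriv \<phi>)"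
        using cd by (intro test_function_diff_bound \<phi>) auto
      also have "\<dots> \<le> ?K" using True by (intro mult_right_mono) auto
      finally show ?thesis unfolding abs_mult by (intro mult_right_mono) auto
    qed (use x supp in auto)
  qed
  finally show "\<bar>LINT x|lebesgue_on \<Omega>. \<phi> x * k x\<bar>
      \<le> sqrt (d - c) * (LINT x|lebesgue_on \<Omega>. \<bar>k x\<bar>) * L2_norm \<Omega> (deriv \<phi>)"
    by (simp add: algebra_simps)
qed

subsection \<open>Separability\<close>

text \<open>Derivatives are compared with step functions that have rational values on a uniform
  grid, of which there are countably many. For each of these and each tolerance one nearby test
  function is selected, if there is any; two functions near the same step function are near each
  other.\<close>

lemma test_functions_separable:
  obtains N :: "nat \<Rightarrow> real \<Rightarrow> real" where "\<And>n. N n \<in> test_functions \<Omega>"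
    "\<And>\<phi> e. \<phi> \<in> test_functions \<Omega> \<Longrightarrow> 0 < e \<Longrightarrow> \<exists>n. \<forall>x\<in>\<Omega>. \<bar>deriv \<phi> x - deriv (N n) x\<bar> < e"
proof -
  \<comment> \<open>\<open>qs\<close> lists the values on cells of length 1/m counted from a; in
    \<open>G\<close> the number k encodes the tolerance 1/(k + 1).\<close>
  define F :: "rat list \<Rightarrow> nat \<Rightarrow> real \<Rightarrow> real"
    where "F qs m x = real_of_rat (qs ! nat \<lfloor>(x - a) * real m\<rfloor>)" for qs m x
  define G where "G = (\<lambda>(qs, m, k) \<psi>. \<psi> \<in> test_functions \<Omega> \<and> (\<forall>x\<in>\<Omega>. \<bar>deriv \<psi> x - F qs m x\<bar> < 1 / real (Suc k)))"
  \<comment> \<open>Codes without a nearby test function are assigned the zero function, so that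
    every \<open>N n\<close> is admissible.\<close>
  define N where "N n = (if \<exists>\<psi>. G (from_nat n) \<psi> then SOME \<psi>. G (from_nat n) \<psi> else (\<lambda>_. 0))" for n
  have N: "G (from_nat n) (N n)" if "G (from_nat n) \<psi>" for n \<psi>
  proof -
    have e: "\<exists>\<psi>. G (from_nat n) \<psi>" using that by blast
    show ?thesis unfolding N_def if_P[OF e] using e by (rule someI_ex)
  qed
  have "smooth (\<lambda>_. 0)"
    using smooth_lincomb[OF smooth_bump[of 1 0 0] smooth_bump[of 1 0 0], of 0 0] by simp
  then have "(\<lambda>_. 0) \<in> test_functions \<Omega>"
    by (rule test_functionsI[of _ "(a+b)/2" "(a+b)/2"]) (use ab in \<open>auto simp: field_simps\<close>)
  then have "N n \<in> test_functions \<Omega>" for n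
    using N[of n] by (cases "\<exists>\<psi>. G (from_nat n) \<psi>") (auto simp: N_def G_def split: prod.splits)
  moreover have "\<exists>n. \<forall>x\<in>\<Omega>. \<bar>deriv \<phi> x - deriv (N n) x\<bar> < e" if \<phi>: "\<phi> \<in> test_functions \<Omega>" and e: "0 < e" for \<phi> e
  proof -
    obtain k where k: "1 / real (Suc k) < e / 2" using e nat_approx_posE[of "e / 2"] by auto
    let ?d = "1 / real (Suc k)"
    have "uniformly_continuous_on {a..b} (deriv \<phi>)"
      by (intro compact_uniformly_continuous smooth_continuous smooth_deriv test_functions_smooth[OF \<phi>]) auto
    then obtain \<eta> where \<eta>: "\<eta> > 0" "\<And>x y. x \<in> {a..b} \<Longrightarrow> y \<in> {a..b} \<Longrightarrow> dist y x < \<eta> \<Longrightarrow> dist (deriv \<phi> y) (deriv \<phi> x) < ?d / 2"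
      unfolding uniformly_continuous_on_def by (metis half_gt_zero_iff of_nat_0_less_iff zero_less_Suc zero_less_divide_1_iff)
    obtain m where m: "1 / real (Suc m) < \<eta>" using \<eta>(1) nat_approx_posE by blast
    let ?m = "real (Suc m)"
    have "\<exists>q. \<bar>real_of_rat q - deriv \<phi> (a + real i / ?m)\<bar> < ?d / 2" for i :: nat
    proof -
      let ?y = "deriv \<phi> (a + real i / ?m)"
      obtain r where "?y < real_of_rat r" "real_of_rat r < ?y + ?d / 2"
        using of_rat_dense[of ?y "?y + ?d / 2"] by auto
      then have "\<bar>real_of_rat r - ?y\<bar> < ?d / 2" by linarith
      then show ?thesis by blast
    qed
    then obtain q where q: "\<And>i. \<bar>real_of_rat (q i) - deriv \<phi> (a + real i / ?m)\<bar> < ?d / 2" by metis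
    \<comment> \<open>One value for each grid point up to b, so that the index computed in
      \<open>F\<close> stays within the list.\<close>
    define qs where "qs = map q [0..<Suc (nat \<lfloor>(b - a) * ?m\<rfloor>)]"
    have F: "\<bar>deriv \<phi> x - F qs (Suc m) x\<bar> < ?d" if x: "x \<in> \<Omega>" for x
    proof -
      define i where "i = nat \<lfloor>(x - a) * ?m\<rfloor>"
      have pos: "0 \<le> (x - a) * ?m" using x by auto
      have i: "real i \<le> (x - a) * ?m" "(x - a) * ?m < real i + 1"
        using pos by (auto simp: i_def)
      have "i \<le> nat \<lfloor>(b - a) * ?m\<rfloor>" unfolding i_def using x by (intro nat_mono floor_mono mult_right_mono) auto
      then have "qs ! i = q i" by (auto simp: qs_def simp del: upt_Suc)
      then have Fq: "F qs (Suc m) x = real_of_rat (q i)" by (simp add: F_def i_def)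
      have i': "real i / ?m \<le> x - a" "x - a < (real i + 1) / ?m"
        using i by (auto simp: pos_divide_le_eq pos_less_divide_eq)
      then have "dist x (a + real i / ?m) < \<eta>" using m by (auto simp: dist_real_def add_divide_distrib)
      moreover have "a + real i / ?m \<in> {a..b}" using i' x by (auto intro: order_trans)
      ultimately have "dist (deriv \<phi> x) (deriv \<phi> (a + real i / ?m)) < ?d / 2"
        using x by (intro \<eta>(2)) auto
      moreover have "\<bar>A - C\<bar> < e" if "\<bar>A - B\<bar> < e / 2" "\<bar>C - B\<bar> < e / 2" for A B C e :: real
        using that by linarith
      ultimately show ?thesis using q[of i] unfolding Fq dist_real_def by blast
    qed
    let ?n = "to_nat (qs, Suc m, k)"
    have "G (from_nat ?n) \<phi>" using \<phi> F by (simp add: G_def)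
    from N[OF this] have "\<forall>x\<in>\<Omega>. \<bar>deriv (N ?n) x - F qs (Suc m) x\<bar> < ?d" by (simp add: G_def)
    then have "\<forall>x\<in>\<Omega>. \<bar>deriv \<phi> x - deriv (N ?n) x\<bar> < e" using F k by (smt (verit) field_sum_of_halves)
    then show ?thesis by blast
  qed
  ultimately show ?thesis using that by blast
qed

lemma H01_separable:
  obtains N :: "nat \<Rightarrow> real \<Rightarrow> real" where "\<And>n. N n \<in> H01 \<Omega>"
    "\<And>u e. u \<in> H01 \<Omega> \<Longrightarrow> 0 < e \<Longrightarrow> \<exists>n. H01_norm \<Omega> (\<lambda>x. u x - N n x) < e"
proof -
  obtain N :: "nat \<Rightarrow> real \<Rightarrow> real" where N: "\<And>n. N n \<in> test_functions \<Omega>"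
    "\<And>\<phi> e. \<phi> \<in> test_functions \<Omega> \<Longrightarrow> 0 < e \<Longrightarrow> \<exists>n. \<forall>x\<in>\<Omega>. \<bar>deriv \<phi> x - deriv (N n) x\<bar> < e"
    using test_functions_separable by metis
  have "\<exists>n. H01_norm \<Omega> (\<lambda>x. u x - N n x) < e" if uH: "u \<in> H01 \<Omega>" and e: "0 < e" for u e
  proof -
    note u = H01D[OF uH]
    obtain \<phi> where \<phi>: "\<And>n. \<phi> n \<in> test_functions \<Omega>" "(\<lambda>n. L2_norm \<Omega> (\<lambda>x. deriv (\<phi> n) x - D \<Omega> u x)) \<longlonglongrightarrow> 0"
      using u(4) by blast
    obtain m where m: "L2_norm \<Omega> (\<lambda>x. deriv (\<phi> m) x - D \<Omega> u x) < e / 2"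
      using order_tendstoD(2)[OF \<phi>(2), of "e/2"] e by (auto simp: eventually_sequentially)
    \<comment> \<open>A uniform error e' on an interval of length b - a has \<open>L2\<close> norm
      at most e/2.\<close>
    define e' where "e' = e / (2 * sqrt (b - a))"
    have "e' > 0" using e ab by (simp add: e'_def)
    then obtain n where n: "\<forall>x\<in>\<Omega>. \<bar>deriv (\<phi> m) x - deriv (N n) x\<bar> < e'" using N(2)[OF \<phi>(1)] by blast
    have "L2_norm \<Omega> (\<lambda>x. deriv (\<phi> m) x - deriv (N n) x) \<le> e' * sqrt (measure lebesgue \<Omega>)"
      using n \<open>e' > 0\<close> by (intro L2_norm_le_bound L2_diff test_L2 \<phi> N) (auto intro: less_imp_le)
    also have "\<dots> = e / 2" using ab by (simp add: e'_def)
    finally have 2: "L2_norm \<Omega> (\<lambda>x. deriv (\<phi> m) x - deriv (N n) x) \<le> e / 2" .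
    have Nw: "weak_deriv \<Omega> (N n) (deriv (N n))" "deriv (N n) \<in> L2 \<Omega>" using N weak_deriv_test test_L2 by auto
    have "H01_norm \<Omega> (\<lambda>x. u x - N n x) = L2_norm \<Omega> (\<lambda>x. D \<Omega> u x - D \<Omega> (N n) x)"
      by (intro H01_norm_diff uH H01_test N)
    also have "\<dots> = L2_norm \<Omega> (\<lambda>x. (D \<Omega> u x - deriv (\<phi> m) x) + (deriv (\<phi> m) x - deriv (N n) x))"
      using D_props(3)[OF Nw(2,1)] by (intro L2_norm_cong_AE L2_diff L2_add u D_props(1)[OF Nw(2,1)] Nw test_L2 \<phi>) auto
    also have "\<dots> \<le> L2_norm \<Omega> (\<lambda>x. D \<Omega> u x - deriv (\<phi> m) x) + L2_norm \<Omega> (\<lambda>x. deriv (\<phi> m) x - deriv (N n) x)"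
      by (intro L2_norm_triangle L2_diff u Nw test_L2 \<phi>)
    also have "\<dots> < e / 2 + e / 2"
      using m 2 L2_norm_diff_commute[of \<Omega> "D \<Omega> u" "deriv (\<phi> m)"] by linarith
    finally show ?thesis by auto
  qed
  with N(1) H01_test that show ?thesis by blast
qed

end

section \<open>Fubini's theorem for Lebesgue measurable functions on rectangles\<close>

text \<open>Completeness of Lebesgue measure: altering a function on a null set keeps it
  measurable.\<close>

lemma lebesgue_on_measurable_AE:
  fixes f g :: "'a::euclidean_space \<Rightarrow> real"
  assumes S: "S \<in> sets lebesgue" and f: "f \<in> borel_measurable (lebesgue_on S)"
    and eq: "AE x in lebesgue_on S. f x = g x"
  shows "g \<in> borel_measurable (lebesgue_on S)"
proof -
  have "(\<lambda>x. if x \<in> S then f x else 0) \<in> borel_measurable lebesgue"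
    using f S by (simp add: borel_measurable_if)
  moreover have "AE x in lebesgue. (if x \<in> S then f x else 0) = (if x \<in> S then g x else 0)"
    using eq S by (auto simp: AE_restrict_space_iff elim: eventually_mono)
  ultimately have "(\<lambda>x. if x \<in> S then g x else 0) \<in> borel_measurable lebesgue"
    by (rule borel_measurable_AE)
  then show ?thesis using S by (simp add: borel_measurable_if)
qed

lemma lebesgue_on_integrable_AE:
  fixes f g :: "'a::euclidean_space \<Rightarrow> real"
  assumes S: "S \<in> sets lebesgue" and f: "integrable (lebesgue_on S) f"
    and eq: "AE x in lebesgue_on S. f x = g x"
  shows "integrable (lebesgue_on S) g"
  by (rule integrable_cong_AE_imp[OF f])
     (use lebesgue_on_measurable_AE[OF S _ eq] f eq in \<open>auto elim: eventually_mono\<close>)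

text \<open>Neither function is assumed measurable: both are integrable or neither is, and in the
  latter case both integrals are 0. Pairings such as \<open>g t (slice v t)\<close> can thus be
  exchanged along an almost everywhere identity.\<close>

lemma lebesgue_on_integral_cong_AE:
  fixes f g :: "'a::euclidean_space \<Rightarrow> real"
  assumes S: "S \<in> sets lebesgue" and eq: "AE x in lebesgue_on S. f x = g x"
  shows "(LINT x|lebesgue_on S. f x) = (LINT x|lebesgue_on S. g x)"
proof (cases "integrable (lebesgue_on S) f")
  case True
  then show ?thesis using lebesgue_on_integrable_AE[OF S True eq] eq
    by (intro integral_cong_AE) auto
next
  case False
  moreover have "\<not> integrable (lebesgue_on S) g"
    using False lebesgue_on_integrable_AE[OF S, of g f] eq by (auto simp: eq_commute)
  ultimately show ?thesis by (simp add: not_integrable_integral_eq)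
qed

lemma AE_lebesgue_on_Times:
  fixes S T :: "real set"
  assumes [measurable]: "S \<in> sets borel" "T \<in> sets borel" and P: "AE z in lebesgue_on (S \<times> T). P z"
  shows "AE t in lebesgue_on S. AE x in lebesgue_on T. P (t, x)"
proof -
  have ST: "S \<times> T \<in> sets borel" by (intro borel_Times) auto
  have "AE z in lebesgue. z \<in> S \<times> T \<longrightarrow> P z"
    using P ST by (simp add: AE_restrict_space_iff)
  then have "AE z in lborel \<Otimes>\<^sub>M lborel. z \<in> S \<times> T \<longrightarrow> P z"
    unfolding lborel_prod by (simp add: AE_completion_iff)
  then have "AE t in lborel. AE x in lborel. (t, x) \<in> S \<times> T \<longrightarrow> P (t, x)"
    by (rule lborel_pair.AE_pair)
  then have "AE t in lebesgue. AE x in lebesgue. (t, x) \<in> S \<times> T \<longrightarrow> P (t, x)"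
    by (simp add: AE_completion_iff)
  then show ?thesis
    by (simp add: AE_restrict_space_iff) (auto elim!: eventually_mono)
qed

text \<open>Lebesgue measure on the plane is the completion of the product measure, so sections of f
  are under control only for almost every t. A Borel version g of the extension by zero carries the
  product theorem.\<close>

lemma Fubini_lebesgue_on:
  fixes S T :: "real set" and f :: "real \<times> real \<Rightarrow> real"
  assumes [measurable]: "S \<in> sets borel" "T \<in> sets borel"
    and f: "integrable (lebesgue_on (S \<times> T)) f"
  shows "AE t in lebesgue_on S. integrable (lebesgue_on T) (\<lambda>x. f (t, x))"
    "integrable (lebesgue_on S) (\<lambda>t. LINT x|lebesgue_on T. f (t, x))"
    "(LINT z|lebesgue_on (S \<times> T). f z) = (LINT t|lebesgue_on S. LINT x|lebesgue_on T. f (t, x))"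
proof -
  have ST: "S \<times> T \<in> sets lebesgue" "S \<in> sets lebesgue" "T \<in> sets lebesgue"
    by (auto intro!: sets_completionI_sets borel_Times)
  define F where "F = (\<lambda>z. if z \<in> S \<times> T then f z else 0)"
  have Fi: "integrable lebesgue F"
    unfolding F_def by (rule iffD2[OF Lebesgue_Measure.integrable_restrict_UNIV f]) (rule ST)
  then obtain g where g: "g \<in> borel_measurable lborel" "AE x in lborel. F x = g x"
    using completion_ex_borel_measurable_real by blast
  have "integrable lebesgue g"
    by (rule integrable_cong_AE_imp[OF Fi]) (use g AE_completion[OF g(2)] in \<open>auto intro: measurable_completion\<close>)
  then have "integrable lborel g" using g(1) integrable_completion by blast
  then have gi: "integrable (lborel \<Otimes>\<^sub>M lborel) g" by (simp add: lborel_prod)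
  have "AE z in lborel \<Otimes>\<^sub>M lborel. F z = g z" using g(2) unfolding lborel_prod .
  then have "AE t in lborel. AE x in lborel. F (t, x) = g (t, x)" by (rule lborel_pair.AE_pair)
  then have "AE t in lborel. integrable lborel (\<lambda>x. g (t, x)) \<and> (AE x in lborel. F (t, x) = g (t, x))"
    using lborel_pair.AE_integrable_fst'[OF gi] by eventually_elim simp
  then have A: "AE t in lebesgue. integrable lborel (\<lambda>x. g (t, x)) \<and> (AE x in lborel. F (t, x) = g (t, x))"
    by (rule AE_completion)
  have B: "integrable lebesgue (\<lambda>x. F (t, x)) \<and> (LINT x|lebesgue. F (t, x)) = (LINT x|lborel. g (t, x))"
    if "integrable lborel (\<lambda>x. g (t, x)) \<and> (AE x in lborel. F (t, x) = g (t, x))" for t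
  proof -
    have gt: "integrable lebesgue (\<lambda>x. g (t, x))" using that integrable_completion by blast
    have "AE x in lebesgue. F (t, x) = g (t, x)"
      using that by (intro AE_completion) auto
    then have eq: "AE x in lebesgue. g (t, x) = F (t, x)" by eventually_elim simp
    then have "integrable lebesgue (\<lambda>x. F (t, x))" "(LINT x|lebesgue. g (t, x)) = (LINT x|lebesgue. F (t, x))"
      using lebesgue_on_integrable_AE[of UNIV "\<lambda>x. g (t, x)" "\<lambda>x. F (t, x)"] gt
        lebesgue_on_integral_cong_AE[of UNIV "\<lambda>x. g (t, x)" "\<lambda>x. F (t, x)"]
      unfolding lebesgue_on_UNIV_eq by auto
    moreover have "(LINT x|lebesgue. g (t, x)) = (LINT x|lborel. g (t, x))"
      using that by (intro integral_completion) auto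
    ultimately show ?thesis by simp
  qed
  have C: "integrable (lebesgue_on T) (\<lambda>x. f (t, x)) \<and> (LINT x|lebesgue_on T. f (t, x)) = (LINT x|lborel. g (t, x))"
    if "integrable lborel (\<lambda>x. g (t, x)) \<and> (AE x in lborel. F (t, x) = g (t, x))" "t \<in> S" for t
  proof -
    have "(\<lambda>x. F (t, x)) = (\<lambda>x. if x \<in> T then f (t, x) else 0)" using that(2) by (auto simp: F_def)
    with B[OF that(1)] ST show ?thesis
      by (simp add: Lebesgue_Measure.integrable_restrict_UNIV Lebesgue_Measure.integral_restrict_UNIV)
  qed
  have D: "AE t in lebesgue_on S. integrable (lebesgue_on T) (\<lambda>x. f (t, x)) \<and> (LINT x|lebesgue_on T. f (t, x)) = (LINT x|lborel. g (t, x))"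
  proof -
    have "AE t in lebesgue. t \<in> S \<longrightarrow> integrable (lebesgue_on T) (\<lambda>x. f (t, x)) \<and> (LINT x|lebesgue_on T. f (t, x)) = (LINT x|lborel. g (t, x))"
      using A by eventually_elim (use C in blast)
    then show ?thesis using ST(2) by (subst AE_restrict_space_iff) auto
  qed
  then show "AE t in lebesgue_on S. integrable (lebesgue_on T) (\<lambda>x. f (t, x))"
    by eventually_elim simp
  have g1: "integrable lebesgue (\<lambda>t. LINT x|lborel. g (t, x))"
    using lborel_pair.integrable_fst'[OF gi] integrable_completion by blast
  have gS: "integrable (lebesgue_on S) (\<lambda>t. LINT x|lborel. g (t, x))"
    using g1 ST by (metis integrable_mult_indicator integrable_restrict_space sets_completionI_sets space_completion space_lborel Int_UNIV_right space_borel)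
  show "integrable (lebesgue_on S) (\<lambda>t. LINT x|lebesgue_on T. f (t, x))"
    by (rule lebesgue_on_integrable_AE[OF ST(2) gS]) (use D in \<open>auto elim: eventually_mono\<close>)
  have g0: "(LINT x|lborel. g (t, x)) = 0" if "integrable lborel (\<lambda>x. g (t, x)) \<and> (AE x in lborel. F (t, x) = g (t, x))" "t \<notin> S" for t
    using B[OF that(1)] that(2) by (auto simp: F_def)
  have "(LINT z|lebesgue_on (S \<times> T). f z) = (LINT z|lebesgue. F z)"
    unfolding F_def using ST by (simp add: Lebesgue_Measure.integral_restrict_UNIV)
  also have "\<dots> = (LINT z|lebesgue. g z)"
    using lebesgue_on_integral_cong_AE[of UNIV F g] AE_completion[OF g(2)] unfolding lebesgue_on_UNIV_eq by simp
  also have "\<dots> = (LINT z|(lborel \<Otimes>\<^sub>M lborel). g z)"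
    using g(1) unfolding lborel_prod by (simp add: integral_completion)
  also have "\<dots> = (LINT t|lborel. LINT x|lborel. g (t, x))"
    using lborel_pair.integral_fst'[OF gi] by simp
  also have "\<dots> = (LINT t|lebesgue. LINT x|lborel. g (t, x))"
    using lborel_pair.integrable_fst'[OF gi] by (intro integral_completion[symmetric]) auto
  also have "\<dots> = (LINT t|lebesgue. (if t \<in> S then (LINT x|lborel. g (t, x)) else 0))"
  proof -
    have "AE t in lebesgue. (LINT x|lborel. g (t, x)) = (if t \<in> S then (LINT x|lborel. g (t, x)) else 0)"
      using A by eventually_elim (use g0 in auto)
    then show ?thesis
      by (intro lebesgue_on_integral_cong_AE[of UNIV, unfolded lebesgue_on_UNIV_eq]) auto
  qed
  also have "\<dots> = (LINT t|lebesgue_on S. LINT x|lborel. g (t, x))"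
    using ST by (simp add: Lebesgue_Measure.integral_restrict_UNIV)
  also have "\<dots> = (LINT t|lebesgue_on S. LINT x|lebesgue_on T. f (t, x))"
    by (rule lebesgue_on_integral_cong_AE[OF ST(2)]) (use D in \<open>auto elim: eventually_mono\<close>)
  finally show "(LINT z|lebesgue_on (S \<times> T). f z) = (LINT t|lebesgue_on S. LINT x|lebesgue_on T. f (t, x))" .
qed

text \<open>A bounded F, an integrable v and finite measure of S give the integrable majorant B
  times the absolute value of v on the rectangle.\<close>

lemma Fubini_swap_bounded:
  fixes S T :: "real set" and F :: "real \<times> real \<Rightarrow> real" and v :: "real \<Rightarrow> real"
  assumes S: "S \<in> sets borel" "S \<in> lmeasurable" and T: "T \<in> sets borel"
    and F: "F \<in> borel_measurable borel" "\<And>z. \<bar>F z\<bar> \<le> B"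
    and v: "v \<in> borel_measurable borel" "integrable (lebesgue_on T) v"
  shows "(LINT t|lebesgue_on S. LINT x|lebesgue_on T. F (t, x) * v x) = (LINT x|lebesgue_on T. LINT t|lebesgue_on S. F (t, x) * v x)"
    "(\<lambda>t. LINT x|lebesgue_on T. F (t, x) * v x) \<in> borel_measurable (lebesgue_on S)"
proof -
  note [measurable] = S(1) T F(1) v(1)
  have SL: "S \<in> sets lebesgue" "T \<in> sets lebesgue" by auto
  have [measurable]: "F \<in> borel_measurable (borel \<Otimes>\<^sub>M borel)" using F(1) by (simp add: borel_prod)
  define G where "G = (\<lambda>(t, x). indicator S t * indicator T x * (F (t, x) * v x))"
  have [measurable]: "G \<in> borel_measurable (lborel \<Otimes>\<^sub>M lborel)" unfolding G_def by measurable
  have iT: "(LINT x|lebesgue_on T. f x) = (LINT x|lborel. indicator T x * f x)" "integrable (lebesgue_on T) f \<longleftrightarrow> integrable lborel (\<lambda>x. indicator T x * f x)"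
    if "T \<in> sets borel" and [measurable]: "f \<in> borel_measurable borel" for f :: "real \<Rightarrow> real" and T
  proof -
    have [measurable]: "(\<lambda>x. indicator T x * f x) \<in> borel_measurable borel" using that by auto
    show "(LINT x|lebesgue_on T. f x) = (LINT x|lborel. indicator T x * f x)"
      using that by (subst integral_restrict_space) (auto intro!: integral_completion)
    show "integrable (lebesgue_on T) f \<longleftrightarrow> integrable lborel (\<lambda>x. indicator T x * f x)"
      using that by (subst integrable_restrict_space) (auto intro!: integrable_completion)
  qed
  have vi: "integrable lborel (\<lambda>x. indicator T x * v x)" using iT(2)[OF T v(1)] v(2) by simp
  have Gi: "integrable (lborel \<Otimes>\<^sub>M lborel) G"
  proof (rule Bochner_Integration.integrable_bound)
    let ?H = "\<lambda>(t, x). B * indicator S t * \<bar>indicator T x * v x\<bar>"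
    show "integrable (lborel \<Otimes>\<^sub>M lborel) ?H"
    proof (rule lborel_pair.Fubini_integrable)
      show "?H \<in> borel_measurable (lborel \<Otimes>\<^sub>M lborel)" by measurable
      show "AE t in lborel. integrable lborel (\<lambda>x. ?H (t, x))" using vi by (auto intro!: AE_I2 integrable_abs)
      have "integrable lborel (indicat_real S)"
        using S by (intro integrable_real_indicator) (auto simp: fmeasurable_def)
      then have "integrable lborel (\<lambda>t. \<bar>B\<bar> * (LINT x|lborel. \<bar>indicator T x * v x\<bar>) * indicat_real S t)" by (rule integrable_mult_right)
      then show "integrable lborel (\<lambda>t. LINT x|lborel. norm (?H (t, x)))"
        by (simp add: abs_mult mult.assoc mult.left_commute)
    qed
    show "AE z in lborel \<Otimes>\<^sub>M lborel. norm (G z) \<le> norm (?H z)"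
    proof (rule AE_I2)
      fix z :: "real \<times> real"
      obtain t x where z: "z = (t, x)" by (cases z)
      have "\<bar>F (t, x)\<bar> * \<bar>v x\<bar> \<le> \<bar>B\<bar> * \<bar>v x\<bar>" using F(2)[of "(t,x)"] by (intro mult_right_mono) auto
      then show "norm (G z) \<le> norm (?H z)" by (auto simp: z G_def abs_mult indicator_def)
    qed
  qed fact
  have Gt: "(\<lambda>x. F (t, x) * v x) \<in> borel_measurable borel" "(\<lambda>t. F (t, x) * v x) \<in> borel_measurable borel" for t x
    by measurable
  have e1: "indicator S t * (LINT x|lebesgue_on T. F (t, x) * v x) = (LINT x|lborel. G (t, x))" for t
    using iT(1)[OF T Gt(1)] by (simp add: G_def mult.assoc)
  have e2: "indicator T x * (LINT t|lebesgue_on S. F (t, x) * v x) = (LINT t|lborel. G (t, x))" for x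
    unfolding iT(1)[OF S(1) Gt(2)] integral_mult_right_zero[symmetric]
    by (intro Bochner_Integration.integral_cong) (auto simp: G_def)
  have m1: "(\<lambda>t. LINT x|lborel. G (t, x)) \<in> borel_measurable borel"
    using lborel_pair.integrable_fst'[OF Gi] by auto
  have m: "(\<lambda>t. LINT x|lebesgue_on T. F (t, x) * v x) \<in> borel_measurable borel"
    unfolding iT(1)[OF T Gt(1)] by measurable
  have m': "(\<lambda>x. LINT t|lebesgue_on S. F (t, x) * v x) \<in> borel_measurable borel"
    unfolding iT(1)[OF S(1) Gt(2)] by measurable
  show "(\<lambda>t. LINT x|lebesgue_on T. F (t, x) * v x) \<in> borel_measurable (lebesgue_on S)"
    using m by (intro borel_imp_lebesgue_on) auto
  have "(LINT x|lborel. LINT t|lborel. G (t, x)) = (LINT t|lborel. LINT x|lborel. G (t, x))"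
    by (rule lborel_pair.Fubini_integral) (use Gi in auto)
  then show "(LINT t|lebesgue_on S. LINT x|lebesgue_on T. F (t, x) * v x) = (LINT x|lebesgue_on T. LINT t|lebesgue_on S. F (t, x) * v x)"
    unfolding iT(1)[OF S(1) m] iT(1)[OF T m'] e1 e2 by simp
qed

section \<open>The dual space \<open>H\<^sup>-\<^sup>1\<close>\<close>

lemma not_ae_zero:
  assumes "S \<in> sets lebesgue" "open U" "U \<noteq> {}" "U \<subseteq> S" "\<And>x. x \<in> U \<Longrightarrow> f x \<noteq> 0"
  shows "\<not> ae_zero S f"
proof
  assume "ae_zero S f"
  then have "AE x in lebesgue. x \<in> S \<longrightarrow> f x = 0"
    using assms(1) by (simp add: ae_zero_def AE_restrict_space_iff)
  then have "AE x in lebesgue. x \<notin> U"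
    by eventually_elim (use assms in auto)
  then have "negligible U"
    using assms(2) by (simp add: negligible_iff_null_sets completion.null_sets_iff_AE)
  then show False using open_not_negligible assms by blast
qed

text \<open>The frontier of a convex set is a null set, so membership in \<open>Q\<close> has to be
  checked on open cells only.\<close>

lemma AE_interior:
  fixes K :: "'a::euclidean_space set"
  assumes "convex K" "closed K"
  shows "AE z in lebesgue_on K. z \<in> interior K"
proof -
  have "AE z in lebesgue. z \<notin> frontier K"
    using negligible_convex_frontier[OF assms(1)] by (simp add: negligible_iff_null_sets AE_not_in)
  then have "AE z in lebesgue. z \<in> K \<longrightarrow> z \<in> interior K"
    by eventually_elim (use assms closure_subset[of K] in \<open>auto simp: frontier_def\<close>)
  then show ?thesis using assms(2) by (subst AE_restrict_space_iff) auto
qed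

text \<open>A nonzero value of a continuous function persists on a nonempty open set, which is not
  null. This turns the almost everywhere formulas in \<open>Q\<close> into pointwise ones.\<close>

lemma AE_zero_imp_zero:
  fixes f :: "'a::euclidean_space \<Rightarrow> real"
  assumes f: "AE z in lebesgue_on K. f z = 0" and K: "K \<in> sets lebesgue"
    and U: "open U" "U \<subseteq> K" "continuous_on U f" and z: "z \<in> U"
  shows "f z = 0"
proof (rule ccontr)
  assume nz: "f z \<noteq> 0"
  let ?V = "U \<inter> f -` (- {0})"
  have "open ?V" using U by (intro continuous_open_preimage) auto
  then have "\<not> ae_zero K f"
    using U nz z by (intro not_ae_zero[OF K, of ?V]) auto
  then show False using f by (simp add: ae_zero_def)
qed

context bounded_interval
begin

lemma L2_borel_representative:
  assumes "u \<in> L2 \<Omega>"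
  obtains u' where "u' \<in> borel_measurable borel" "AE x in lebesgue_on \<Omega>. u x = u' x" "integrable (lebesgue_on \<Omega>) u'"
proof -
  define U where "U = (\<lambda>x. if x \<in> \<Omega> then u x else 0)"
  have "u \<in> borel_measurable (lebesgue_on \<Omega>)" using assms by (simp add: L2_def)
  then have "U \<in> borel_measurable lebesgue"
    unfolding U_def by (intro iffD2[OF borel_measurable_if]) simp_all
  from completion_ex_borel_measurable_real[OF this]
  obtain u' where u': "u' \<in> borel_measurable lborel" "AE x in lborel. U x = u' x" by blast
  have "AE x in lebesgue. x \<in> \<Omega> \<longrightarrow> u x = u' x"
    using AE_completion[OF u'(2)] by eventually_elim (auto simp: U_def)
  then have "AE x in lebesgue_on \<Omega>. u x = u' x" by (subst AE_restrict_space_iff) simp_all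
  moreover have "integrable (lebesgue_on \<Omega>) u'"
    by (rule lebesgue_on_integrable_AE[OF _ L2_integrable[OF Omega_lmeasurable assms] calculation]) simp
  moreover have "u' \<in> borel_measurable borel" using u'(1) by simp
  ultimately show ?thesis using that by metis
qed

text \<open>The supremum in \<open>Hm1_norm\<close> leaves out functions vanishing almost
  everywhere; its index set has to be nonempty.\<close>

lemma H01_nontrivial: "\<exists>u\<in>H01 \<Omega>. \<not> ae_zero \<Omega> u"
proof
  let ?s = "(3 * a + b) / 4" and ?t = "(a + 3 * b) / 4"
  show "bump 1 ?s ?t \<in> H01 \<Omega>" by (intro H01_test bump_test) (use ab in auto)
  show "\<not> ae_zero \<Omega> (bump 1 ?s ?t)"
    by (rule not_ae_zero[of _ "{?s<..<?t}"]) (use ab in \<open>auto simp: bump_def flat_def\<close>)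
qed

lemma Hm1_bdd:
  assumes "l \<in> Hm1 \<Omega>"
  shows "bdd_above ((\<lambda>u. l u / H01_norm \<Omega> u) ` {u \<in> H01 \<Omega>. \<not> ae_zero \<Omega> u})"
proof -
  obtain K where K: "\<And>u. u \<in> H01 \<Omega> \<Longrightarrow> \<bar>l u\<bar> \<le> K * H01_norm \<Omega> u" using assms by (auto simp: Hm1_def)
  \<comment> \<open>The absolute value covers a zero denominator, where the quotient is 0 and K
    might be negative.\<close>
  have "l u / H01_norm \<Omega> u \<le> \<bar>K\<bar>" if "u \<in> H01 \<Omega>" for u
  proof (cases "H01_norm \<Omega> u = 0")
    case False
    then have "0 < H01_norm \<Omega> u" by (simp add: less_le)
    moreover have "l u \<le> \<bar>K\<bar> * H01_norm \<Omega> u"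
      using K[OF that] mult_right_mono[OF abs_ge_self[of K] H01_norm_nonneg[of u]] by linarith
    ultimately show ?thesis by (simp add: pos_divide_le_eq)
  qed simp
  then show ?thesis by (intro bdd_aboveI2[of _ _ "\<bar>K\<bar>"]) blast
qed

lemma Hm1_uminus:
  assumes "l \<in> Hm1 \<Omega>" "u \<in> H01 \<Omega>"
  shows "l (\<lambda>x. - u x) = - l u"
proof -
  have "l (\<lambda>x. (-1) * u x + 0 * u x) = (-1) * l u + 0 * l u"
    using assms unfolding Hm1_def linear_on_H01_def by blast
  then show ?thesis by simp
qed

lemma Hm1_diff:
  assumes "l \<in> Hm1 \<Omega>" "u \<in> H01 \<Omega>" "v \<in> H01 \<Omega>"
  shows "l (\<lambda>x. u x - v x) = l u - l v"
proof -
  have "l (\<lambda>x. 1 * u x + (-1) * v x) = 1 * l u + (-1) * l v"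
    using assms unfolding Hm1_def linear_on_H01_def by blast
  then show ?thesis by simp
qed

lemma H01_uminus: "u \<in> H01 \<Omega> \<Longrightarrow> (\<lambda>x. - u x) \<in> H01 \<Omega>"
  using H01_scale[of u "-1"] by simp

lemma H01_norm_uminus:
  assumes "u \<in> H01 \<Omega>"
  shows "H01_norm \<Omega> (\<lambda>x. - u x) = H01_norm \<Omega> u"
  using H01_norm_scale[OF assms, of "-1"] by simp

text \<open>The supremum is taken without absolute values; the two-sided bound comes from testing
  with u and -u.\<close>

lemma Hm1_norm_upper:
  assumes l: "l \<in> Hm1 \<Omega>" and u: "u \<in> H01 \<Omega>"
  shows "\<bar>l u\<bar> \<le> Hm1_norm \<Omega> l * H01_norm \<Omega> u"
proof -
  obtain K where K: "\<And>u. u \<in> H01 \<Omega> \<Longrightarrow> \<bar>l u\<bar> \<le> K * H01_norm \<Omega> u" using l by (auto simp: Hm1_def)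
  have *: "l v \<le> Hm1_norm \<Omega> l * H01_norm \<Omega> v" if v: "v \<in> H01 \<Omega>" for v
  proof (cases "H01_norm \<Omega> v = 0")
    case True
    then show ?thesis using K[OF v] by simp
  next
    case False
    then have "0 < H01_norm \<Omega> v" by (simp add: less_le)
    moreover have "\<not> ae_zero \<Omega> v" using False H01_norm_ae_zero H01D(1)[OF v] by blast
    then have "l v / H01_norm \<Omega> v \<le> Hm1_norm \<Omega> l"
      unfolding Hm1_norm_def using v by (intro cSUP_upper Hm1_bdd l) auto
    ultimately show ?thesis by (simp add: pos_divide_le_eq)
  qed
  show ?thesis
    using *[OF u] *[OF H01_uminus[OF u]] by (simp add: Hm1_uminus[OF l u] H01_norm_uminus[OF u])
qed

lemma Hm1_norm_nonneg:
  assumes l: "l \<in> Hm1 \<Omega>"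
  shows "0 \<le> Hm1_norm \<Omega> l"
proof -
  obtain u where u: "u \<in> H01 \<Omega>" "\<not> ae_zero \<Omega> u" using H01_nontrivial by blast
  have "l v / H01_norm \<Omega> v \<le> Hm1_norm \<Omega> l" if "v \<in> H01 \<Omega>" "\<not> ae_zero \<Omega> v" for v
    unfolding Hm1_norm_def using that by (intro cSUP_upper Hm1_bdd l) auto
  from this[OF u] this[OF H01_uminus[OF u(1)]] u(2) show ?thesis
    by (auto simp: Hm1_uminus[OF l u(1)] H01_norm_uminus[OF u(1)] ae_zero_def)
qed

lemma Hm1_norm_least:
  assumes "0 \<le> c" "\<And>u. u \<in> H01 \<Omega> \<Longrightarrow> \<bar>l u\<bar> \<le> c * H01_norm \<Omega> u"
  shows "Hm1_norm \<Omega> l \<le> c"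
  unfolding Hm1_norm_def
proof (rule cSUP_least)
  show "{u \<in> H01 \<Omega>. \<not> ae_zero \<Omega> u} \<noteq> {}" using H01_nontrivial by auto
  fix u assume "u \<in> {u \<in> H01 \<Omega>. \<not> ae_zero \<Omega> u}"
  then have "l u \<le> c * H01_norm \<Omega> u" using assms(2)[of u] by auto
  then show "l u / H01_norm \<Omega> u \<le> c"
    using assms(1) H01_norm_nonneg[of u] by (cases "H01_norm \<Omega> u = 0") (auto simp: divide_le_eq less_le)
qed

text \<open>Continuity of l carries the bound from a dense sequence to all of \<open>H01\<close>.
  With c = 0 this gives uniqueness of time derivatives, with general c the measurability in time of
  the dual norm.\<close>

lemma Hm1_bound_dense:
  assumes N: "\<And>n. N n \<in> H01 \<Omega>" "\<And>u e. u \<in> H01 \<Omega> \<Longrightarrow> 0 < e \<Longrightarrow> \<exists>n. H01_norm \<Omega> (\<lambda>x. u x - N n x) < e"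
    and l: "l \<in> Hm1 \<Omega>" and c: "0 \<le> c" "\<And>n. \<bar>l (N n)\<bar> \<le> c * H01_norm \<Omega> (N n)" and u: "u \<in> H01 \<Omega>"
  shows "\<bar>l u\<bar> \<le> c * H01_norm \<Omega> u"
proof (rule field_le_epsilon)
  fix e :: real assume e: "0 < e"
  let ?K = "Hm1_norm \<Omega> l"
  have K: "0 \<le> ?K" by (rule Hm1_norm_nonneg[OF l])
  \<comment> \<open>Replacing u by \<open>N n\<close> costs \<open>?K * d\<close> in the functional
    and \<open>c * d\<close> in the norm; the extra 1 keeps the denominator positive.\<close>
  define d where "d = e / (?K + c + 1)"
  have d: "0 < d" using e K c by (simp add: d_def)
  then obtain n where n: "H01_norm \<Omega> (\<lambda>x. u x - N n x) < d" using N(2)[OF u] by blast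
  have "H01_norm \<Omega> (N n) \<le> H01_norm \<Omega> u + d"
    using n L2_norm_reverse_triangle[OF H01D(2)[OF u] H01D(2)[OF N(1)[of n]]]
    unfolding H01_norm_diff[OF u N(1)] by (simp add: H01_norm_def)
  then have 1: "\<bar>l (N n)\<bar> \<le> c * (H01_norm \<Omega> u + d)"
    using c by (meson mult_left_mono order_trans)
  have "\<bar>l u - l (N n)\<bar> \<le> ?K * d"
    using Hm1_norm_upper[OF l H01_diff[OF u N(1)[of n]]] n K mult_left_mono[OF less_imp_le[OF n] K]
    by (simp add: Hm1_diff[OF l u N(1)])
  with 1 have "\<bar>l u\<bar> \<le> c * H01_norm \<Omega> u + (?K + c) * d" by (simp add: algebra_simps)
  also have "(?K + c) * d \<le> e"
    unfolding d_def using K c e by (simp add: field_simps)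
  finally show "\<bar>l u\<bar> \<le> c * H01_norm \<Omega> u + e" by simp
qed

lemma integral_functional_Hm1:
  assumes k: "k \<in> L2 \<Omega>"
  shows "(\<lambda>u. LINT x|lebesgue_on \<Omega>. k x * u x) \<in> Hm1 \<Omega>"
    "Hm1_norm \<Omega> (\<lambda>u. LINT x|lebesgue_on \<Omega>. k x * u x) \<le> (b - a) * L2_norm \<Omega> k"
proof -
  have bnd: "\<bar>LINT x|lebesgue_on \<Omega>. k x * u x\<bar> \<le> (b - a) * L2_norm \<Omega> k * H01_norm \<Omega> u" if "u \<in> H01 \<Omega>" for u
    using Poincare_functional[OF k that] by (simp add: mult.commute)
  then show "Hm1_norm \<Omega> (\<lambda>u. LINT x|lebesgue_on \<Omega>. k x * u x) \<le> (b - a) * L2_norm \<Omega> k"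
    using ab by (intro Hm1_norm_least) auto
  have "linear_on_H01 \<Omega> (\<lambda>u. LINT x|lebesgue_on \<Omega>. k x * u x)"
    unfolding linear_on_H01_def
  proof (intro ballI allI)
    fix u v r s assume u: "u \<in> H01 \<Omega>" and v: "v \<in> H01 \<Omega>"
    have "(LINT x|lebesgue_on \<Omega>. k x * (r * u x + s * v x)) = (LINT x|lebesgue_on \<Omega>. r * (k x * u x) + s * (k x * v x))"
      by (simp add: algebra_simps)
    also have "\<dots> = r * (LINT x|lebesgue_on \<Omega>. k x * u x) + s * (LINT x|lebesgue_on \<Omega>. k x * v x)"
      using L2_mult_integrable[OF k H01D(1)[OF u]] L2_mult_integrable[OF k H01D(1)[OF v]] by simp
    finally show "(LINT x|lebesgue_on \<Omega>. k x * (r * u x + s * v x)) =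
      r * (LINT x|lebesgue_on \<Omega>. k x * u x) + s * (LINT x|lebesgue_on \<Omega>. k x * v x)" .
  qed
  with bnd show "(\<lambda>u. LINT x|lebesgue_on \<Omega>. k x * u x) \<in> Hm1 \<Omega>" by (auto simp: Hm1_def)
qed

section \<open>The space \<open>L\<^sub>2(\<Xi>; H\<^sub>0\<^sup>1)\<close>\<close>

lemma Xi_lmeasurable: "\<Xi> \<in> lmeasurable" "\<Xi> \<in> sets lebesgue" "\<Xi> \<in> sets borel"
  by (auto simp: \<Xi>_def)

lemma Y_weak_grad: "v \<in> Y \<Omega> \<Longrightarrow> weak_grad_x \<Omega> v (grad_x \<Omega> v)"
  unfolding grad_x_def Y_def by (metis (mono_tags, lifting) mem_Collect_eq someI_ex)

lemma Y_slice: "v \<in> Y \<Omega> \<Longrightarrow> AE t in lebesgue_on \<Xi>. slice v t \<in> H01 \<Omega>"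
  by (simp add: Y_def)

text \<open>Fubini turns the norm of \<open>Y\<close> into an \<open>L2\<close> norm in time of
  spatial norms. Later norm computations go through this identity instead of the arbitrarily chosen
  \<open>grad_x\<close>.\<close>

lemma Y_slice_norm:
  assumes v: "v \<in> Y \<Omega>"
  shows "(\<lambda>t. H01_norm \<Omega> (slice v t)) \<in> L2 \<Xi>" "L2_norm \<Xi> (\<lambda>t. H01_norm \<Omega> (slice v t)) = Y_norm \<Omega> v"
proof -
  let ?G = "grad_x \<Omega> v"
  have G: "?G \<in> L2 (\<Sigma> \<Omega>)" "AE t in lebesgue_on \<Xi>. slice ?G t \<in> L2 \<Omega> \<and> weak_deriv \<Omega> (slice v t) (slice ?G t)"
    using Y_weak_grad[OF v] by (auto simp: weak_grad_x_def)
  have Gi: "integrable (lebesgue_on (\<Xi> \<times> \<Omega>)) (\<lambda>z. (?G z)\<^sup>2)" using G(1) by (simp add: L2_def)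
  have Ob: "\<Omega> \<in> sets borel" by simp
  note Fub = Fubini_lebesgue_on[OF Xi_lmeasurable(3) Ob Gi]
  have eq: "AE t in lebesgue_on \<Xi>. (LINT x|lebesgue_on \<Omega>. (?G (t, x))\<^sup>2) = (H01_norm \<Omega> (slice v t))\<^sup>2"
    using G(2)
  proof eventually_elim
    case (elim t)
    then have "H01_norm \<Omega> (slice v t) = L2_norm \<Omega> (slice ?G t)" by (intro D_props) auto
    then show ?case by (simp add: L2_norm_power2)
  qed
  have sq: "integrable (lebesgue_on \<Xi>) (\<lambda>t. (H01_norm \<Omega> (slice v t))\<^sup>2)"
    by (rule lebesgue_on_integrable_AE[OF Xi_lmeasurable(2) Fub(2) eq])
  have "(\<lambda>t. sqrt ((H01_norm \<Omega> (slice v t))\<^sup>2)) \<in> borel_measurable (lebesgue_on \<Xi>)"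
    using borel_measurable_integrable[OF sq] by measurable
  then have "(\<lambda>t. H01_norm \<Omega> (slice v t)) \<in> borel_measurable (lebesgue_on \<Xi>)" by simp
  with sq show "(\<lambda>t. H01_norm \<Omega> (slice v t)) \<in> L2 \<Xi>" by (simp add: L2_def)
  show "L2_norm \<Xi> (\<lambda>t. H01_norm \<Omega> (slice v t)) = Y_norm \<Omega> v"
    unfolding Y_norm_def L2_norm_def Fub(3) using lebesgue_on_integral_cong_AE[OF Xi_lmeasurable(2) eq] by simp
qed

lemma Y_norm_nonneg [simp]: "0 \<le> Y_norm \<Omega> v"
  by (simp add: Y_norm_def)

lemma weak_deriv_scale:
  assumes "weak_deriv \<Omega> u g"
  shows "weak_deriv \<Omega> (\<lambda>x. r * u x) (\<lambda>x. r * g x)"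
  unfolding weak_deriv_def
proof
  fix \<phi> assume "\<phi> \<in> test_functions \<Omega>"
  then have "(LINT x|lebesgue_on \<Omega>. u x * deriv \<phi> x) = - (LINT x|lebesgue_on \<Omega>. g x * \<phi> x)"
    using assms unfolding weak_deriv_def by blast
  then show "(LINT x|lebesgue_on \<Omega>. r * u x * deriv \<phi> x) = - (LINT x|lebesgue_on \<Omega>. r * g x * \<phi> x)"
    unfolding mult.assoc integral_mult_right_zero by (simp only: mult_minus_right)
qed

lemma Y_uminus:
  assumes v: "v \<in> Y \<Omega>"
  shows "(\<lambda>z. - v z) \<in> Y \<Omega>" "Y_norm \<Omega> (\<lambda>z. - v z) = Y_norm \<Omega> v"
proof -
  obtain g where g: "g \<in> L2 (\<Sigma> \<Omega>)" "AE t in lebesgue_on \<Xi>. slice g t \<in> L2 \<Omega> \<and> weak_deriv \<Omega> (slice v t) (slice g t)"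
    using v by (auto simp: Y_def weak_grad_x_def)
  have "AE t in lebesgue_on \<Xi>. slice (\<lambda>z. - g z) t \<in> L2 \<Omega> \<and> weak_deriv \<Omega> (slice (\<lambda>z. - v z) t) (slice (\<lambda>z. - g z) t)"
    using g(2)
  proof eventually_elim
    case (elim t)
    then show ?case using L2_scale[of "slice g t" \<Omega> "-1"] weak_deriv_scale[of "slice v t" "slice g t" "-1"] by simp
  qed
  moreover have "(\<lambda>z. - g z) \<in> L2 (\<Sigma> \<Omega>)" "(\<lambda>z. - v z) \<in> L2 (\<Sigma> \<Omega>)"
    using L2_scale[OF g(1), of "-1"] L2_scale[of v "\<Sigma> \<Omega>" "-1"] v by (auto simp: Y_def)
  moreover have "AE t in lebesgue_on \<Xi>. slice (\<lambda>z. - v z) t \<in> H01 \<Omega>"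
    using Y_slice[OF v] by eventually_elim (rule H01_uminus)
  ultimately show Y: "(\<lambda>z. - v z) \<in> Y \<Omega>"
    by (auto simp: Y_def weak_grad_x_def intro!: exI[of _ "\<lambda>z. - g z"])
  have "AE t in lebesgue_on \<Xi>. H01_norm \<Omega> (slice (\<lambda>z. - v z) t) = H01_norm \<Omega> (slice v t)"
    using Y_slice[OF v] by eventually_elim (rule H01_norm_uminus)
  then show "Y_norm \<Omega> (\<lambda>z. - v z) = Y_norm \<Omega> v"
    using L2_norm_cong_AE[OF Y_slice_norm(1)[OF Y] Y_slice_norm(1)[OF v]] by (simp add: Y_slice_norm(2)[OF Y] Y_slice_norm(2)[OF v])
qed

lemma Y_norm_ae_zero:
  assumes v: "v \<in> Y \<Omega>" and z: "ae_zero (\<Sigma> \<Omega>) v"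
  shows "Y_norm \<Omega> v = 0"
proof -
  have "AE t in lebesgue_on \<Xi>. ae_zero \<Omega> (slice v t)"
    using AE_lebesgue_on_Times[OF Xi_lmeasurable(3) _ z[unfolded ae_zero_def]] by (simp add: ae_zero_def)
  with Y_slice[OF v] have "AE t in lebesgue_on \<Xi>. H01_norm \<Omega> (slice v t) = 0"
    by eventually_elim (auto intro: H01_norm_ae_zero dest: H01D)
  then have "AE t in lebesgue_on \<Xi>. (H01_norm \<Omega> (slice v t))\<^sup>2 = 0" by eventually_elim simp
  then have "(LINT t|lebesgue_on \<Xi>. (H01_norm \<Omega> (slice v t))\<^sup>2) = 0" by (rule integral_eq_zero_AE)
  then show ?thesis unfolding Y_slice_norm(2)[OF v, symmetric] by (simp add: L2_norm_def)
qed

lemma Sigma_lmeasurable: "\<Sigma> \<Omega> \<in> lmeasurable"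
  by (rule lmeasurable_open) (auto simp: \<Xi>_def intro!: open_Times bounded_Times)

lemma tensor_Y:
  fixes f u g :: "real \<Rightarrow> real"
  assumes f: "f \<in> borel_measurable borel" "\<And>t. \<bar>f t\<bar> \<le> F"
    and u: "u \<in> H01 \<Omega>" "u \<in> borel_measurable borel" "\<And>x. \<bar>u x\<bar> \<le> U"
    and g: "weak_deriv \<Omega> u g" "g \<in> borel_measurable borel" "\<And>x. \<bar>g x\<bar> \<le> G"
  shows "(\<lambda>(t, x). f t * u x) \<in> Y \<Omega>" "Y_norm \<Omega> (\<lambda>(t, x). f t * u x) = L2_norm \<Xi> f * H01_norm \<Omega> u"
proof -
  have L: "(\<lambda>(t, x). f t * k x) \<in> L2 (\<Sigma> \<Omega>)" if "k \<in> borel_measurable borel" "\<And>x. \<bar>k x\<bar> \<le> K" for k K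
  proof (rule bounded_L2[OF Sigma_lmeasurable, of _ "F * K"])
    note [measurable] = f(1) that(1)
    have "(\<lambda>(t, x). f t * k x) \<in> borel_measurable (borel \<Otimes>\<^sub>M borel)" by measurable
    then show "(\<lambda>(t, x). f t * k x) \<in> borel_measurable (lebesgue_on (\<Sigma> \<Omega>))"
      unfolding borel_prod by (intro borel_imp_lebesgue_on) simp
    have F: "0 \<le> F" using f(2)[of 0] by simp
    have "\<bar>f t\<bar> * \<bar>k x\<bar> \<le> F * K" for t x
      by (rule mult_mono[OF f(2) that(2) F]) simp
    then show "\<bar>case z of (t, x) \<Rightarrow> f t * k x\<bar> \<le> F * K" for z
      by (cases z) (simp add: abs_mult)
  qed
  have gL: "g \<in> L2 \<Omega>" using g by (intro bounded_L2[of _ _ G]) (auto intro!: borel_imp_lebesgue_on)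
  have "weak_grad_x \<Omega> (\<lambda>(t, x). f t * u x) (\<lambda>(t, x). f t * g x)"
    unfolding weak_grad_x_def using L[OF g(2,3)] L2_scale[OF gL] weak_deriv_scale[OF g(1)] by simp
  then show Y: "(\<lambda>(t, x). f t * u x) \<in> Y \<Omega>"
    unfolding Y_def using L[OF u(2,3)] H01_scale[OF u(1)] by (simp add: exI)
  show "Y_norm \<Omega> (\<lambda>(t, x). f t * u x) = L2_norm \<Xi> f * H01_norm \<Omega> u"
    unfolding Y_slice_norm(2)[OF Y, symmetric] using L2_norm_scale[of \<Xi> "H01_norm \<Omega> u" "\<lambda>t. \<bar>f t\<bar>"]
    by (simp add: H01_norm_scale[OF u(1)] mult.commute)
qed

section \<open>Dual norms as suprema of bounded sets\<close>

lemma dual_norm_bdd: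
  assumes S: "S \<subseteq> Y \<Omega>" and K: "\<And>v. v \<in> S \<Longrightarrow> G v \<le> K * Y_norm \<Omega> v" "0 \<le> K"
  shows "v \<in> S \<Longrightarrow> G v / Y_norm \<Omega> v \<le> K"
    "bdd_above ((\<lambda>v. G v / Y_norm \<Omega> v) ` {v \<in> S. \<not> ae_zero (\<Sigma> \<Omega>) v})"
proof -
  have *: "G v / Y_norm \<Omega> v \<le> K" if "v \<in> S" for v
    using K(1)[OF that] K(2) Y_norm_nonneg[of v] by (cases "Y_norm \<Omega> v = 0") (auto simp: divide_le_eq less_le)
  then show "v \<in> S \<Longrightarrow> G v / Y_norm \<Omega> v \<le> K" .
  show "bdd_above ((\<lambda>v. G v / Y_norm \<Omega> v) ` {v \<in> S. \<not> ae_zero (\<Sigma> \<Omega>) v})"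
    by (rule bdd_aboveI2[of _ _ K]) (use * in blast)
qed

text \<open>\<open>Sup\<close> is meaningful on bounded sets only, so some bound K has to be
  supplied; its size does not enter the result. K also settles v of zero norm, where the quotient
  carries no information.\<close>

lemma dual_norm_upper:
  assumes S: "S \<subseteq> Y \<Omega>" and K: "\<And>v. v \<in> S \<Longrightarrow> G v \<le> K * Y_norm \<Omega> v" "0 \<le> K" and v: "v \<in> S"
  shows "G v \<le> dual_norm \<Omega> S G * Y_norm \<Omega> v"
proof (cases "Y_norm \<Omega> v = 0")
  case True
  then show ?thesis using K(1)[OF v] by simp
next
  case False
  then have "0 < Y_norm \<Omega> v" by (simp add: less_le)
  moreover have "\<not> ae_zero (\<Sigma> \<Omega>) v" using False Y_norm_ae_zero S v by blast
  then have "G v / Y_norm \<Omega> v \<le> dual_norm \<Omega> S G"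
    unfolding dual_norm_def using v by (intro cSUP_upper dual_norm_bdd(2)[OF S K]) auto
  ultimately show ?thesis by (simp add: pos_divide_le_eq)
qed

lemma dual_norm_least:
  assumes S: "S \<subseteq> Y \<Omega>" and K: "\<And>v. v \<in> S \<Longrightarrow> G v \<le> K * Y_norm \<Omega> v" "0 \<le> K"
    and ne: "v \<in> S" "\<not> ae_zero (\<Sigma> \<Omega>) v"
  shows "dual_norm \<Omega> S G \<le> K"
  unfolding dual_norm_def using ne by (intro cSUP_least) (auto intro: dual_norm_bdd(1)[OF S K])

text \<open>The quotients at v and -v are opposite numbers, and both lie below the supremum.\<close>

lemma dual_norm_nonneg:
  assumes S: "S \<subseteq> Y \<Omega>" and K: "\<And>v. v \<in> S \<Longrightarrow> G v \<le> K * Y_norm \<Omega> v" "0 \<le> K"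
    and ne: "v \<in> S" "\<not> ae_zero (\<Sigma> \<Omega>) v" and neg: "(\<lambda>z. - v z) \<in> S" "G (\<lambda>z. - v z) = - G v"
  shows "0 \<le> dual_norm \<Omega> S G"
proof -
  have up: "G u / Y_norm \<Omega> u \<le> dual_norm \<Omega> S G" if "u \<in> S" "\<not> ae_zero (\<Sigma> \<Omega>) u" for u
    unfolding dual_norm_def using that by (intro cSUP_upper dual_norm_bdd(2)[OF S K]) auto
  have "Y_norm \<Omega> (\<lambda>z. - v z) = Y_norm \<Omega> v" using S ne by (intro Y_uminus) auto
  with up[OF ne] up[OF neg(1)] ne(2) neg(2) show ?thesis by (auto simp: ae_zero_def)
qed

end

section \<open>Weak time derivatives\<close>

context bounded_interval
begin

text \<open>Membership in \<open>L2_Hm1\<close> directly makes only the square of the norm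
  measurable; the root of that square is an absolute value, hence the form of the claim.\<close>

lemma L2_Hm1_norm_L2:
  assumes "g \<in> L2_Hm1 \<Omega>"
  shows "(\<lambda>t. \<bar>Hm1_norm \<Omega> (g t)\<bar>) \<in> L2 \<Xi>"
proof -
  have sq: "integrable (lebesgue_on \<Xi>) (\<lambda>t. (Hm1_norm \<Omega> (g t))\<^sup>2)" using assms by (simp add: L2_Hm1_def)
  have "(\<lambda>t. sqrt ((Hm1_norm \<Omega> (g t))\<^sup>2)) \<in> borel_measurable (lebesgue_on \<Xi>)"
    using borel_measurable_integrable[OF sq] by measurable
  with sq show ?thesis by (simp add: L2_def)
qed

lemma L2_Hm1_apply_integrable:
  assumes g: "g \<in> L2_Hm1 \<Omega>" and u: "u \<in> H01 \<Omega>"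
  shows "(\<lambda>t. g t u) \<in> L2 \<Xi>"
proof -
  have m: "(\<lambda>t. g t u) \<in> borel_measurable (lebesgue_on \<Xi>)" and H: "AE t in lebesgue_on \<Xi>. g t \<in> Hm1 \<Omega>"
    and i: "integrable (lebesgue_on \<Xi>) (\<lambda>t. (Hm1_norm \<Omega> (g t))\<^sup>2)"
    using g u by (auto simp: L2_Hm1_def)
  have "integrable (lebesgue_on \<Xi>) (\<lambda>t. (g t u)\<^sup>2)"
  proof (rule Bochner_Integration.integrable_bound)
    show "integrable (lebesgue_on \<Xi>) (\<lambda>t. (H01_norm \<Omega> u)\<^sup>2 * (Hm1_norm \<Omega> (g t))\<^sup>2)"
      using i by simp
    show "AE t in lebesgue_on \<Xi>. norm ((g t u)\<^sup>2) \<le> norm ((H01_norm \<Omega> u)\<^sup>2 * (Hm1_norm \<Omega> (g t))\<^sup>2)"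
      using H
    proof eventually_elim
      case (elim t)
      have "\<bar>g t u\<bar>\<^sup>2 \<le> (Hm1_norm \<Omega> (g t) * H01_norm \<Omega> u)\<^sup>2"
        by (rule power_mono[OF Hm1_norm_upper[OF elim u]]) simp
      then show ?case by (simp add: power_mult_distrib mult.commute)
    qed
  qed (use m in measurable)
  with m show ?thesis by (simp add: L2_def)
qed

text \<open>\<open>L2_Hm1\<close> asks for measurability with a fixed argument, whereas here the
  slice moves with t. The non-integrable case is settled by the default value 0.\<close>

lemma pairing_bound:
  assumes g: "g \<in> L2_Hm1 \<Omega>" and v: "v \<in> Y \<Omega>"
  shows "\<bar>LINT t|lebesgue_on \<Xi>. g t (slice v t)\<bar> \<le> L2_norm \<Xi> (\<lambda>t. Hm1_norm \<Omega> (g t)) * Y_norm \<Omega> v"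
proof (cases "integrable (lebesgue_on \<Xi>) (\<lambda>t. g t (slice v t))")
  case True
  have H: "AE t in lebesgue_on \<Xi>. g t \<in> Hm1 \<Omega>" using g by (simp add: L2_Hm1_def)
  have "\<bar>LINT t|lebesgue_on \<Xi>. g t (slice v t)\<bar> \<le> (LINT t|lebesgue_on \<Xi>. \<bar>g t (slice v t)\<bar>)"
    by (rule integral_abs_bound)
  also have "\<dots> \<le> (LINT t|lebesgue_on \<Xi>. \<bar>Hm1_norm \<Omega> (g t)\<bar> * H01_norm \<Omega> (slice v t))"
  proof (rule integral_mono_AE)
    show "AE t in lebesgue_on \<Xi>. \<bar>g t (slice v t)\<bar> \<le> \<bar>Hm1_norm \<Omega> (g t)\<bar> * H01_norm \<Omega> (slice v t)"
      using H Y_slice[OF v]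
    proof eventually_elim
      case (elim t)
      have "Hm1_norm \<Omega> (g t) * H01_norm \<Omega> (slice v t) \<le> \<bar>Hm1_norm \<Omega> (g t)\<bar> * H01_norm \<Omega> (slice v t)"
        by (intro mult_right_mono) auto
      with Hm1_norm_upper[OF elim] show ?case by linarith
    qed
  qed (use True L2_mult_integrable[OF L2_Hm1_norm_L2[OF g] Y_slice_norm(1)[OF v]] in auto)
  also have "\<dots> \<le> L2_norm \<Xi> (\<lambda>t. \<bar>Hm1_norm \<Omega> (g t)\<bar>) * L2_norm \<Xi> (\<lambda>t. H01_norm \<Omega> (slice v t))"
    using L2_Cauchy_Schwarz[OF L2_Hm1_norm_L2[OF g] Y_slice_norm(1)[OF v]] by linarith
  finally show ?thesis by (simp add: Y_slice_norm(2)[OF v])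
next
  case False
  then show ?thesis by (simp add: not_integrable_integral_eq)
qed

text \<open>For each fixed \<open>u\<close> the two derivatives agree outside a null set depending on \<open>u\<close>; a countable
  dense set of \<open>u\<close> makes the null set uniform.\<close>

lemma weak_time_deriv_unique:
  assumes g: "weak_time_deriv \<Omega> w g" and g': "weak_time_deriv \<Omega> w g'"
  shows "AE t in lebesgue_on \<Xi>. \<forall>u\<in>H01 \<Omega>. g t u = g' t u"
proof -
  obtain N :: "nat \<Rightarrow> real \<Rightarrow> real" where N: "\<And>n. N n \<in> H01 \<Omega>"
    "\<And>u e. u \<in> H01 \<Omega> \<Longrightarrow> 0 < e \<Longrightarrow> \<exists>n. H01_norm \<Omega> (\<lambda>x. u x - N n x) < e"
    using H01_separable by metis
  have gL: "g \<in> L2_Hm1 \<Omega>" "g' \<in> L2_Hm1 \<Omega>" using g g' by (auto simp: weak_time_deriv_def)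
  have eq: "AE t in lebesgue_on \<Xi>. g t u - g' t u = 0" if u: "u \<in> H01 \<Omega>" for u
    unfolding \<Xi>_def
  proof (rule weak_zero_imp_AE_zero)
    have L: "(\<lambda>t. g t u) \<in> L2 {0<..<1}" "(\<lambda>t. g' t u) \<in> L2 {0<..<1}"
      using L2_Hm1_apply_integrable[OF gL(1) u] L2_Hm1_apply_integrable[OF gL(2) u] by (auto simp: \<Xi>_def)
    show "integrable (lebesgue_on {0<..<1}) (\<lambda>t. g t u - g' t u)"
      by (rule L2_integrable[OF _ L2_diff[OF L]]) simp
    fix \<phi> assume \<phi>: "\<phi> \<in> test_functions {0<..<1}"
    have i: "integrable (lebesgue_on {0<..<1}) (\<lambda>t. g t u * \<phi> t)" "integrable (lebesgue_on {0<..<1}) (\<lambda>t. g' t u * \<phi> t)"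
      by (intro L2_mult_integrable L test_function_L2[OF \<phi>])+
    have "(LINT t|lebesgue_on {0<..<1}. g t u * \<phi> t) = (LINT t|lebesgue_on {0<..<1}. g' t u * \<phi> t)"
      using g g' u \<phi> unfolding weak_time_deriv_def \<Xi>_def by simp
    then show "(LINT t|lebesgue_on {0<..<1}. (g t u - g' t u) * \<phi> t) = 0"
      using i by (simp add: left_diff_distrib)
  qed simp
  then have all: "AE t in lebesgue_on \<Xi>. \<forall>n. g t (N n) - g' t (N n) = 0"
    unfolding AE_all_countable using N(1) by blast
  have H: "AE t in lebesgue_on \<Xi>. g t \<in> Hm1 \<Omega>" "AE t in lebesgue_on \<Xi>. g' t \<in> Hm1 \<Omega>"
    using gL by (auto simp: L2_Hm1_def)
  from all H show ?thesis
  proof eventually_elim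
    case (elim t)
    let ?l = "\<lambda>u. g t u - g' t u"
    have L: "?l \<in> Hm1 \<Omega>"
    proof -
      have "linear_on_H01 \<Omega> ?l"
        using elim(2,3) unfolding Hm1_def linear_on_H01_def by (simp add: algebra_simps)
      moreover have "\<bar>?l u\<bar> \<le> (Hm1_norm \<Omega> (g t) + Hm1_norm \<Omega> (g' t)) * H01_norm \<Omega> u" if "u \<in> H01 \<Omega>" for u
        using Hm1_norm_upper[OF elim(2) that] Hm1_norm_upper[OF elim(3) that] by (simp add: distrib_right)
      ultimately show ?thesis by (auto simp: Hm1_def)
    qed
    have "\<bar>?l u\<bar> \<le> 0 * H01_norm \<Omega> u" if "u \<in> H01 \<Omega>" for u
      by (rule Hm1_bound_dense[OF N L]) (use elim(1) that in auto)
    then show ?case by auto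
  qed
qed

text \<open>An explicit derivative may replace the one selected by \<open>SOME\<close>. Agreement
  for all u outside one common null set is essential, because the argument \<open>slice v t\<close>
  depends on t.\<close>

lemma time_deriv_props:
  assumes g: "weak_time_deriv \<Omega> w g"
  shows "weak_time_deriv \<Omega> w (time_deriv \<Omega> w)"
    "v \<in> Y \<Omega> \<Longrightarrow> d_t \<Omega> w v = (LINT t|lebesgue_on \<Xi>. g t (slice v t))"
proof -
  show t: "weak_time_deriv \<Omega> w (time_deriv \<Omega> w)"
    unfolding time_deriv_def by (rule someI[of _ g]) (rule g)
  assume v: "v \<in> Y \<Omega>"
  have "AE t in lebesgue_on \<Xi>. time_deriv \<Omega> w t (slice v t) = g t (slice v t)"
    using weak_time_deriv_unique[OF t g] Y_slice[OF v] by eventually_elim blast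
  then show "d_t \<Omega> w v = (LINT t|lebesgue_on \<Xi>. g t (slice v t))"
    unfolding d_t_def by (rule lebesgue_on_integral_cong_AE[OF Xi_lmeasurable(2)])
qed

lemma d_t_bound:
  assumes g: "weak_time_deriv \<Omega> w g"
  obtains K where "0 \<le> K" "\<And>v. v \<in> Y \<Omega> \<Longrightarrow> \<bar>d_t \<Omega> w v\<bar> \<le> K * Y_norm \<Omega> v"
proof -
  have "g \<in> L2_Hm1 \<Omega>" using g by (simp add: weak_time_deriv_def)
  then show ?thesis
    using that[of "L2_norm \<Xi> (\<lambda>t. Hm1_norm \<Omega> (g t))"] pairing_bound[of g] time_deriv_props(2)[OF g] by simp
qed

lemma d_t_uminus:
  assumes g: "weak_time_deriv \<Omega> w g" and v: "v \<in> Y \<Omega>"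
  shows "d_t \<Omega> w (\<lambda>z. - v z) = - d_t \<Omega> w v"
proof -
  have "AE t in lebesgue_on \<Xi>. g t \<in> Hm1 \<Omega>" using g by (simp add: weak_time_deriv_def L2_Hm1_def)
  then have "AE t in lebesgue_on \<Xi>. g t (\<lambda>x. - v (t, x)) = - g t (slice v t)"
    using Y_slice[OF v] by eventually_elim (rule Hm1_uminus)
  then have "(LINT t|lebesgue_on \<Xi>. g t (\<lambda>x. - v (t, x))) = (LINT t|lebesgue_on \<Xi>. - g t (slice v t))"
    by (rule lebesgue_on_integral_cong_AE[OF Xi_lmeasurable(2)])
  then show ?thesis
    by (simp add: time_deriv_props(2)[OF g] v Y_uminus)
qed

lemma test_function_bounded:
  assumes "\<phi> \<in> test_functions {c<..<d}" "c < d"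
  shows "\<exists>B. \<forall>x. \<bar>\<phi> x\<bar> \<le> B \<and> \<bar>deriv \<phi> x\<bar> \<le> B"
proof -
  obtain s t where st: "smooth \<phi>" "\<And>x. x \<notin> {s..t} \<Longrightarrow> \<phi> x = 0" "\<And>x. x \<notin> {s..t} \<Longrightarrow> deriv \<phi> x = 0"
    using test_functionsD[OF assms] by metis
  have "bounded (\<phi> ` {s..t})" "bounded (deriv \<phi> ` {s..t})"
    by (intro compact_imp_bounded compact_continuous_image smooth_continuous smooth_deriv st compact_Icc)+
  then obtain B1 B2 where "\<forall>x\<in>{s..t}. \<bar>\<phi> x\<bar> \<le> B1" "\<forall>x\<in>{s..t}. \<bar>deriv \<phi> x\<bar> \<le> B2" by (auto simp: bounded_iff)
  then have "\<bar>\<phi> x\<bar> \<le> max 0 (max B1 B2)" "\<bar>deriv \<phi> x\<bar> \<le> max 0 (max B1 B2)" for x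
    using st(2,3)[of x] by (cases "x \<in> {s..t}"; force simp: le_max_iff_disj)+
  then show ?thesis by blast
qed

text \<open>A bounded classical time derivative off finitely many lines is the weak one: exchange
  the integrals, integrate by parts in t for fixed x, and exchange back.\<close>

lemma weak_time_derivI:
  fixes w \<rho> :: "real \<times> real \<Rightarrow> real"
  assumes w: "continuous_on (closure (\<Sigma> \<Omega>)) w"
    and \<rho>: "\<rho> \<in> borel_measurable borel" "\<And>z. \<bar>\<rho> z\<bar> \<le> B"
    and fin: "finite T0" "finite X0"
    and deriv: "\<And>t x. t \<in> \<Xi> - T0 \<Longrightarrow> x \<in> \<Omega> - X0 \<Longrightarrow> ((\<lambda>s. w (s, x)) has_real_derivative \<rho> (t, x)) (at t)"
  shows "weak_time_deriv \<Omega> w (\<lambda>t u. LINT x|lebesgue_on \<Omega>. \<rho> (t, x) * u x)"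
proof -
  interpret unit: bounded_interval 0 1 by unfold_locales simp
  define g where "g = (\<lambda>t u. LINT x|lebesgue_on \<Omega>. \<rho> (t, x) * u x)"
  have cl: "closure (\<Sigma> \<Omega>) = {0..1} \<times> {a..b}" using ab by (simp add: closure_Times \<Xi>_def)
  have B0: "0 \<le> B" using \<rho>(2)[of "(0,0)"] by simp
  have SL: "\<Omega> \<in> sets lebesgue" "\<Omega> \<in> sets borel" by auto
  have [measurable]: "\<rho> \<in> borel_measurable (borel \<Otimes>\<^sub>M borel)" using \<rho>(1) by (simp add: borel_prod)
  have \<rho>L: "slice \<rho> t \<in> L2 \<Omega>" for t
  proof (rule bounded_L2[OF Omega_lmeasurable _ \<rho>(2)])
    have "slice \<rho> t \<in> borel_measurable borel" by measurable
    then show "slice \<rho> t \<in> borel_measurable (lebesgue_on \<Omega>)"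
      by (intro borel_imp_lebesgue_on) simp
  qed
  have gH: "g t \<in> Hm1 \<Omega>" for t unfolding g_def by (rule integral_functional_Hm1[OF \<rho>L])
  have gm: "(\<lambda>t. g t u) \<in> borel_measurable (lebesgue_on \<Xi>)" if u: "u \<in> H01 \<Omega>" for u
  proof -
    obtain u' where u': "u' \<in> borel_measurable borel" "AE x in lebesgue_on \<Omega>. u x = u' x" "integrable (lebesgue_on \<Omega>) u'"
      using L2_borel_representative[OF H01D(1)[OF u]] by metis
    have "g t u = (LINT x|lebesgue_on \<Omega>. \<rho> (t, x) * u' x)" for t
      unfolding g_def
    proof (rule lebesgue_on_integral_cong_AE[OF SL(1)])
      show "AE x in lebesgue_on \<Omega>. \<rho> (t, x) * u x = \<rho> (t, x) * u' x"
        using u'(2) by eventually_elim simp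
    qed
    then show ?thesis
      using Fubini_swap_bounded(2)[OF Xi_lmeasurable(3,1) SL(2) \<rho> u'(1,3)] by simp
  qed
  have gN: "Hm1_norm \<Omega> (g t) \<le> (b - a) * (B * sqrt (b - a))" for t
  proof -
    have "L2_norm \<Omega> (slice \<rho> t) \<le> B * sqrt (measure lebesgue \<Omega>)"
      by (rule L2_norm_le_bound[OF Omega_lmeasurable \<rho>L \<rho>(2) B0])
    also have "\<dots> = B * sqrt (b - a)" using ab by simp
    finally have "(b - a) * L2_norm \<Omega> (slice \<rho> t) \<le> (b - a) * (B * sqrt (b - a))"
      using ab by (intro mult_left_mono) auto
    with integral_functional_Hm1(2)[OF \<rho>L, of t] show ?thesis unfolding g_def by linarith
  qed
  \<comment> \<open>A supremum over uncountably many u is measurable because each sublevel set is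
    already cut out by the inequalities for a dense sequence.\<close>
  have gNm: "(\<lambda>t. Hm1_norm \<Omega> (g t)) \<in> borel_measurable (lebesgue_on \<Xi>)"
    unfolding borel_measurable_iff_le
  proof
    fix c :: real
    show "{t \<in> space (lebesgue_on \<Xi>). Hm1_norm \<Omega> (g t) \<le> c} \<in> sets (lebesgue_on \<Xi>)"
    proof (cases "0 \<le> c")
      case True
      obtain N :: "nat \<Rightarrow> real \<Rightarrow> real" where N: "\<And>n. N n \<in> H01 \<Omega>"
        "\<And>u e. u \<in> H01 \<Omega> \<Longrightarrow> 0 < e \<Longrightarrow> \<exists>n. H01_norm \<Omega> (\<lambda>x. u x - N n x) < e"
        using H01_separable by metis
      have "Hm1_norm \<Omega> (g t) \<le> c \<longleftrightarrow> (\<forall>n. \<bar>g t (N n)\<bar> \<le> c * H01_norm \<Omega> (N n))" for t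
      proof
        assume c: "Hm1_norm \<Omega> (g t) \<le> c"
        show "\<forall>n. \<bar>g t (N n)\<bar> \<le> c * H01_norm \<Omega> (N n)"
          by (intro allI order_trans[OF Hm1_norm_upper[OF gH N(1)]] mult_right_mono[OF c H01_norm_nonneg])
      next
        assume d: "\<forall>n. \<bar>g t (N n)\<bar> \<le> c * H01_norm \<Omega> (N n)"
        show "Hm1_norm \<Omega> (g t) \<le> c"
        proof (rule Hm1_norm_least[OF True])
          fix u assume u: "u \<in> H01 \<Omega>"
          show "\<bar>g t u\<bar> \<le> c * H01_norm \<Omega> u"
            by (rule Hm1_bound_dense[OF N gH True]) (use d u in auto)
        qed
      qed
      then have "{t \<in> space (lebesgue_on \<Xi>). Hm1_norm \<Omega> (g t) \<le> c} =
          {t \<in> space (lebesgue_on \<Xi>). \<forall>n. \<bar>g t (N n)\<bar> \<le> c * H01_norm \<Omega> (N n)}" by simp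
      also have "\<dots> \<in> sets (lebesgue_on \<Xi>)"
      proof (rule sets.sets_Collect_countable_All)
        fix n
        have "(\<lambda>t. g t (N n)) \<in> borel_measurable (lebesgue_on \<Xi>)" by (rule gm[OF N(1)])
        then have "(\<lambda>t. \<bar>g t (N n)\<bar>) \<in> borel_measurable (lebesgue_on \<Xi>)" by measurable
        then show "{t \<in> space (lebesgue_on \<Xi>). \<bar>g t (N n)\<bar> \<le> c * H01_norm \<Omega> (N n)} \<in> sets (lebesgue_on \<Xi>)"
          unfolding borel_measurable_iff_le by blast
      qed
      finally show ?thesis .
    next
      case False
      then have "\<not> Hm1_norm \<Omega> (g t) \<le> c" for t using Hm1_norm_nonneg[OF gH, of t] by linarith
      then have "{t \<in> space (lebesgue_on \<Xi>). Hm1_norm \<Omega> (g t) \<le> c} = {}" by blast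
      then show ?thesis by (simp only: sets.empty_sets)
    qed
  qed
  have "(\<lambda>t. Hm1_norm \<Omega> (g t)) \<in> L2 \<Xi>"
    by (rule bounded_L2[OF Xi_lmeasurable(1) gNm]) (use gN Hm1_norm_nonneg[OF gH] in auto)
  then have gL: "g \<in> L2_Hm1 \<Omega>"
    using gm gH by (simp add: L2_Hm1_def L2_def)
  have "(LINT t|lebesgue_on \<Xi>. g t u * \<phi> t) =
     - (LINT t|lebesgue_on \<Xi>. (LINT x|lebesgue_on \<Omega>. w (t, x) * u x) * deriv \<phi> t)"
    if u: "u \<in> H01 \<Omega>" and \<phi>: "\<phi> \<in> test_functions \<Xi>" for u \<phi>
  proof -
    obtain u' where u': "u' \<in> borel_measurable borel" "AE x in lebesgue_on \<Omega>. u x = u' x" "integrable (lebesgue_on \<Omega>) u'"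
      using L2_borel_representative[OF H01D(1)[OF u]] by metis
    have \<phi>': "\<phi> \<in> test_functions {0<..<1}" using \<phi> by (simp add: \<Xi>_def)
    obtain K where K: "\<And>x. \<bar>\<phi> x\<bar> \<le> K" "\<And>x. \<bar>deriv \<phi> x\<bar> \<le> K"
      using test_function_bounded[OF \<phi>' zero_less_one] by blast
    have [measurable]: "\<phi> \<in> borel_measurable borel" "deriv \<phi> \<in> borel_measurable borel"
      by (intro borel_measurable_continuous_onI smooth_continuous smooth_deriv test_functions_smooth[OF \<phi>])+
    \<comment> \<open>w is continuous only on the closed rectangle; the cutoff makes it a bounded
      Borel function on the plane.\<close>
    define W where "W = (\<lambda>z. indicator ({0..1} \<times> {a..b}) z * w z)"
    have "W \<in> borel_measurable borel"
      unfolding W_def using borel_measurable_continuous_on_indicator[OF _ w[unfolded cl]]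
      by (simp add: borel_closed closed_Times)
    then have [measurable]: "W \<in> borel_measurable (borel \<Otimes>\<^sub>M borel)" by (simp add: borel_prod)
    have "bounded (w ` closure (\<Sigma> \<Omega>))"
      using w by (intro compact_imp_bounded compact_continuous_image) (auto simp: cl intro: compact_Times)
    then obtain M where M: "\<forall>z\<in>closure (\<Sigma> \<Omega>). \<bar>w z\<bar> \<le> M" by (auto simp: bounded_iff)
    then have WM: "\<bar>W z\<bar> \<le> max 0 M" for z by (auto simp: W_def cl indicator_def le_max_iff_disj)
    have Ww: "W (t, x) = w (t, x)" if "t \<in> \<Xi>" "x \<in> \<Omega>" for t x
      using that by (simp add: W_def \<Xi>_def)
    \<comment> \<open>Used twice, forwards for \<rho> with \<phi> and backwards for W with the
      derivative of \<phi>. It also trades u for its Borel version.\<close>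
    have swap: "(LINT t|lebesgue_on \<Xi>. (LINT x|lebesgue_on \<Omega>. F (t, x) * u x) * f t) =
        (LINT x|lebesgue_on \<Omega>. (LINT t|lebesgue_on \<Xi>. F (t, x) * f t) * u' x)"
      if [measurable]: "F \<in> borel_measurable (borel \<Otimes>\<^sub>M borel)" "f \<in> borel_measurable borel"
        and FC: "\<And>z. \<bar>F z\<bar> \<le> C" and fK: "\<And>t. \<bar>f t\<bar> \<le> K" for F f C
    proof -
      define G where "G = (\<lambda>(t, x). F (t, x) * f t)"
      have "G \<in> borel_measurable (borel \<Otimes>\<^sub>M borel)" unfolding G_def by measurable
      then have G: "G \<in> borel_measurable borel" by (simp add: borel_prod)
      have "0 \<le> C" using FC[of "(0,0)"] by simp
      then have GC: "\<bar>G z\<bar> \<le> C * K" for z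
        using mult_mono[OF FC fK] by (cases z) (simp add: G_def abs_mult)
      have "(LINT x|lebesgue_on \<Omega>. F (t, x) * u x) * f t = (LINT x|lebesgue_on \<Omega>. G (t, x) * u' x)" for t
      proof -
        have "(LINT x|lebesgue_on \<Omega>. F (t, x) * u x) * f t = (LINT x|lebesgue_on \<Omega>. F (t, x) * u x * f t)"
          by simp
        also have "\<dots> = (LINT x|lebesgue_on \<Omega>. G (t, x) * u' x)"
        proof (rule lebesgue_on_integral_cong_AE[OF SL(1)])
          show "AE x in lebesgue_on \<Omega>. F (t, x) * u x * f t = G (t, x) * u' x"
            using u'(2) by eventually_elim (simp add: G_def)
        qed
        finally show ?thesis .
      qed
      then have "(LINT t|lebesgue_on \<Xi>. (LINT x|lebesgue_on \<Omega>. F (t, x) * u x) * f t) =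
          (LINT t|lebesgue_on \<Xi>. LINT x|lebesgue_on \<Omega>. G (t, x) * u' x)" by simp
      also have "\<dots> = (LINT x|lebesgue_on \<Omega>. LINT t|lebesgue_on \<Xi>. G (t, x) * u' x)"
        by (rule Fubini_swap_bounded(1)[OF Xi_lmeasurable(3,1) SL(2) G GC u'(1,3)])
      finally show ?thesis by (simp add: G_def)
    qed
    have ibp: "(LINT t|lebesgue_on \<Xi>. w (t, x) * deriv \<phi> t) = - (LINT t|lebesgue_on \<Xi>. \<rho> (t, x) * \<phi> t)"
      if x: "x \<in> \<Omega> - X0" for x
      unfolding \<Xi>_def
    proof (rule unit.integration_by_parts_test[OF fin(1) _ _ _ \<phi>'])
      show "continuous_on {0..1} (\<lambda>t. w (t, x))"
        by (rule continuous_on_compose2[OF w]) (use x in \<open>auto simp: cl intro!: continuous_intros\<close>)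
      show "((\<lambda>t. w (t, x)) has_real_derivative \<rho> (t, x)) (at t)" if "t \<in> {0<..<1} - T0" for t
        using deriv[of t x] that x by (simp add: \<Xi>_def)
      show "(\<lambda>t. \<rho> (t, x)) \<in> L2 {0<..<1}"
      proof (rule bounded_L2[OF _ _ \<rho>(2)])
        have "(\<lambda>t. \<rho> (t, x)) \<in> borel_measurable borel" by measurable
        then show "(\<lambda>t. \<rho> (t, x)) \<in> borel_measurable (lebesgue_on {0<..<1})"
          by (intro borel_imp_lebesgue_on) simp
      qed simp
    qed
    have X0: "AE x in lebesgue_on \<Omega>. x \<in> \<Omega> - X0"
    proof -
      have "AE x in lebesgue. x \<notin> X0"
        using negligible_finite[OF fin(2)] by (simp add: negligible_iff_null_sets AE_not_in)
      then have "AE x in lebesgue. x \<in> \<Omega> \<longrightarrow> x \<in> \<Omega> - X0" by eventually_elim blast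
      then show ?thesis by (subst AE_restrict_space_iff) simp_all
    qed
    have "(LINT t|lebesgue_on \<Xi>. g t u * \<phi> t) = (LINT x|lebesgue_on \<Omega>. (LINT t|lebesgue_on \<Xi>. \<rho> (t, x) * \<phi> t) * u' x)"
      unfolding g_def by (rule swap[OF _ _ \<rho>(2) K(1)]) measurable
    also have "\<dots> = (LINT x|lebesgue_on \<Omega>. - ((LINT t|lebesgue_on \<Xi>. w (t, x) * deriv \<phi> t) * u' x))"
    proof (rule lebesgue_on_integral_cong_AE[OF SL(1)])
      show "AE x in lebesgue_on \<Omega>. (LINT t|lebesgue_on \<Xi>. \<rho> (t, x) * \<phi> t) * u' x =
          - ((LINT t|lebesgue_on \<Xi>. w (t, x) * deriv \<phi> t) * u' x)"
        using X0 by eventually_elim (simp only: ibp minus_mult_left minus_minus)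
    qed
    also have "\<dots> = - (LINT x|lebesgue_on \<Omega>. (LINT t|lebesgue_on \<Xi>. w (t, x) * deriv \<phi> t) * u' x)"
      by simp
    also have "(LINT x|lebesgue_on \<Omega>. (LINT t|lebesgue_on \<Xi>. w (t, x) * deriv \<phi> t) * u' x) =
        (LINT x|lebesgue_on \<Omega>. (LINT t|lebesgue_on \<Xi>. W (t, x) * deriv \<phi> t) * u' x)"
      using Ww by (intro Bochner_Integration.integral_cong arg_cong2[where f = "(*)"]) auto
    also have "\<dots> = (LINT t|lebesgue_on \<Xi>. (LINT x|lebesgue_on \<Omega>. W (t, x) * u x) * deriv \<phi> t)"
      by (rule swap[OF _ _ WM K(2), symmetric]) measurable
    also have "\<dots> = (LINT t|lebesgue_on \<Xi>. (LINT x|lebesgue_on \<Omega>. w (t, x) * u x) * deriv \<phi> t)"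
      using Ww by (intro Bochner_Integration.integral_cong arg_cong2[where f = "(*)"]) auto
    finally show ?thesis .
  qed
  with gL have "weak_time_deriv \<Omega> w g" by (simp add: weak_time_deriv_def)
  then show ?thesis by (simp only: g_def)
qed

end

section \<open>A step function orthogonal to polynomials\<close>

text \<open>The m-th finite difference annihilates polynomials of degree below m. Pascal's rule
  turns the sum for m + 1 into the sum for m applied to a first difference, whose degree is smaller
  by one.\<close>

lemma alternating_binomial_power_sum:
  "k < m \<Longrightarrow> (\<Sum>i\<le>m. (-1) ^ i * real (m choose i) * real i ^ k) = 0"
proof (induction m arbitrary: k)
  case (Suc m)
  have rec: "(\<Sum>i\<le>Suc m. (-1) ^ i * real (Suc m choose i) * f i) =
      (\<Sum>i\<le>m. (-1) ^ i * real (m choose i) * (f i - f (Suc i)))" for f :: "nat \<Rightarrow> real"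
  proof -
    have "(\<Sum>i\<le>Suc m. (-1) ^ i * real (Suc m choose i) * f i) =
        f 0 + (\<Sum>i\<le>m. (-1) ^ Suc i * real (Suc m choose Suc i) * f (Suc i))"
      by (subst sum.atMost_Suc_shift) simp
    also have "\<dots> = (f 0 + (\<Sum>i\<le>m. (-1) ^ Suc i * real (m choose Suc i) * f (Suc i)))
        - (\<Sum>i\<le>m. (-1) ^ i * real (m choose i) * f (Suc i))"
    proof -
      have "(\<Sum>i\<le>m. (-1) ^ Suc i * real (Suc m choose Suc i) * f (Suc i)) =
          (\<Sum>i\<le>m. (-1) ^ Suc i * real (m choose Suc i) * f (Suc i) - (-1) ^ i * real (m choose i) * f (Suc i))"
        by (intro sum.cong) (simp_all add: algebra_simps)
      then show ?thesis by (simp add: sum_subtractf)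
    qed
    also have "f 0 + (\<Sum>i\<le>m. (-1) ^ Suc i * real (m choose Suc i) * f (Suc i)) =
        (\<Sum>i\<le>Suc m. (-1) ^ i * real (m choose i) * f i)"
      by (subst sum.atMost_Suc_shift) simp
    also have "\<dots> = (\<Sum>i\<le>m. (-1) ^ i * real (m choose i) * f i)" by simp
    finally show ?thesis by (simp add: sum_subtractf[symmetric] algebra_simps)
  qed
  have "real i ^ k - real (Suc i) ^ k = (\<Sum>j<k. - (real (k choose j) * real i ^ j))" for i
  proof -
    have "real (Suc i) ^ k = (\<Sum>j\<le>k. real (k choose j) * real i ^ j)"
      using binomial_ring[of "real i" 1 k] by (simp add: add.commute)
    also have "\<dots> = (\<Sum>j<k. real (k choose j) * real i ^ j) + real i ^ k"
      by (simp flip: lessThan_Suc_atMost)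
    finally show ?thesis by (simp add: sum_negf)
  qed
  then have "(\<Sum>i\<le>Suc m. (-1) ^ i * real (Suc m choose i) * real i ^ k) =
      (\<Sum>i\<le>m. (-1) ^ i * real (m choose i) * (\<Sum>j<k. - (real (k choose j) * real i ^ j)))"
    unfolding rec by simp
  also have "\<dots> = (\<Sum>i\<le>m. \<Sum>j<k. - real (k choose j) * ((-1) ^ i * real (m choose i) * real i ^ j))"
    by (simp add: sum_distrib_left algebra_simps)
  also have "\<dots> = (\<Sum>j<k. - real (k choose j) * (\<Sum>i\<le>m. (-1) ^ i * real (m choose i) * real i ^ j))"
    by (subst sum.swap) (simp add: sum_distrib_left)
  also have "\<dots> = 0"
    using Suc.prems by (intro sum.neutral) (auto intro!: Suc.IH)
  finally show ?case .
qed simp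

lemma indicator_L2_norm:
  assumes "0 \<le> c" "c \<le> 1"
  shows "indicat_real {0<..<c} \<in> L2 \<Xi>" "L2_norm \<Xi> (indicat_real {0<..<c}) = sqrt c"
proof -
  show "indicat_real {0<..<c} \<in> L2 \<Xi>"
    by (rule indicator_L2) (auto simp: \<Xi>_def)
  have "(LINT t|lebesgue_on \<Xi>. (indicat_real {0<..<c} t)\<^sup>2) = (LINT t|lebesgue_on \<Xi>. (if t \<in> {0<..<c} then 1 else 0))"
    by (intro Bochner_Integration.integral_cong) (auto simp: indicator_def)
  also have "\<dots> = (LINT t|lebesgue_on {0<..<c}. 1)"
    using assms by (intro Lebesgue_Measure.integral_restrict) (auto simp: \<Xi>_def)
  also have "\<dots> = c"
    using assms by (simp add: measure_restrict_space)
  finally show "L2_norm \<Xi> (indicat_real {0<..<c}) = sqrt c" by (simp add: L2_norm_def)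
qed

text \<open>The coefficients, up to sign, of the finite difference of order p + 1.\<close>

definition altcoeff :: "nat \<Rightarrow> nat \<Rightarrow> real" where
  "altcoeff p i = (-1) ^ i * real (Suc p choose i)"

definition altstep :: "nat \<Rightarrow> real \<Rightarrow> real \<Rightarrow> real" where
  "altstep p h t = (\<Sum>i\<le>Suc p. altcoeff p i * indicator {real i * h<..<real (i + 1) * h} t)"

text \<open>Each clamp is the antiderivative, vanishing at 0, of the indicator of one cell, so this
  is an antiderivative of \<open>altstep\<close>.\<close>

definition altspline :: "nat \<Rightarrow> real \<Rightarrow> real \<Rightarrow> real" where
  "altspline p h t = (\<Sum>i\<le>Suc p. altcoeff p i * max 0 (min h (t - real i * h)))"

text \<open>The bracket is, up to a constant, the integral of the k-th power over cell i. As a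
  polynomial in i it has degree k, which the difference of order p + 1 annihilates.\<close>

lemma altcoeff_orthogonal:
  assumes "k \<le> p"
  shows "(\<Sum>i\<le>Suc p. altcoeff p i * (real (Suc i) ^ Suc k - real i ^ Suc k)) = 0"
proof -
  have "real (Suc i) ^ Suc k - real i ^ Suc k = (\<Sum>j\<le>k. real (Suc k choose j) * real i ^ j)" for i
  proof -
    have "real (Suc i) ^ Suc k = (\<Sum>j\<le>Suc k. real (Suc k choose j) * real i ^ j)"
      using binomial_ring[of "real i" 1 "Suc k"] by (simp add: add.commute)
    then show ?thesis by simp
  qed
  then have "(\<Sum>i\<le>Suc p. altcoeff p i * (real (Suc i) ^ Suc k - real i ^ Suc k)) =
      (\<Sum>i\<le>Suc p. \<Sum>j\<le>k. real (Suc k choose j) * (altcoeff p i * real i ^ j))"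
    by (simp only: sum_distrib_left mult.left_commute)
  also have "\<dots> = (\<Sum>j\<le>k. real (Suc k choose j) * (\<Sum>i\<le>Suc p. altcoeff p i * real i ^ j))"
    by (subst sum.swap) (simp only: sum_distrib_left)
  also have "\<dots> = 0"
    using assms unfolding altcoeff_def
    by (intro sum.neutral ballI mult_eq_0_iff[THEN iffD2] disjI2 alternating_binomial_power_sum) auto
  finally show ?thesis .
qed

lemma sum_altcoeff: "(\<Sum>i\<le>Suc p. altcoeff p i) = 0"
  using altcoeff_orthogonal[of 0 p] by simp

lemma sum_abs_altcoeff: "(\<Sum>i\<le>Suc p. \<bar>altcoeff p i\<bar>) = 2 ^ Suc p"
proof -
  have "(\<Sum>i\<le>Suc p. \<bar>altcoeff p i\<bar>) = real (\<Sum>i\<le>Suc p. Suc p choose i)"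
    unfolding altcoeff_def of_nat_sum by (intro sum.cong) (simp_all add: abs_mult power_abs)
  then show ?thesis unfolding choose_row_sum by simp
qed

context
  fixes p :: nat and h :: real
  assumes h: "0 < h"
begin

lemma altstep_borel: "altstep p h \<in> borel_measurable borel"
  unfolding altstep_def by measurable

text \<open>The case i > \<open>Suc p\<close> occurs because the fine rectangle may have more than p
  + 2 time layers.\<close>

lemma altstep_on_cell:
  assumes "t \<in> {real i * h<..<real (i + 1) * h}"
  shows "altstep p h t = (if i \<le> Suc p then altcoeff p i else 0)"
proof -
  have "t \<in> {real j * h<..<real (j + 1) * h} \<longleftrightarrow> j = i" for j
  proof
    assume j: "t \<in> {real j * h<..<real (j + 1) * h}"
    have "real j * h < real (i + 1) * h" "real i * h < real (j + 1) * h" using j assms by auto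
    then have "real j < real (i + 1)" "real i < real (j + 1)"
      using h by (simp_all only: mult_less_cancel_right_pos)
    then show "j = i" by simp
  qed (use assms in simp)
  then have "altstep p h t = (\<Sum>j\<le>Suc p. altcoeff p j * (if j = i then 1 else 0))"
    unfolding altstep_def by (intro sum.cong) (auto simp: indicator_def)
  also have "\<dots> = (\<Sum>j\<le>Suc p. if j = i then altcoeff p j else 0)"
    by (intro sum.cong) auto
  finally show ?thesis by (simp del: sum.atMost_Suc)
qed

lemma altstep_abs_le: "\<bar>altstep p h t\<bar> \<le> 2 ^ Suc p"
proof -
  have "\<bar>altstep p h t\<bar> \<le> (\<Sum>i\<le>Suc p. \<bar>altcoeff p i * indicator {real i * h<..<real (i + 1) * h} t\<bar>)"
    unfolding altstep_def by (rule sum_abs)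
  also have "\<dots> \<le> (\<Sum>i\<le>Suc p. \<bar>altcoeff p i\<bar>)"
    by (intro sum_mono) (auto simp: abs_mult indicator_def)
  finally show ?thesis unfolding sum_abs_altcoeff .
qed

lemma altstep_zero:
  assumes "t \<le> 0 \<or> real (p + 2) * h \<le> t"
  shows "altstep p h t = 0"
  unfolding altstep_def
proof (rule sum.neutral, rule ballI)
  fix i assume i: "i \<in> {..Suc p}"
  have "0 \<le> real i * h" "real (i + 1) * h \<le> real (p + 2) * h"
    using i h by (auto intro!: mult_right_mono)
  then show "altcoeff p i * indicator {real i * h<..<real (i + 1) * h} t = 0"
    using assms by (auto simp: indicator_def)
qed

text \<open>Past the last cell every clamp has reached h, and the coefficients sum to 0.\<close>

lemma altspline_zero:
  assumes "t \<le> 0 \<or> real (p + 2) * h \<le> t"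
  shows "altspline p h t = 0"
proof (cases "t \<le> 0")
  case True
  then have "max 0 (min h (t - real i * h)) = 0" for i
    using h by (simp add: max_def min_def) (smt (verit) mult_nonneg_nonneg of_nat_0_le_iff)
  then show ?thesis by (simp add: altspline_def)
next
  case False
  have "max 0 (min h (t - real i * h)) = h" if "i \<le> Suc p" for i
  proof -
    have "real (i + 1) * h \<le> real (p + 2) * h" using that h by (intro mult_right_mono) auto
    then have "h \<le> t - real i * h" using assms False by (simp add: algebra_simps)
    then show ?thesis using h by simp
  qed
  then have "altspline p h t = (\<Sum>i\<le>Suc p. altcoeff p i * h)"
    unfolding altspline_def by (intro sum.cong) auto
  also have "\<dots> = (\<Sum>i\<le>Suc p. altcoeff p i) * h" by (simp only: sum_distrib_right)
  finally show ?thesis by (simp only: sum_altcoeff mult_zero_left)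
qed

lemma altspline_abs_le: "\<bar>altspline p h t\<bar> \<le> 2 ^ Suc p * h"
proof -
  have "\<bar>altspline p h t\<bar> \<le> (\<Sum>i\<le>Suc p. \<bar>altcoeff p i * max 0 (min h (t - real i * h))\<bar>)"
    unfolding altspline_def by (rule sum_abs)
  also have "\<dots> \<le> (\<Sum>i\<le>Suc p. \<bar>altcoeff p i\<bar> * h)"
    using h by (intro sum_mono) (auto simp: abs_mult intro!: mult_left_mono)
  also have "\<dots> = 2 ^ Suc p * h" by (simp only: sum_distrib_right[symmetric] sum_abs_altcoeff)
  finally show ?thesis .
qed

lemma altspline_continuous: "continuous_on S (altspline p h)"
  unfolding altspline_def by (intro continuous_intros)

lemma altspline_has_derivative:
  assumes "t \<notin> (\<lambda>i. real i * h) ` {..p + 2}"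
  shows "(altspline p h has_real_derivative altstep p h t) (at t)"
proof -
  have "((\<lambda>t. altcoeff p i * max 0 (min h (t - real i * h))) has_real_derivative
      altcoeff p i * indicator {real i * h<..<real (i + 1) * h} t) (at t)" if i: "i \<le> Suc p" for i
  proof -
    have "real i * h \<in> (\<lambda>i. real i * h) ` {..p + 2}" "real (i + 1) * h \<in> (\<lambda>i. real i * h) ` {..p + 2}"
      using i by (intro imageI; simp)+
    with assms have ne: "t \<noteq> real i * h" "t \<noteq> real (i + 1) * h" by metis+
    have hi: "real (i + 1) * h = real i * h + h" by (simp add: algebra_simps)
    consider "t < real i * h" | "real i * h < t" "t < real (i + 1) * h" | "real (i + 1) * h < t"
      using ne by linarith
    then have "((\<lambda>t. max 0 (min h (t - real i * h))) has_real_derivative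
      indicator {real i * h<..<real (i + 1) * h} t) (at t)"
    proof cases
      case 1
      have "((\<lambda>_. 0) has_real_derivative 0) (at t)" by simp
      then have "((\<lambda>t. max 0 (min h (t - real i * h))) has_real_derivative 0) (at t)"
        by (rule has_field_derivative_transform_within_open[of _ _ _ "{..<real i * h}"]) (use 1 h in auto)
      then show ?thesis using 1 by simp
    next
      case 2
      have "((\<lambda>t. t - real i * h) has_real_derivative 1) (at t)" by (auto intro!: derivative_eq_intros)
      then have "((\<lambda>t. max 0 (min h (t - real i * h))) has_real_derivative 1) (at t)"
        by (rule has_field_derivative_transform_within_open[of _ _ _ "{real i * h<..<real (i + 1) * h}"])
           (use 2 h hi in auto)
      then show ?thesis using 2 by simp
    next
      case 3
      have "((\<lambda>_. h) has_real_derivative 0) (at t)" by simp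
      then have "((\<lambda>t. max 0 (min h (t - real i * h))) has_real_derivative 0) (at t)"
        by (rule has_field_derivative_transform_within_open[of _ _ _ "{real (i + 1) * h<..}"]) (use 3 h hi in auto)
      then show ?thesis using 3 by simp
    qed
    then show ?thesis by (rule DERIV_cmult)
  qed
  then show ?thesis
    unfolding altspline_def[abs_def] altstep_def by (intro DERIV_sum) auto
qed

lemma altspline_on_cell:
  obtains d where "\<And>t. t \<in> {real i * h<..<real (i + 1) * h} \<Longrightarrow> altspline p h t = (\<Sum>k\<le>1. d k * t ^ k)"
proof -
  \<comment> \<open>On cell i the j-th clamp is affine with intercept e and slope e': it is
    constantly h for earlier j, rises for j = i, and is still 0 for later j.\<close>
  define e where "e j = (if j < i then h else if j = i then - (real i * h) else 0)" for j
  define e' where "e' j = (if j = i then 1 else 0 :: real)" for j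
  define d where "d k = (if k = 0 then \<Sum>j\<le>Suc p. altcoeff p j * e j else \<Sum>j\<le>Suc p. altcoeff p j * e' j)" for k :: nat
  have "altspline p h t = (\<Sum>k\<le>1. d k * t ^ k)" if t: "t \<in> {real i * h<..<real (i + 1) * h}" for t
  proof -
    have "max 0 (min h (t - real j * h)) = e j + e' j * t" for j
    proof -
      consider "j < i" | "j = i" | "i < j" by linarith
      then show ?thesis
      proof cases
        case 1
        then have "real (j + 1) * h \<le> real i * h" using h by (intro mult_right_mono) auto
        then have "h \<le> t - real j * h" using t by (simp add: algebra_simps)
        then show ?thesis using 1 h by (simp add: e_def e'_def)
      next
        case 2
        then show ?thesis using t h by (simp add: e_def e'_def algebra_simps)
      next
        case 3
        then have "real (i + 1) * h \<le> real j * h" using h by (intro mult_right_mono) auto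
        then have "t - real j * h \<le> 0" using t by simp
        then show ?thesis using 3 h by (simp add: e_def e'_def)
      qed
    qed
    then have "altspline p h t = (\<Sum>j\<le>Suc p. altcoeff p j * e j + altcoeff p j * e' j * t)"
      unfolding altspline_def by (simp only: distrib_left mult.assoc)
    also have "\<dots> = d 0 + d 1 * t"
      unfolding d_def sum.distrib sum_distrib_right[symmetric] by simp
    finally show ?thesis by simp
  qed
  then show ?thesis using that by blast
qed

text \<open>Reduces to \<open>altcoeff_orthogonal\<close> by integrating the power over each cell.
  The bound on (p + 2) h keeps all these cells inside \<Xi>.\<close>

lemma altstep_orthogonal:
  assumes k: "k \<le> p" and le: "real (p + 2) * h \<le> 1"
  shows "integrable (lebesgue_on \<Xi>) (\<lambda>t. altstep p h t * t ^ k)" "(LINT t|lebesgue_on \<Xi>. altstep p h t * t ^ k) = 0"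
proof -
  have piece: "has_bochner_integral (lebesgue_on \<Xi>) (\<lambda>t. indicator {real i * h<..<real (i + 1) * h} t * t ^ k)
      (h ^ Suc k / real (Suc k) * (real (Suc i) ^ Suc k - real i ^ Suc k))" if i: "i \<le> Suc p" for i
  proof -
    let ?I = "{real i * h<..<real (i + 1) * h}"
    have "real (i + 1) * h \<le> real (p + 2) * h" "0 \<le> real i * h" using i h by (auto intro!: mult_right_mono)
    then have sub: "?I \<subseteq> \<Xi>" using le by (auto simp: \<Xi>_def)
    have il: "real i * h \<le> real (i + 1) * h" using h by (intro mult_right_mono) auto
    have int: "integrable (lebesgue_on ?I) (\<lambda>t. t ^ k)"
      by (intro L2_integrable continuous_imp_L2 continuous_intros) auto
    have "((\<lambda>t. t ^ k) has_integral (real (i + 1) * h) ^ Suc k / real (Suc k) - (real i * h) ^ Suc k / real (Suc k)) {real i * h..real (i + 1) * h}"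
    proof (rule fundamental_theorem_of_calculus[OF il])
      fix t assume "t \<in> {real i * h..real (i + 1) * h}"
      have "((\<lambda>t. t ^ Suc k / real (Suc k)) has_real_derivative (1 + real k) * (1 * t ^ k) / real (Suc k)) (at t within {real i * h..real (i + 1) * h})"
        using DERIV_cdivide[OF DERIV_power_Suc[OF DERIV_ident]] .
      then have "((\<lambda>t. t ^ Suc k / real (Suc k)) has_real_derivative t ^ k) (at t within {real i * h..real (i + 1) * h})"
        by (simp add: of_nat_Suc[symmetric] del: of_nat_Suc power_Suc)
      then show "((\<lambda>t. t ^ Suc k / real (Suc k)) has_vector_derivative t ^ k) (at t within {real i * h..real (i + 1) * h})"
        by (simp add: has_real_derivative_iff_has_vector_derivative)
    qed
    then have "(LINT t|lebesgue_on ?I. t ^ k) = (real (i + 1) * h) ^ Suc k / real (Suc k) - (real i * h) ^ Suc k / real (Suc k)"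
      using has_integral_integral_lebesgue_on[OF int] unfolding has_integral_Icc_iff_Ioo
      by (auto intro: has_integral_unique)
    also have "\<dots> = h ^ Suc k / real (Suc k) * (real (Suc i) ^ Suc k - real i ^ Suc k)"
      unfolding power_mult_distrib by (simp add: field_simps del: of_nat_Suc power_Suc)
    finally have val: "(LINT t|lebesgue_on ?I. t ^ k) = h ^ Suc k / real (Suc k) * (real (Suc i) ^ Suc k - real i ^ Suc k)" .
    have "has_bochner_integral (lebesgue_on ?I) (\<lambda>t. t ^ k) (h ^ Suc k / real (Suc k) * (real (Suc i) ^ Suc k - real i ^ Suc k))"
      using int val by (simp add: has_bochner_integral_iff)
    then have "has_bochner_integral lebesgue (\<lambda>t. indicator ?I t *\<^sub>R t ^ k) (h ^ Suc k / real (Suc k) * (real (Suc i) ^ Suc k - real i ^ Suc k))"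
      by (rule iffD1[OF has_bochner_integral_restrict_space, rotated]) simp
    moreover have "(\<lambda>t. indicator ?I t *\<^sub>R t ^ k) = (\<lambda>t. indicator \<Xi> t *\<^sub>R (indicator ?I t * t ^ k))"
    proof
      show "indicator ?I t *\<^sub>R t ^ k = indicator \<Xi> t *\<^sub>R (indicator ?I t * t ^ k)" for t
      proof (cases "t \<in> ?I")
        case True
        then have "t \<in> \<Xi>" using sub by (rule rev_subsetD)
        then show ?thesis using True by simp
      qed simp
    qed
    ultimately show ?thesis
      by (intro iffD2[OF has_bochner_integral_restrict_space]) (simp_all add: \<Xi>_def)
  qed
  have "has_bochner_integral (lebesgue_on \<Xi>) (\<lambda>t. \<Sum>i\<le>Suc p. altcoeff p i * (indicator {real i * h<..<real (i + 1) * h} t * t ^ k))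
      (\<Sum>i\<le>Suc p. altcoeff p i * (h ^ Suc k / real (Suc k) * (real (Suc i) ^ Suc k - real i ^ Suc k)))"
    by (intro has_bochner_integral_sum has_bochner_integral_mult_right piece) auto
  moreover have "(\<Sum>i\<le>Suc p. altcoeff p i * (indicator {real i * h<..<real (i + 1) * h} t * t ^ k)) = altstep p h t * t ^ k" for t
    unfolding altstep_def sum_distrib_right by (intro sum.cong) auto
  moreover have "(\<Sum>i\<le>Suc p. altcoeff p i * (h ^ Suc k / real (Suc k) * (real (Suc i) ^ Suc k - real i ^ Suc k))) = 0"
  proof -
    have "(\<Sum>i\<le>Suc p. altcoeff p i * (h ^ Suc k / real (Suc k) * (real (Suc i) ^ Suc k - real i ^ Suc k))) =
        h ^ Suc k / real (Suc k) * (\<Sum>i\<le>Suc p. altcoeff p i * (real (Suc i) ^ Suc k - real i ^ Suc k))"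
      unfolding sum_distrib_left by (intro sum.cong) (simp_all only: mult_ac)
    then show ?thesis by (simp only: altcoeff_orthogonal[OF k] mult_zero_right)
  qed
  ultimately have "has_bochner_integral (lebesgue_on \<Xi>) (\<lambda>t. altstep p h t * t ^ k) 0" by simp
  then show "integrable (lebesgue_on \<Xi>) (\<lambda>t. altstep p h t * t ^ k)" "(LINT t|lebesgue_on \<Xi>. altstep p h t * t ^ k) = 0"
    by (auto simp: has_bochner_integral_iff)
qed

lemma altstep_L2: "altstep p h \<in> L2 \<Xi>"
  by (rule bounded_L2[OF _ _ altstep_abs_le])
     (auto simp: \<Xi>_def intro!: borel_imp_lebesgue_on altstep_borel)

lemma altspline_L2: "altspline p h \<in> L2 \<Xi>"
  unfolding \<Xi>_def by (intro continuous_imp_L2 altspline_continuous)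

text \<open>The first coefficient is 1, so the step function dominates the indicator of the first
  cell.\<close>

lemma altstep_norm_ge:
  assumes "h \<le> 1"
  shows "sqrt h \<le> L2_norm \<Xi> (altstep p h)"
proof -
  have "L2_norm \<Xi> (indicat_real {0<..<h}) \<le> L2_norm \<Xi> (altstep p h)"
  proof (rule L2_norm_mono[OF _ altstep_L2])
    show "indicat_real {0<..<h} \<in> L2 \<Xi>" using h assms by (intro indicator_L2_norm) auto
    fix t
    show "\<bar>indicat_real {0<..<h} t\<bar> \<le> \<bar>altstep p h t\<bar>"
    proof (cases "t \<in> {0<..<h}")
      case True
      then show ?thesis using altstep_on_cell[of t 0] by (simp add: altcoeff_def)
    qed simp
  qed
  then show ?thesis using indicator_L2_norm(2)[of h] h assms by simp
qed

text \<open>Height \<open>2 ^ Suc p * h\<close> on a support of length (p + 2) h leaves a factor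
  sqrt(h), which the norm of the step function absorbs. That norm becomes the common unit of all
  later estimates.\<close>

lemma altspline_norm_le:
  assumes le: "real (p + 2) * h \<le> 1"
  shows "L2_norm \<Xi> (altspline p h) \<le> 2 ^ Suc p * sqrt (real (p + 2)) * h * L2_norm \<Xi> (altstep p h)"
proof -
  let ?c = "real (p + 2) * h"
  have c: "0 \<le> ?c" "h \<le> ?c" using h by (simp_all add: algebra_simps)
  have L: "(\<lambda>t. 2 ^ Suc p * h * indicat_real {0<..<?c} t) \<in> L2 \<Xi>"
    by (intro L2_scale indicator_L2_norm c le)
  have "L2_norm \<Xi> (altspline p h) \<le> L2_norm \<Xi> (\<lambda>t. 2 ^ Suc p * h * indicat_real {0<..<?c} t)"
  proof (rule L2_norm_mono[OF altspline_L2 L])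
    fix t
    show "\<bar>altspline p h t\<bar> \<le> \<bar>2 ^ Suc p * h * indicat_real {0<..<?c} t\<bar>"
      using altspline_abs_le[of t] altspline_zero[of t] h by (cases "t \<in> {0<..<?c}") auto
  qed
  also have "\<dots> = 2 ^ Suc p * h * sqrt ?c"
    using h by (simp only: L2_norm_scale indicator_L2_norm(2)[OF c(1) le]) (simp add: abs_mult)
  also have "\<dots> = 2 ^ Suc p * sqrt (real (p + 2)) * h * sqrt h" by (simp add: real_sqrt_mult)
  also have "\<dots> \<le> 2 ^ Suc p * sqrt (real (p + 2)) * h * L2_norm \<Xi> (altstep p h)"
    using h order_trans[OF c(2) le] by (intro mult_left_mono altstep_norm_ge) auto
  finally show ?thesis .
qed

end

text \<open>Shows the spline to be nonzero on a set of positive measure, which makes w an admissible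
  trial function.\<close>

lemma altspline_first:
  assumes h: "0 < h" and t: "t \<in> {0<..<h}"
  shows "altspline p h t = t"
proof -
  have "max 0 (min h (t - real (Suc j) * h)) = 0" for j
  proof -
    have "1 * h \<le> real (Suc j) * h" using h by (intro mult_right_mono) auto
    then have "t - real (Suc j) * h \<le> 0" using t by (simp only: greaterThanLessThan_iff) linarith
    then show ?thesis by (rule max_absorb1[OF min.coboundedI2])
  qed
  then show ?thesis
    unfolding altspline_def sum.atMost_Suc_shift using t by (simp add: altcoeff_def)
qed

section \<open>Hat functions\<close>

definition hat :: "real \<Rightarrow> real \<Rightarrow> real \<Rightarrow> real" where
  "hat \<alpha> H x = max 0 (1 - \<bar>x - \<alpha>\<bar> / H)"

text \<open>Written with two indicators so that replacing each by smooth bumps approximates it in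
  \<open>L2\<close> term by term.\<close>

definition hat' :: "real \<Rightarrow> real \<Rightarrow> real \<Rightarrow> real" where
  "hat' \<alpha> H x = 1 / H * indicator {\<alpha> - H<..<\<alpha>} x + (- 1 / H) * indicator {\<alpha><..<\<alpha> + H} x"

lemma hat_has_derivative:
  assumes H: "0 < H" and x: "x \<notin> {\<alpha> - H, \<alpha>, \<alpha> + H}"
  shows "(hat \<alpha> H has_real_derivative hat' \<alpha> H x) (at x)"
proof -
  consider "x < \<alpha> - H" | "x \<in> {\<alpha> - H<..<\<alpha>}" | "x \<in> {\<alpha><..<\<alpha> + H}" | "\<alpha> + H < x" using x by force
  then show ?thesis
  proof cases
    case 1
    have "((\<lambda>_. 0) has_real_derivative 0) (at x)" by simp
    then have "(hat \<alpha> H has_real_derivative 0) (at x)"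
      by (rule has_field_derivative_transform_within_open[of _ _ _ "{..<\<alpha> - H}"]) (use 1 H in \<open>auto simp: hat_def field_simps\<close>)
    then show ?thesis using 1 H by (simp add: hat'_def)
  next
    case 2
    have "((\<lambda>y. 1 - (\<alpha> - y) / H) has_real_derivative 1 / H) (at x)" using H by (auto intro!: derivative_eq_intros)
    then have "(hat \<alpha> H has_real_derivative 1 / H) (at x)"
      by (rule has_field_derivative_transform_within_open[of _ _ _ "{\<alpha> - H<..<\<alpha>}"]) (use 2 H in \<open>auto simp: hat_def field_simps max_def\<close>)
    then show ?thesis using 2 H by (simp add: hat'_def)
  next
    case 3
    have "((\<lambda>y. 1 - (y - \<alpha>) / H) has_real_derivative - 1 / H) (at x)" using H by (auto intro!: derivative_eq_intros)
    then have "(hat \<alpha> H has_real_derivative - 1 / H) (at x)"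
      by (rule has_field_derivative_transform_within_open[of _ _ _ "{\<alpha><..<\<alpha> + H}"]) (use 3 H in \<open>auto simp: hat_def field_simps max_def\<close>)
    then show ?thesis using 3 H by (simp add: hat'_def)
  next
    case 4
    have "((\<lambda>_. 0) has_real_derivative 0) (at x)" by simp
    then have "(hat \<alpha> H has_real_derivative 0) (at x)"
      by (rule has_field_derivative_transform_within_open[of _ _ _ "{\<alpha> + H<..}"]) (use 4 H in \<open>auto simp: hat_def field_simps\<close>)
    then show ?thesis using 4 H by (simp add: hat'_def)
  qed
qed

lemma hat_continuous: "continuous_on S (hat \<alpha> H)"
  unfolding hat_def[abs_def] divide_inverse by (intro continuous_intros)

lemma hat_bounds: "0 < H \<Longrightarrow> 0 \<le> hat \<alpha> H x" "0 < H \<Longrightarrow> hat \<alpha> H x \<le> 1" "0 < H \<Longrightarrow> \<bar>hat \<alpha> H x\<bar> \<le> 1"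
  by (auto simp: hat_def)

lemma hat_zero: "0 < H \<Longrightarrow> x \<notin> {\<alpha> - H<..<\<alpha> + H} \<Longrightarrow> hat \<alpha> H x = 0"
  by (auto simp: hat_def field_simps max_def)

lemma hat_left: "0 < H \<Longrightarrow> \<alpha> - H \<le> x \<Longrightarrow> x \<le> \<alpha> \<Longrightarrow> hat \<alpha> H x = 1 - (\<alpha> - x) / H"
  by (simp add: hat_def pos_divide_le_eq)

lemma hat_right: "0 < H \<Longrightarrow> \<alpha> \<le> x \<Longrightarrow> x \<le> \<alpha> + H \<Longrightarrow> hat \<alpha> H x = 1 - (x - \<alpha>) / H"
  by (simp add: hat_def pos_divide_le_eq)

lemma hat_pos: "0 < H \<Longrightarrow> \<alpha> - H < x \<Longrightarrow> x < \<alpha> + H \<Longrightarrow> 0 < hat \<alpha> H x"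
  by (simp add: hat_def less_max_iff_disj pos_divide_less_eq abs_less_iff)

lemma hat'_borel: "hat' \<alpha> H \<in> borel_measurable borel"
  unfolding hat'_def[abs_def] by measurable

lemma hat'_abs_le: "0 < H \<Longrightarrow> \<bar>hat' \<alpha> H x\<bar> \<le> 1 / H"
  by (auto simp: hat'_def indicator_def)

section \<open>Hat functions as elements of \<open>H01\<close>, their mass and norm\<close>

context bounded_interval
begin

lemma bump_L2_tendsto:
  "(\<lambda>n. L2_norm \<Omega> (\<lambda>x. bump (real (Suc n)) s t x - indicator {s<..<t} x)) \<longlonglongrightarrow> 0"
proof -
  have "(\<lambda>n. LINT x|lebesgue_on \<Omega>. (bump (real (Suc n)) s t x - indicator {s<..<t} x)\<^sup>2) \<longlonglongrightarrow> (LINT x|lebesgue_on \<Omega>. 0)"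
  proof (rule integral_dominated_convergence[where w = "\<lambda>_. 1"])
    interpret finite_measure "lebesgue_on \<Omega>" by (rule finite_measure_lebesgue_on) simp
    show "integrable (lebesgue_on \<Omega>) (\<lambda>_. 1 :: real)" by simp
    have [measurable]: "bump (real (Suc n)) s t \<in> borel_measurable borel" for n
      by (intro borel_measurable_continuous_onI smooth_continuous smooth_bump)
    have "(\<lambda>x. (bump (real (Suc n)) s t x - indicator {s<..<t} x)\<^sup>2) \<in> borel_measurable borel" for n by measurable
    then show "(\<lambda>x. (bump (real (Suc n)) s t x - indicator {s<..<t} x)\<^sup>2) \<in> borel_measurable (lebesgue_on \<Omega>)" for n
      by (intro borel_imp_lebesgue_on) simp
    show "AE x in lebesgue_on \<Omega>. (\<lambda>n. (bump (real (Suc n)) s t x - indicator {s<..<t} x)\<^sup>2) \<longlonglongrightarrow> 0"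
    proof (rule AE_I2)
      fix x
      show "(\<lambda>n. (bump (real (Suc n)) s t x - indicator {s<..<t} x)\<^sup>2) \<longlonglongrightarrow> 0"
        using tendsto_power[OF LIM_zero[OF bump_tendsto[of s t x]], of 2] by simp
    qed
    show "AE x in lebesgue_on \<Omega>. norm ((bump (real (Suc n)) s t x - indicator {s<..<t} x)\<^sup>2) \<le> 1" for n
    proof (rule AE_I2)
      fix x
      have "\<bar>bump (real (Suc n)) s t x - indicator {s<..<t} x\<bar> \<le> 1"
        using bump_bounds[of "real (Suc n)" s t x] by (auto simp: indicator_def)
      then show "norm ((bump (real (Suc n)) s t x - indicator {s<..<t} x)\<^sup>2) \<le> 1"
        by (simp add: abs_square_le_1)
    qed
  qed simp
  then show ?thesis
    unfolding L2_norm_def using tendsto_real_sqrt by fastforce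
qed

lemma hat'_L2: "0 < H \<Longrightarrow> hat' \<alpha> H \<in> L2 \<Omega>"
  by (rule bounded_L2[OF _ _ hat'_abs_le]) (auto intro!: borel_imp_lebesgue_on hat'_borel)

text \<open>The vanishing integral makes the antiderivative return to 0 at t, so that it has compact
  support again.\<close>

lemma smooth_antiderivative:
  assumes f: "smooth f" "\<And>x. x \<notin> {s..t} \<Longrightarrow> f x = 0" and st: "s \<le> t" and int: "(f has_integral 0) {s..t}"
  obtains F where "\<And>x. (F has_real_derivative f x) (at x)" "smooth F" "\<And>x. x \<notin> {s..t} \<Longrightarrow> F x = 0"
proof -
  \<comment> \<open>The lower limit lies left of s, so that s is interior to the range of
    integration and F has a two-sided derivative there.\<close>
  define F where "F x = integral {s - 1..x} f" for x
  have c: "continuous_on A f" for A using f(1) by (rule smooth_continuous)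
  have i: "f integrable_on {x..y}" for x y by (intro integrable_continuous_real c)
  have left: "F x = 0" if "x \<le> s" for x
  proof -
    have "integral {s - 1..x} f = integral {s - 1..x} (\<lambda>_. 0)"
    proof (rule integral_spike[of "{s}"])
      show "(0::real) = f y" if "y \<in> {s - 1..x} - {s}" for y using that \<open>x \<le> s\<close> f(2)[of y] by auto
    qed simp
    then show ?thesis by (simp add: F_def)
  qed
  have right: "F x = 0" if "t \<le> x" for x
  proof -
    have "integral {t..x} f = integral {t..x} (\<lambda>_. 0)"
    proof (rule integral_spike[of "{t}"])
      show "(0::real) = f y" if "y \<in> {t..x} - {t}" for y using that f(2)[of y] by auto
    qed simp
    then have "integral {t..x} f = 0" by simp
    moreover have "integral {s..t} f = 0" using int by (rule integral_unique)
    moreover have "integral {s - 1..s} f + integral {s..x} f = F x" "integral {s..t} f + integral {t..x} f = integral {s..x} f"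
      unfolding F_def using that st by (auto intro!: Henstock_Kurzweil_Integration.integral_combine i)
    ultimately show ?thesis using left[of s] by (simp add: F_def)
  qed
  have d: "(F has_real_derivative f x) (at x)" for x
  proof (cases "x < s")
    case True
    have "((\<lambda>_. 0) has_real_derivative 0) (at x)" by simp
    then have "(F has_real_derivative 0) (at x)"
      by (rule has_field_derivative_transform_within_open[of _ _ _ "{..<s}"]) (use True left in auto)
    then show ?thesis using f(2)[of x] True by simp
  next
    case False
    have "((\<lambda>u. integral {s - 1..u} f) has_real_derivative f x) (at x within {s - 1..x + 1})"
      using False by (intro integral_has_real_derivative c) auto
    then show ?thesis
      using False at_within_Icc_at[of "s - 1" x "x + 1"] by (simp add: F_def[abs_def])
  qed
  then have "smooth F" using smoothI f(1) by blast
  moreover have "F x = 0" if "x \<notin> {s..t}" for x using left[of x] right[of x] that by auto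
  ultimately show ?thesis using that d by blast
qed

text \<open>The derivative is mollified rather than the hat: its two indicators become bumps of
  equal mass with opposite weights, so the antiderivative is a test function.\<close>

lemma hat_H01:
  assumes H: "0 < H" and sub: "a < \<alpha> - H" "\<alpha> + H < b"
  shows "hat \<alpha> H \<in> H01 \<Omega>" "weak_deriv \<Omega> (hat \<alpha> H) (hat' \<alpha> H)" "H01_norm \<Omega> (hat \<alpha> H) = L2_norm \<Omega> (hat' \<alpha> H)"
proof -
  define f where "f n x = 1 / H * bump (real (Suc n)) (\<alpha> - H) \<alpha> x + (- 1 / H) * bump (real (Suc n)) \<alpha> (\<alpha> + H) x" for n x
  have sm: "smooth (f n)" for n unfolding f_def[abs_def] by (intro smooth_lincomb smooth_bump)
  have f0: "f n x = 0" if "x \<notin> {\<alpha> - H..\<alpha> + H}" for n x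
    unfolding f_def using that H by (subst bump_zero, simp, force, subst bump_zero, simp, force, simp)
  have fint: "(f n has_integral 0) {\<alpha> - H..\<alpha> + H}" for n
  proof -
    let ?b = "bump (real (Suc n)) (\<alpha> - H) \<alpha>" and ?c = "bump (real (Suc n)) \<alpha> (\<alpha> + H)"
    have c: "?b integrable_on {x..y}" "?c integrable_on {x..y}" for x y
      by (intro integrable_continuous_real smooth_continuous smooth_bump)+
    let ?I = "integral {\<alpha> - H..\<alpha>} ?b"
    have b1: "(?b has_integral ?I) {\<alpha> - H..\<alpha>}" using c by (intro integrable_integral)
    have "((\<lambda>x. ?b (x - H)) has_integral ?I) {\<alpha>..\<alpha> + H}"
      using has_integral_affinity'[of ?b ?I "\<alpha> - H" \<alpha> 1 "- H"] b1 by simp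
    \<comment> \<open>The right bump is the left one shifted by H, so their integrals
      coincide.\<close>
    moreover have "?b (x - H) = ?c x" for x by (simp add: bump_def algebra_simps)
    ultimately have c1: "(?c has_integral ?I) {\<alpha>..\<alpha> + H}" by simp
    have 1: "(f n has_integral 1 / H * ?I) {\<alpha> - H..\<alpha>}"
    proof (rule has_integral_eq[OF _ has_integral_mult_right[OF b1]])
      show "1 / H * ?b x = f n x" if "x \<in> {\<alpha> - H..\<alpha>}" for x
        unfolding f_def using bump_zero[of "real (Suc n)" x \<alpha> "\<alpha> + H"] that by simp
    qed
    have 2: "(f n has_integral (- 1 / H) * ?I) {\<alpha>..\<alpha> + H}"
    proof (rule has_integral_eq[OF _ has_integral_mult_right[OF c1]])
      show "(- 1 / H) * ?c x = f n x" if "x \<in> {\<alpha>..\<alpha> + H}" for x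
        unfolding f_def using bump_zero[of "real (Suc n)" x "\<alpha> - H" \<alpha>] that by simp
    qed
    show ?thesis using has_integral_combine[OF _ _ 1 2] H by simp
  qed
  have "\<exists>F. (\<forall>x. (F has_real_derivative f n x) (at x)) \<and> smooth F \<and> (\<forall>x. x \<notin> {\<alpha> - H..\<alpha> + H} \<longrightarrow> F x = 0)" for n
    by (rule smooth_antiderivative[OF sm f0 _ fint[of n]]) (use H in auto)
  then obtain \<phi> where \<phi>: "\<And>n x. (\<phi> n has_real_derivative f n x) (at x)" "\<And>n. smooth (\<phi> n)"
      "\<And>n x. x \<notin> {\<alpha> - H..\<alpha> + H} \<Longrightarrow> \<phi> n x = 0" by metis
  have T: "\<phi> n \<in> test_functions \<Omega>" for n
    by (rule test_functionsI[OF \<phi>(2,3)]) (use sub in auto)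
  have d: "deriv (\<phi> n) = f n" for n using \<phi>(1) by (auto intro: DERIV_imp_deriv)
  have bL: "bump r s t \<in> L2 \<Omega>" for r s t by (intro continuous_imp_L2 smooth_continuous smooth_bump)
  have iL: "indicat_real {s<..<t} \<in> L2 \<Omega>" for s t
    by (rule indicator_L2) auto
  have lim: "(\<lambda>n. L2_norm \<Omega> (\<lambda>x. f n x - hat' \<alpha> H x)) \<longlonglongrightarrow> 0"
    unfolding f_def hat'_def by (intro L2_norm_lincomb_tendsto bL iL bump_L2_tendsto)
  have fL: "f n \<in> L2 \<Omega>" for n unfolding f_def[abs_def] by (intro L2_lincomb bL)
  have hL: "hat \<alpha> H \<in> L2 \<Omega>" by (intro continuous_imp_L2 hat_continuous)
  have pL: "\<phi> n \<in> L2 \<Omega>" for n by (intro test_L2 T)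
  have "L2_norm \<Omega> (\<lambda>x. \<phi> n x - hat \<alpha> H x) \<le> (b - a) * L2_norm \<Omega> (\<lambda>x. f n x - hat' \<alpha> H x)" for n
  proof -
    let ?N = "L2_norm \<Omega> (\<lambda>x. f n x - hat' \<alpha> H x)"
    have z: "\<phi> n a - hat \<alpha> H a = 0" using \<phi>(3)[of a n] hat_zero[OF H, of a \<alpha>] sub H by auto
    \<comment> \<open>Both functions vanish at a, so closeness of the derivatives already yields
      closeness of the functions.\<close>
    have "\<bar>\<phi> n x - hat \<alpha> H x\<bar> \<le> sqrt (b - a) * ?N" if x: "x \<in> \<Omega>" for x
    proof -
      have "\<bar>(\<phi> n x - hat \<alpha> H x) - (\<phi> n a - hat \<alpha> H a)\<bar> \<le> sqrt (x - a) * ?N"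
      proof (rule derivative_diff_bound[of "{\<alpha> - H, \<alpha>, \<alpha> + H}"])
        show "continuous_on {a..b} (\<lambda>x. \<phi> n x - hat \<alpha> H x)"
          by (intro continuous_on_diff hat_continuous smooth_continuous \<phi>)
        show "((\<lambda>x. \<phi> n x - hat \<alpha> H x) has_real_derivative f n y - hat' \<alpha> H y) (at y)"
          if "y \<in> \<Omega> - {\<alpha> - H, \<alpha>, \<alpha> + H}" for y
          using that by (intro DERIV_diff \<phi> hat_has_derivative H) auto
        show "(\<lambda>x. f n x - hat' \<alpha> H x) \<in> L2 \<Omega>" by (intro L2_diff fL hat'_L2 H)
      qed (use x in auto)
      also have "\<dots> \<le> sqrt (b - a) * ?N" using x by (intro mult_right_mono) auto
      finally show ?thesis by (simp add: z)
    qed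
    then have "L2_norm \<Omega> (\<lambda>x. \<phi> n x - hat \<alpha> H x) \<le> sqrt (b - a) * ?N * sqrt (measure lebesgue \<Omega>)"
      using ab by (intro L2_norm_le_bound L2_diff pL hL) auto
    also have "\<dots> = (sqrt (b - a) * sqrt (b - a)) * ?N" using ab by simp
    also have "\<dots> = (b - a) * ?N" using ab by simp
    finally show ?thesis .
  qed
  then have lim0: "(\<lambda>n. L2_norm \<Omega> (\<lambda>x. \<phi> n x - hat \<alpha> H x)) \<longlonglongrightarrow> 0"
    by (intro Lim_null_comparison[OF _ tendsto_mult_right_zero[OF lim, of "b - a"]]) (auto intro!: always_eventually)
  from H01I[OF hL hat'_L2[OF H] T lim0] lim
  show "hat \<alpha> H \<in> H01 \<Omega>" "weak_deriv \<Omega> (hat \<alpha> H) (hat' \<alpha> H)" "H01_norm \<Omega> (hat \<alpha> H) = L2_norm \<Omega> (hat' \<alpha> H)"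
    by (auto simp: d)
qed

lemma integral_subinterval:
  assumes "a \<le> c" "c \<le> d" "d \<le> b"
  shows "(LINT x|lebesgue_on \<Omega>. indicat_real {c..d} x) = d - c" "integrable (lebesgue_on \<Omega>) (indicat_real {c..d})"
proof -
  have "indicat_real {c..d} \<in> L2 \<Omega>"
    by (rule indicator_L2) auto
  then show i: "integrable (lebesgue_on \<Omega>) (indicat_real {c..d})" by (intro L2_integrable) auto
  have "(indicat_real {c..d} has_integral (LINT x|lebesgue_on \<Omega>. indicat_real {c..d} x)) {a..b}"
    unfolding has_integral_Icc_iff_Ioo using i by (intro has_integral_integral_lebesgue_on) auto
  moreover have "(indicat_real {c..d} has_integral d - c) {a..b}"
  proof -
    have "((\<lambda>x. if x \<in> {c..d} then 1 else 0) has_integral (d - c)) {a..b}"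
      using has_integral_const_real[of "1::real" c d] assms by (subst has_integral_restrict) auto
    then show ?thesis by (rule has_integral_eq[rotated]) (auto simp: indicator_def)
  qed
  ultimately show "(LINT x|lebesgue_on \<Omega>. indicat_real {c..d} x) = d - c" by (rule has_integral_unique)
qed

lemma integral_hat:
  assumes H: "0 < H" and sub: "a \<le> \<alpha> - H" "\<alpha> + H \<le> b"
  shows "(LINT x|lebesgue_on \<Omega>. hat \<alpha> H x) = H" "integrable (lebesgue_on \<Omega>) (hat \<alpha> H)"
proof -
  show i: "integrable (lebesgue_on \<Omega>) (hat \<alpha> H)"
    by (intro L2_integrable continuous_imp_L2 hat_continuous) auto
  have "(hat \<alpha> H has_integral (LINT x|lebesgue_on \<Omega>. hat \<alpha> H x)) {a..b}"
    unfolding has_integral_Icc_iff_Ioo using i by (intro has_integral_integral_lebesgue_on) auto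
  moreover have "(hat \<alpha> H has_integral H) {a..b}"
  proof -
    have "((\<lambda>x. 1 - (\<alpha> - x) / H) has_integral (\<alpha> - \<alpha> + H)\<^sup>2 / (2 * H) - (\<alpha> - H - \<alpha> + H)\<^sup>2 / (2 * H)) {\<alpha> - H..\<alpha>}"
      by (rule fundamental_theorem_of_calculus)
         (use H in \<open>auto intro!: derivative_eq_intros simp: field_simps simp flip: has_real_derivative_iff_has_vector_derivative\<close>)
    then have "((\<lambda>x. 1 - (\<alpha> - x) / H) has_integral H / 2) {\<alpha> - H..\<alpha>}" using H by (simp add: power2_eq_square)
    then have 1: "(hat \<alpha> H has_integral H / 2) {\<alpha> - H..\<alpha>}"
      by (rule has_integral_eq[rotated]) (use H in \<open>auto simp: hat_def field_simps max_def\<close>)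
    have "((\<lambda>x. 1 - (x - \<alpha>) / H) has_integral (- ((\<alpha> + H - (\<alpha> + H))\<^sup>2 / (2 * H)) - - ((\<alpha> + H - \<alpha>)\<^sup>2 / (2 * H)))) {\<alpha>..\<alpha> + H}"
      by (rule fundamental_theorem_of_calculus)
         (use H in \<open>auto intro!: derivative_eq_intros simp: field_simps simp flip: has_real_derivative_iff_has_vector_derivative\<close>)
    then have "((\<lambda>x. 1 - (x - \<alpha>) / H) has_integral H / 2) {\<alpha>..\<alpha> + H}" using H by (simp add: power2_eq_square)
    then have 2: "(hat \<alpha> H has_integral H / 2) {\<alpha>..\<alpha> + H}"
      by (rule has_integral_eq[rotated]) (use H in \<open>auto simp: hat_def field_simps max_def\<close>)
    have "(hat \<alpha> H has_integral H) {\<alpha> - H..\<alpha> + H}"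
      using has_integral_combine[OF _ _ 1 2] H by simp
    then show ?thesis
      by (rule has_integral_on_superset) (use sub hat_zero[OF H] in auto)
  qed
  ultimately show "(LINT x|lebesgue_on \<Omega>. hat \<alpha> H x) = H" by (rule has_integral_unique)
qed

lemma hat_norm_le:
  assumes H: "0 < H" and sub: "a < \<alpha> - H" "\<alpha> + H < b"
  shows "H01_norm \<Omega> (hat \<alpha> H) \<le> sqrt (2 / H)"
proof -
  have L: "indicat_real {\<alpha> - H..\<alpha> + H} \<in> L2 \<Omega>"
    by (rule indicator_L2) auto
  have "L2_norm \<Omega> (hat' \<alpha> H) \<le> L2_norm \<Omega> (\<lambda>x. 1 / H * indicat_real {\<alpha> - H..\<alpha> + H} x)"
    by (rule L2_norm_mono[OF hat'_L2[OF H] L2_scale[OF L]]) (use H in \<open>auto simp: hat'_def indicator_def\<close>)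
  also have "\<dots> = 1 / H * L2_norm \<Omega> (indicat_real {\<alpha> - H..\<alpha> + H})"
    using H by (simp only: L2_norm_scale) simp
  also have "L2_norm \<Omega> (indicat_real {\<alpha> - H..\<alpha> + H}) = sqrt (2 * H)"
  proof -
    have "(LINT x|lebesgue_on \<Omega>. (indicat_real {\<alpha> - H..\<alpha> + H} x)\<^sup>2) = (LINT x|lebesgue_on \<Omega>. indicat_real {\<alpha> - H..\<alpha> + H} x)"
      by (intro Bochner_Integration.integral_cong) (auto simp: indicator_def)
    then show ?thesis using integral_subinterval(1)[of "\<alpha> - H" "\<alpha> + H"] sub H by (simp add: L2_norm_def)
  qed
  also have "1 / H * sqrt (2 * H) = sqrt (2 / H)"
  proof -
    have "sqrt (2 / H) = sqrt (2 * H / H\<^sup>2)" using H by (simp add: power2_eq_square)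
    then show ?thesis using H by (simp add: real_sqrt_divide)
  qed
  finally show ?thesis by (simp add: hat_H01(3)[OF H sub])
qed

section \<open>The operator A and the trial space\<close>

lemma closure_Sigma: "closure (\<Sigma> \<Omega>) = {0..1} \<times> {a..b}"
  using ab by (simp add: closure_Times \<Xi>_def)

text \<open>The sign of M is not prescribed by \<open>bounded_coercive\<close>, so its absolute
  value is returned. Oddness in v is recorded because nonnegativity of dual norms rests on
  it.\<close>

lemma A_op_bound:
  assumes "bounded_coercive \<Omega> A"
  obtains M where "0 \<le> M" "\<And>w v. w \<in> Y \<Omega> \<Longrightarrow> v \<in> Y \<Omega> \<Longrightarrow> \<bar>A_op A w v\<bar> \<le> M * (Y_norm \<Omega> w * Y_norm \<Omega> v)"
    "\<And>w v. w \<in> Y \<Omega> \<Longrightarrow> v \<in> Y \<Omega> \<Longrightarrow> A_op A w (\<lambda>z. - v z) = - A_op A w v"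
proof -
  obtain M m where AE: "AE t in lebesgue_on \<Xi>.
        (\<forall>u\<in>H01 \<Omega>. linear_on_H01 \<Omega> (\<lambda>v. A t u v)) \<and>
        (\<forall>v\<in>H01 \<Omega>. linear_on_H01 \<Omega> (\<lambda>u. A t u v)) \<and>
        (\<forall>u\<in>H01 \<Omega>. \<forall>v\<in>H01 \<Omega>. \<bar>A t u v\<bar> \<le> M * H01_norm \<Omega> u * H01_norm \<Omega> v) \<and>
        (\<forall>u\<in>H01 \<Omega>. A t u u \<ge> m * (H01_norm \<Omega> u)\<^sup>2)"
    using assms by (auto simp: bounded_coercive_def)
  have lin: "AE t in lebesgue_on \<Xi>. \<forall>u\<in>H01 \<Omega>. linear_on_H01 \<Omega> (\<lambda>v. A t u v)"
    and bnd: "AE t in lebesgue_on \<Xi>. \<forall>u\<in>H01 \<Omega>. \<forall>v\<in>H01 \<Omega>. \<bar>A t u v\<bar> \<le> M * H01_norm \<Omega> u * H01_norm \<Omega> v"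
    using AE by (eventually_elim, blast)+
  have "\<bar>A_op A w v\<bar> \<le> \<bar>M\<bar> * (Y_norm \<Omega> w * Y_norm \<Omega> v)" if w: "w \<in> Y \<Omega>" and v: "v \<in> Y \<Omega>" for w v
  proof -
    have "AE t in lebesgue_on \<Xi>. \<bar>A t (slice w t) (slice v t)\<bar> \<le> \<bar>M\<bar> * (\<bar>H01_norm \<Omega> (slice w t)\<bar> * \<bar>H01_norm \<Omega> (slice v t)\<bar>)"
      using bnd Y_slice[OF w] Y_slice[OF v]
    proof eventually_elim
      case (elim t)
      have "M * (H01_norm \<Omega> (slice w t) * H01_norm \<Omega> (slice v t)) \<le> \<bar>M\<bar> * (H01_norm \<Omega> (slice w t) * H01_norm \<Omega> (slice v t))"
        by (intro mult_right_mono) auto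
      moreover have "\<bar>A t (slice w t) (slice v t)\<bar> \<le> M * H01_norm \<Omega> (slice w t) * H01_norm \<Omega> (slice v t)"
        using elim by blast
      ultimately show ?case by (simp add: mult.assoc)
    qed
    from weighted_Cauchy_Schwarz[OF Y_slice_norm(1)[OF w] Y_slice_norm(1)[OF v] _ this]
    show ?thesis by (simp add: A_op_def Y_slice_norm(2)[OF w] Y_slice_norm(2)[OF v])
  qed
  moreover have "A_op A w (\<lambda>z. - v z) = - A_op A w v" if w: "w \<in> Y \<Omega>" and v: "v \<in> Y \<Omega>" for w v
  proof -
    have "AE t in lebesgue_on \<Xi>. A t (slice w t) (\<lambda>x. - v (t, x)) = - A t (slice w t) (slice v t)"
      using lin Y_slice[OF w] Y_slice[OF v]
    proof eventually_elim
      case (elim t)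
      have "linear_on_H01 \<Omega> (\<lambda>v. A t (slice w t) v)" using elim(1,2) by blast
      from this[unfolded linear_on_H01_def, THEN bspec, OF elim(3), THEN bspec, OF elim(3), THEN spec, THEN spec, of "-1" 0]
      show ?case by simp
    qed
    from lebesgue_on_integral_cong_AE[OF Xi_lmeasurable(2) this]
    show ?thesis by (simp add: A_op_def)
  qed
  ultimately show ?thesis using that[of "\<bar>M\<bar>"] by simp
qed

text \<open>The infimum defining \<open>\<gamma>\<^sub>\<delta>\<close> ranges over all of \<open>X\<^sup>\<delta>\<close>, and \<open>Sup\<close> of an unbounded set of reals is a junk
  value. So even \<open>0 \<le> \<gamma>\<^sub>\<delta>\<close> requires that every element of \<open>X\<^sup>\<delta>\<close> has a weak time derivative.\<close>

lemma X_disc_weak_time_deriv: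
  assumes P: "P division_of closure (\<Sigma> \<Omega>)"
    and sq: "\<And>K. K \<in> P \<Longrightarrow> \<exists>t x l. 0 < l \<and> K = {t..t + l} \<times> {x..x + l}"
    and w: "w \<in> X_disc \<Omega> P"
  obtains g where "weak_time_deriv \<Omega> w g"
proof -
  have cont: "continuous_on (closure (\<Sigma> \<Omega>)) w" and wQ: "w \<in> Q 1 1 P" using w by (auto simp: X_disc_def)
  have "\<forall>K\<in>P. \<exists>k :: real \<times> real \<times> real. 0 < snd (snd k) \<and>
      K = {fst k..fst k + snd (snd k)} \<times> {fst (snd k)..fst (snd k) + snd (snd k)}"
    using sq by (metis fst_conv snd_conv)
  from bchoice[OF this] obtain k :: "(real \<times> real) set \<Rightarrow> real \<times> real \<times> real" where
    k: "\<forall>K\<in>P. 0 < snd (snd (k K)) \<and> K = {fst (k K)..fst (k K) + snd (snd (k K))} \<times> {fst (snd (k K))..fst (snd (k K)) + snd (snd (k K))}"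
    by blast
  define tt xx ll where "tt K = fst (k K)" and "xx K = fst (snd (k K))" and "ll K = snd (snd (k K))" for K
  have K: "0 < ll K" "K = {tt K..tt K + ll K} \<times> {xx K..xx K + ll K}" if "K \<in> P" for K
    using k that unfolding tt_def xx_def ll_def by blast+
  have "\<forall>K\<in>P. \<exists>c :: nat \<Rightarrow> nat \<Rightarrow> real. AE z in lebesgue_on K. w z = (\<Sum>i\<le>1. \<Sum>j\<le>1. c i j * fst z ^ i * snd z ^ j)"
    using wQ unfolding Q_def by (rule CollectD)
  from bchoice[OF this] obtain c :: "(real \<times> real) set \<Rightarrow> nat \<Rightarrow> nat \<Rightarrow> real" where
    c: "\<And>K. K \<in> P \<Longrightarrow> AE z in lebesgue_on K. w z = (\<Sum>i\<le>1. \<Sum>j\<le>1. c K i j * fst z ^ i * snd z ^ j)"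
    by blast
  define d e f g where "d K = c K 0 0" and "e K = c K 0 1" and "f K = c K 1 0" and "g K = c K 1 1" for K
  have sub: "K \<subseteq> {0..1} \<times> {a..b}" if "K \<in> P" for K using P that unfolding closure_Sigma by blast
  have intK: "interior K = {tt K<..<tt K + ll K} \<times> {xx K<..<xx K + ll K}" if "K \<in> P" for K
    using K(2)[OF that] by (metis interior_Times interior_atLeastAtMost_real)
  \<comment> \<open>Continuity of w upgrades the almost everywhere formula of \<open>Q\<close> to
    all interior points of the cell.\<close>
  have wK: "w (t, x) = d K + e K * x + f K * t + g K * t * x" if KP: "K \<in> P" and z: "(t, x) \<in> interior K" for K t x
  proof -
    let ?r = "\<lambda>z. d K + e K * snd z + f K * fst z + g K * fst z * snd z"
    have "w (t, x) - ?r (t, x) = 0"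
    proof (rule AE_zero_imp_zero[where K = K])
      show "AE z in lebesgue_on K. w z - ?r z = 0"
        using c[OF KP] by eventually_elim (simp add: d_def e_def f_def g_def)
      show "K \<in> sets lebesgue" using P KP by (auto dest!: division_ofD(4))
      have "continuous_on (interior K) w"
        using cont by (rule continuous_on_subset) (use sub[OF KP] interior_subset closure_Sigma in blast)
      then show "continuous_on (interior K) (\<lambda>z. w z - ?r z)" by (intro continuous_intros)
    qed (use z interior_subset in auto)
    then show ?thesis by simp
  qed
  \<comment> \<open>The time derivative of the bilinear polynomial on each open cell, and 0 on all
    cell edges.\<close>
  define \<rho> where "\<rho> z = (\<Sum>K\<in>P. indicator (interior K) z * (f K + g K * snd z))" for z
  \<comment> \<open>The coordinates of all cell edges: a point of the rectangle avoiding these lines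
    in both coordinates is interior to a cell.\<close>
  define T0 where "T0 = tt ` P \<union> (\<lambda>K. tt K + ll K) ` P"
  define X0 where "X0 = xx ` P \<union> (\<lambda>K. xx K + ll K) ` P"
  have fin: "finite P" using P by (rule division_ofD)
  have "weak_time_deriv \<Omega> w (\<lambda>t u. LINT x|lebesgue_on \<Omega>. \<rho> (t, x) * u x)"
  proof (rule weak_time_derivI[OF cont])
    show "finite T0" "finite X0" using fin by (auto simp: T0_def X0_def)
    have "(\<lambda>z. indicator (interior K) z * (f K + g K * snd z)) \<in> borel_measurable borel" for K
    proof -
      have [measurable]: "interior K \<in> sets borel" by simp
      have [measurable]: "(\<lambda>z :: real \<times> real. f K + g K * snd z) \<in> borel_measurable borel"
        by (intro borel_measurable_continuous_onI continuous_intros)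
      show ?thesis by measurable
    qed
    then show "\<rho> \<in> borel_measurable borel" unfolding \<rho>_def[abs_def] by (intro borel_measurable_sum)
    show "\<bar>\<rho> z\<bar> \<le> (\<Sum>K\<in>P. \<bar>f K\<bar> + \<bar>g K\<bar> * (\<bar>a\<bar> + \<bar>b\<bar>))" for z
    proof -
      have "\<bar>\<rho> z\<bar> \<le> (\<Sum>K\<in>P. \<bar>indicator (interior K) z * (f K + g K * snd z)\<bar>)"
        unfolding \<rho>_def by (rule sum_abs)
      also have "\<dots> \<le> (\<Sum>K\<in>P. \<bar>f K\<bar> + \<bar>g K\<bar> * (\<bar>a\<bar> + \<bar>b\<bar>))"
      proof (rule sum_mono)
        fix K assume KP: "K \<in> P"
        show "\<bar>indicator (interior K) z * (f K + g K * snd z)\<bar> \<le> \<bar>f K\<bar> + \<bar>g K\<bar> * (\<bar>a\<bar> + \<bar>b\<bar>)"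
        proof (cases "z \<in> interior K")
          case True
          then have "z \<in> {0..1} \<times> {a..b}" using sub[OF KP] interior_subset by blast
          then have "\<bar>snd z\<bar> \<le> \<bar>a\<bar> + \<bar>b\<bar>" by (cases z) auto
          then have "\<bar>g K\<bar> * \<bar>snd z\<bar> \<le> \<bar>g K\<bar> * (\<bar>a\<bar> + \<bar>b\<bar>)" by (intro mult_left_mono) auto
          moreover have "\<bar>f K + g K * snd z\<bar> \<le> \<bar>f K\<bar> + \<bar>g K\<bar> * \<bar>snd z\<bar>"
            by (metis abs_mult abs_triangle_ineq)
          ultimately show ?thesis using True by simp
        qed simp
      qed
      finally show ?thesis .
    qed
    show "((\<lambda>s. w (s, x)) has_real_derivative \<rho> (t, x)) (at t)" if t: "t \<in> \<Xi> - T0" and x: "x \<in> \<Omega> - X0" for t x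
    proof -
      have "(t, x) \<in> closure (\<Sigma> \<Omega>)" using t x unfolding closure_Sigma by (auto simp: \<Xi>_def)
      then obtain K where KP: "K \<in> P" "(t, x) \<in> K" using division_ofD(6)[OF P] by blast
      have "t \<noteq> tt K" "t \<noteq> tt K + ll K" "x \<noteq> xx K" "x \<noteq> xx K + ll K"
        using t x KP(1) by (auto simp: T0_def X0_def)
      moreover have "t \<in> {tt K..tt K + ll K}" "x \<in> {xx K..xx K + ll K}"
        using subsetD[OF equalityD1[OF K(2)[OF KP(1)]] KP(2)] by (simp_all only: mem_Sigma_iff)
      ultimately have z: "(t, x) \<in> interior K" unfolding intK[OF KP(1)] by auto
      have "\<rho> (t, x) = (\<Sum>L\<in>P. if L = K then f K + g K * x else 0)"
        unfolding \<rho>_def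
      proof (rule sum.cong)
        fix L assume L: "L \<in> P"
        show "indicator (interior L) (t, x) * (f L + g L * snd (t, x)) = (if L = K then f K + g K * x else 0)"
        proof (cases "L = K")
          case False
          then have "interior L \<inter> interior K = {}" using division_ofD(5)[OF P L KP(1)] by simp
          then show ?thesis using z False by (auto simp: indicator_def)
        qed (use z in simp)
      qed simp
      also have "\<dots> = f K + g K * x" using fin KP(1) by simp
      finally have \<rho>: "\<rho> (t, x) = f K + g K * x" .
      have "((\<lambda>s. d K + e K * x + f K * s + g K * s * x) has_real_derivative f K + g K * x) (at t)"
        by (auto intro!: derivative_eq_intros)
      then show ?thesis
        unfolding \<rho>
      proof (rule has_field_derivative_transform_within_open)
        show "open {tt K<..<tt K + ll K}" "t \<in> {tt K<..<tt K + ll K}" using z by (auto simp: intK[OF KP(1)])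
        fix s assume "s \<in> {tt K<..<tt K + ll K}"
        then have "(s, x) \<in> interior K" using z by (auto simp: intK[OF KP(1)])
        from wK[OF KP(1) this] show "d K + e K * x + f K * s + g K * s * x = w (s, x)" by simp
      qed
    qed
  qed
  then show ?thesis by (rule that)
qed

end

section \<open>The local mesh\<close>

text \<open>One sufficiently fine mesh of the family, with n = H/h. That the fine rectangle fits on
  the left is guaranteed for small H by the distance of \<alpha> from the boundary; on the right it
  follows from the gap and \<open>\<beta> < b\<close>.\<close>

locale local_mesh = bounded_interval a b for a b :: real +
  fixes P :: "(real \<times> real) set set" and h H \<alpha> \<beta> C :: real and p q n :: nat
  assumes P: "P division_of closure (\<Sigma> {a<..<b})"
    and squares: "\<And>K. K \<in> P \<Longrightarrow> \<exists>t x l. 0 < l \<and> K = {t..t + l} \<times> {x..x + l}"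
    and h: "0 < h" and q: "1 \<le> q" and n: "p + 2 \<le> n" "real n * h = H"
    and fine: "\<And>i j :: nat. i < n \<Longrightarrow> j < 2 * n \<Longrightarrow> {real i * h..real (i + 1) * h} \<times>
           {\<alpha> - H + real j * h..\<alpha> - H + real (j + 1) * h} \<in> P"
    and coarse: "{0..H} \<times> {\<beta> - H..\<beta>} \<in> P"
    and gap: "0 < (\<beta> - H) - (\<alpha> + H)" "(\<beta> - H) - (\<alpha> + H) \<le> C * H"
    and inside: "a < \<alpha> - H" "\<beta> < b"
begin

lemma H: "0 < H" "h \<le> H" "real (p + 2) * h \<le> H"
proof -
  show le: "real (p + 2) * h \<le> H" unfolding n(2)[symmetric] using n(1) h by (intro mult_right_mono) auto
  have "1 * h \<le> real (p + 2) * h" using h by (intro mult_right_mono) auto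
  with le have "h \<le> H" by linarith
  then show "h \<le> H" "0 < H" using h by linarith+
qed

text \<open>The coarse square lies in the space-time rectangle, whose time length is 1.\<close>

lemma H_le_1: "H \<le> 1"
proof -
  have "(H, \<beta>) \<in> {0..H} \<times> {\<beta> - H..\<beta>}" using H by auto
  then have "(H, \<beta>) \<in> closure (\<Sigma> \<Omega>)" using P coarse by blast
  then show ?thesis unfolding closure_Sigma by auto
qed

lemma inside': "\<alpha> + H < b" "a < \<beta> - H" "real (p + 2) * h \<le> 1" "h \<le> 1"
  using inside gap H H_le_1 by linarith+

section \<open>The trial function on the mesh\<close>

abbreviation "\<theta> \<equiv> altstep p h"
abbreviation "\<phi> \<equiv> hat \<alpha> H"
abbreviation "w \<equiv> (\<lambda>(t, x). altspline p h t * \<phi> x)"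
abbreviation "T \<equiv> L2_norm \<Xi> \<theta>"

lemma T_pos: "0 < T"
  using altstep_norm_ge[OF h inside'(4), of p] h by (meson order_less_le_trans real_sqrt_gt_zero)

text \<open>The kink of the hat falls on a grid line since \<open>real n * h = H\<close>; cells with
  j < n lie on the rising side.\<close>

lemma hat_on_cell:
  assumes "j < 2 * n"
  obtains e0 e1 where "\<And>x. x \<in> {\<alpha> - H + real j * h<..<\<alpha> - H + real (j + 1) * h} \<Longrightarrow> \<phi> x = e0 + e1 * x"
proof (cases "j < n")
  case True
  then have "real (j + 1) * h \<le> real n * h" "0 \<le> real j * h" using h by (auto intro!: mult_right_mono)
  then have "\<phi> x = (1 - \<alpha> / H) + 1 / H * x" if "x \<in> {\<alpha> - H + real j * h<..<\<alpha> - H + real (j + 1) * h}" for x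
    using that n(2) hat_left[OF H(1), of \<alpha> x] by (simp add: diff_divide_distrib)
  then show ?thesis by (rule that)
next
  case False
  then have "real n * h \<le> real j * h" "real (j + 1) * h \<le> real (2 * n) * h"
    using assms h by (intro mult_right_mono; simp)+
  then have "H \<le> real j * h" "real (j + 1) * h \<le> 2 * H" using n(2) by auto
  then have "\<phi> x = (1 + \<alpha> / H) + (- 1 / H) * x" if "x \<in> {\<alpha> - H + real j * h<..<\<alpha> - H + real (j + 1) * h}" for x
    using that hat_right[OF H(1), of \<alpha> x] by (simp add: diff_divide_distrib)
  then show ?thesis by (rule that)
qed

lemma nat_cell:
  assumes "0 < s" "s < real m * h"
  obtains i where "i < m" "s \<in> {real i * h..real (i + 1) * h}"
proof
  let ?i = "nat \<lfloor>s / h\<rfloor>"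
  have pos: "0 \<le> s / h" using assms h by simp
  have i: "real ?i \<le> s / h" "s / h < real ?i + 1" using pos by auto
  from i have "real ?i * h \<le> s" "s < (real ?i + 1) * h"
    using h by (simp_all only: pos_le_divide_eq pos_divide_less_eq)
  then show "s \<in> {real ?i * h..real (?i + 1) * h}" by (simp add: add.commute)
  have "s / h < real m" using assms h by (simp only: pos_divide_less_eq)
  then have "real ?i < real m" using i(1) by linarith
  then show "?i < m" by simp
qed

text \<open>Serves both w, with r = s = 1, and the product of \<theta> with the hat, with r = p and
  s = q. On every other cell the function vanishes, since its support is filled by fine
  cells.\<close>

lemma tensor_Q:
  assumes f: "\<And>i. i < n \<Longrightarrow> \<exists>d. \<forall>t\<in>{real i * h<..<real (i + 1) * h}. f t = (\<Sum>k\<le>r. d k * t ^ k)"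
    and f0: "\<And>t. t \<le> 0 \<or> H \<le> t \<Longrightarrow> f t = 0" and s: "1 \<le> s"
  shows "(\<lambda>(t, x). f t * \<phi> x) \<in> Q r s P"
  unfolding Q_def
proof (rule CollectI, rule ballI)
  fix K assume KP: "K \<in> P"
  let ?v = "\<lambda>(t, x). f t * \<phi> x"
  let ?cell = "\<lambda>i j. {real i * h..real (i + 1) * h} \<times> {\<alpha> - H + real j * h..\<alpha> - H + real (j + 1) * h}"
  have int: "AE z in lebesgue_on K. z \<in> interior K"
    using division_ofD(4)[OF P KP] by (intro AE_interior) (auto simp: convex_box(1))
  have icell: "interior (?cell i j) = {real i * h<..<real (i + 1) * h} \<times> {\<alpha> - H + real j * h<..<\<alpha> - H + real (j + 1) * h}" for i j
    by (simp only: interior_Times interior_atLeastAtMost_real)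
  show "\<exists>c :: nat \<Rightarrow> nat \<Rightarrow> real. AE z in lebesgue_on K. ?v z = (\<Sum>i\<le>r. \<Sum>j\<le>s. c i j * fst z ^ i * snd z ^ j)"
  proof (cases "\<exists>i j. i < n \<and> j < 2 * n \<and> K = ?cell i j")
    case True
    then obtain i j where ij: "i < n" "j < 2 * n" "K = ?cell i j" by blast
    obtain d where d: "\<And>t. t \<in> {real i * h<..<real (i + 1) * h} \<Longrightarrow> f t = (\<Sum>k\<le>r. d k * t ^ k)" using f[OF ij(1)] by blast
    obtain e0 e1 where e: "\<And>x. x \<in> {\<alpha> - H + real j * h<..<\<alpha> - H + real (j + 1) * h} \<Longrightarrow> \<phi> x = e0 + e1 * x"
      using hat_on_cell[OF ij(2)] by blast
    define e where "e m = (if m = 0 then e0 else if m = 1 then e1 else 0)" for m :: nat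
    have esum: "(\<Sum>m\<le>s. e m * x ^ m) = e0 + e1 * x" for x :: real
    proof -
      have "(\<Sum>m\<le>s. e m * x ^ m) = (\<Sum>m\<in>{0, 1}. e m * x ^ m)"
        using s by (intro sum.mono_neutral_right) (auto simp: e_def)
      then show ?thesis by (simp add: e_def)
    qed
    have "AE z in lebesgue_on K. ?v z = (\<Sum>k\<le>r. \<Sum>m\<le>s. (d k * e m) * fst z ^ k * snd z ^ m)"
      using int
    proof eventually_elim
      case (elim z)
      obtain t x where z: "z = (t, x)" by (cases z)
      have "t \<in> {real i * h<..<real (i + 1) * h}" "x \<in> {\<alpha> - H + real j * h<..<\<alpha> - H + real (j + 1) * h}"
        using elim unfolding ij(3) icell z by auto
      then have "?v z = (\<Sum>k\<le>r. d k * t ^ k) * (\<Sum>m\<le>s. e m * x ^ m)" unfolding z esum using d e by simp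
      also have "\<dots> = (\<Sum>k\<le>r. \<Sum>m\<le>s. (d k * e m) * t ^ k * x ^ m)"
        unfolding sum_product by (intro sum.cong) (simp_all only: mult_ac)
      finally show ?case by (simp add: z)
    qed
    then show ?thesis by (intro exI[of _ "\<lambda>i j. d i * e j"])
  next
    case False
    have zero: "?v z = 0" if z: "z \<in> interior K" for z
    proof (rule ccontr)
      obtain t x where tx: "z = (t, x)" by (cases z)
      assume "?v z \<noteq> 0"
      then have "f t \<noteq> 0" "\<phi> x \<noteq> 0" by (auto simp: tx)
      then have t: "0 < t" "t < H" and x: "\<alpha> - H < x" "x < \<alpha> + H"
        using f0[of t] hat_zero[OF H(1), of x \<alpha>] by force+
      obtain i where i: "i < n" "t \<in> {real i * h..real (i + 1) * h}" using nat_cell[of t n] t n(2) by auto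
      have "x - (\<alpha> - H) < real (2 * n) * h" using x n(2) by simp
      then obtain j where j: "j < 2 * n" "x - (\<alpha> - H) \<in> {real j * h..real (j + 1) * h}"
        using nat_cell[of "x - (\<alpha> - H)" "2 * n"] x by auto
      have cp: "?cell i j \<in> P" by (rule fine[OF i(1) j(1)])
      have "K \<noteq> ?cell i j" using False i j by blast
      then have "interior K \<inter> interior (?cell i j) = {}" using division_ofD(5)[OF P KP cp] by simp
      \<comment> \<open>z may lie on an edge between fine cells, so the closed cell is needed: an
        open set that misses an open cell also misses its closure.\<close>
      then have "interior K \<inter> closure (interior (?cell i j)) = {}"
        by (simp only: open_Int_closure_eq_empty[OF open_interior])
      moreover have "closure (interior (?cell i j)) = ?cell i j"
      proof -
        have "real i * h < real (i + 1) * h" "\<alpha> - H + real j * h < \<alpha> - H + real (j + 1) * h" using h by (auto simp: algebra_simps)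
        then show ?thesis unfolding icell closure_Times by (simp only: closure_greaterThanLessThan)
      qed
      moreover have "z \<in> ?cell i j" using i(2) j(2) by (auto simp: tx)
      ultimately show False using z by blast
    qed
    have "AE z in lebesgue_on K. ?v z = (\<Sum>i\<le>r. \<Sum>j\<le>s. 0 * fst z ^ i * snd z ^ j)"
      using int by eventually_elim (simp add: zero)
    then show ?thesis by (intro exI[of _ "\<lambda>_ _. 0"])
  qed
qed

lemma w_Q: "w \<in> Q 1 1 P"
proof (rule tensor_Q)
  fix i
  show "\<exists>d. \<forall>t\<in>{real i * h<..<real (i + 1) * h}. altspline p h t = (\<Sum>k\<le>1. d k * t ^ k)"
    by (rule altspline_on_cell[OF h, of i p]) blast
  show "altspline p h t = 0" if "t \<le> 0 \<or> H \<le> t" for t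
    using altspline_zero[OF h, of t p] that H by auto
qed simp

lemma step_Q: "(\<lambda>(t, x). \<theta> t * \<phi> x) \<in> Q p q P"
proof (rule tensor_Q)
  fix i
  define d where "d k = (if k = 0 then if i \<le> Suc p then altcoeff p i else 0 else 0)" for k :: nat
  have "\<theta> t = (\<Sum>k\<le>p. d k * t ^ k)" if "t \<in> {real i * h<..<real (i + 1) * h}" for t
  proof -
    have "(\<Sum>k\<le>p. d k * t ^ k) = (\<Sum>k\<in>{0}. d k * t ^ k)" by (intro sum.mono_neutral_right) (auto simp: d_def)
    then show ?thesis using altstep_on_cell[OF h that, of p] by (simp add: d_def)
  qed
  then show "\<exists>d. \<forall>t\<in>{real i * h<..<real (i + 1) * h}. \<theta> t = (\<Sum>k\<le>p. d k * t ^ k)" by blast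
  show "\<theta> t = 0" if "t \<le> 0 \<or> H \<le> t" for t
    using altstep_zero[OF h, of t p] that H by auto
qed (rule q)

lemma hat_props:
  "\<phi> \<in> H01 \<Omega>" "\<phi> \<in> borel_measurable borel" "\<And>x. \<bar>\<phi> x\<bar> \<le> 1" "weak_deriv \<Omega> \<phi> (hat' \<alpha> H)"
  using hat_H01[OF H(1) inside(1) inside'(1)] hat_bounds[OF H(1)] borel_measurable_continuous_onI[OF hat_continuous]
  by auto

lemma w_Y: "w \<in> Y \<Omega>" "Y_norm \<Omega> w \<le> 2 ^ Suc p * sqrt (real (p + 2)) * h * T * sqrt (2 / H)"
proof -
  have b: "altspline p h \<in> borel_measurable borel" by (intro borel_measurable_continuous_onI altspline_continuous[OF h])
  note Y = tensor_Y[OF b altspline_abs_le[OF h] hat_props(1-4) hat'_borel hat'_abs_le[OF H(1)]]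
  show "w \<in> Y \<Omega>" by (rule Y)
  show "Y_norm \<Omega> w \<le> 2 ^ Suc p * sqrt (real (p + 2)) * h * T * sqrt (2 / H)"
    unfolding Y(2)
    by (rule mult_mono[OF altspline_norm_le[OF h inside'(3)] hat_norm_le[OF H(1) inside(1) inside'(1)]])
       (simp_all add: h less_imp_le[OF h])
qed

lemma step_Y: "(\<lambda>(t, x). \<theta> t * \<phi> x) \<in> Y \<Omega>"
  by (rule tensor_Y(1)[OF altstep_borel[OF h] altstep_abs_le[OF h] hat_props(1-4) hat'_borel hat'_abs_le[OF H(1)]])

lemma tensor_not_ae_zero:
  assumes "\<And>t. t \<in> {0<..<h} \<Longrightarrow> f t \<noteq> 0"
  shows "\<not> ae_zero (\<Sigma> \<Omega>) (\<lambda>(t, x). f t * \<phi> x)"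
proof (rule not_ae_zero)
  let ?U = "{0<..<h} \<times> {\<alpha> - H<..<\<alpha> + H}"
  show "\<Sigma> \<Omega> \<in> sets lebesgue" using Sigma_lmeasurable by (rule fmeasurableD)
  show "open ?U" by (intro open_Times open_greaterThanLessThan)
  show "?U \<noteq> {}" using h H by auto
  show "?U \<subseteq> \<Sigma> \<Omega>" using inside inside' by (auto simp: \<Xi>_def)
  fix z assume "z \<in> ?U"
  then show "(case z of (t, x) \<Rightarrow> f t * \<phi> x) \<noteq> 0"
    using assms hat_pos[OF H(1), of \<alpha> "snd z"] by (cases z) auto
qed

lemma w_X_disc: "w \<in> X_disc \<Omega> P" "\<not> ae_zero (\<Sigma> \<Omega>) w"
proof -
  have "continuous_on (closure (\<Sigma> \<Omega>)) (\<lambda>z. altspline p h (fst z) * \<phi> (snd z))"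
    by (intro continuous_on_mult continuous_on_compose2[OF altspline_continuous[OF h, of UNIV]]
        continuous_on_compose2[OF hat_continuous[of UNIV]] continuous_intros) auto
  then have "continuous_on (closure (\<Sigma> \<Omega>)) w" by (simp add: case_prod_beta)
  then show "w \<in> X_disc \<Omega> P" using w_Y(1) w_Q by (simp add: X_disc_def)
  show "\<not> ae_zero (\<Sigma> \<Omega>) w" by (rule tensor_not_ae_zero) (auto simp: altspline_first[OF h])
qed

text \<open>A nonzero discrete test function: the supremum over \<open>Y_disc\<close> has a nonempty
  index set, and the pair v, -v yields nonnegativity.\<close>

lemma step_Y_disc: "(\<lambda>(t, x). \<theta> t * \<phi> x) \<in> Y_disc \<Omega> p q P" "\<not> ae_zero (\<Sigma> \<Omega>) (\<lambda>(t, x). \<theta> t * \<phi> x)"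
proof -
  show "(\<lambda>(t, x). \<theta> t * \<phi> x) \<in> Y_disc \<Omega> p q P" using step_Y step_Q by (simp add: Y_disc_def)
  show "\<not> ae_zero (\<Sigma> \<Omega>) (\<lambda>(t, x). \<theta> t * \<phi> x)"
  proof (rule tensor_not_ae_zero)
    fix t assume "t \<in> {0<..<h}"
    then show "\<theta> t \<noteq> 0" using altstep_on_cell[OF h, of t 0 p] by (simp add: altcoeff_def)
  qed
qed

lemma w_weak_time_deriv: "weak_time_deriv \<Omega> w (\<lambda>t u. LINT x|lebesgue_on \<Omega>. \<theta> t * \<phi> x * u x)"
proof -
  have "weak_time_deriv \<Omega> w (\<lambda>t u. LINT x|lebesgue_on \<Omega>. (\<lambda>(t, x). \<theta> t * \<phi> x) (t, x) * u x)"
  proof (rule weak_time_derivI)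
    show "continuous_on (closure (\<Sigma> \<Omega>)) w" using w_X_disc by (simp add: X_disc_def)
    note [measurable] = altstep_borel[OF h] hat_props(2)
    have "(\<lambda>(t, x). \<theta> t * \<phi> x) \<in> borel_measurable (borel \<Otimes>\<^sub>M borel)" by measurable
    then show "(\<lambda>(t, x). \<theta> t * \<phi> x) \<in> borel_measurable borel" unfolding borel_prod .
    have "\<bar>\<theta> t\<bar> * \<bar>\<phi> x\<bar> \<le> 2 ^ Suc p * 1" for t x
      by (intro mult_mono altstep_abs_le[OF h] hat_props) auto
    then show "\<bar>case z of (t, x) \<Rightarrow> \<theta> t * \<phi> x\<bar> \<le> 2 ^ Suc p * 1" for z
      by (cases z) (simp add: abs_mult)
    show "finite ((\<lambda>i. real i * h) ` {..p + 2})" "finite {}" by auto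
    show "((\<lambda>s. w (s, x)) has_real_derivative (\<lambda>(t, x). \<theta> t * \<phi> x) (t, x)) (at t)"
      if "t \<in> \<Xi> - (\<lambda>i. real i * h) ` {..p + 2}" for t x
    proof -
      have "(altspline p h has_real_derivative \<theta> t) (at t)" using that by (intro altspline_has_derivative[OF h]) simp
      from DERIV_cmult_right[OF this, of "\<phi> x"] show ?thesis by simp
    qed
  qed
  then show ?thesis by simp
qed

lemma d_t_w: "v \<in> Y \<Omega> \<Longrightarrow> d_t \<Omega> w v = (LINT t|lebesgue_on \<Xi>. LINT x|lebesgue_on \<Omega>. \<theta> t * \<phi> x * v (t, x))"
  using time_deriv_props(2)[OF w_weak_time_deriv] .

end

lemma Q_uminus:
  assumes "v \<in> Q r s P"
  shows "(\<lambda>z. - v z) \<in> Q r s P"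
  unfolding Q_def
proof (rule CollectI, rule ballI)
  fix K assume "K \<in> P"
  then obtain c :: "nat \<Rightarrow> nat \<Rightarrow> real" where c: "AE z in lebesgue_on K. v z = (\<Sum>i\<le>r. \<Sum>j\<le>s. c i j * fst z ^ i * snd z ^ j)"
    using assms unfolding Q_def by blast
  have "AE z in lebesgue_on K. - v z = (\<Sum>i\<le>r. \<Sum>j\<le>s. (- c i j) * fst z ^ i * snd z ^ j)"
    using c by eventually_elim (simp add: sum_negf)
  then show "\<exists>c :: nat \<Rightarrow> nat \<Rightarrow> real. AE z in lebesgue_on K. - v z = (\<Sum>i\<le>r. \<Sum>j\<le>s. c i j * fst z ^ i * snd z ^ j)"
    by (intro exI[of _ "\<lambda>i j. - c i j"])
qed

section \<open>Estimates of the dual norms and of the two stability constants\<close>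

context local_mesh
begin

lemma Y_disc_uminus: "v \<in> Y_disc \<Omega> p q P \<Longrightarrow> (\<lambda>z. - v z) \<in> Y_disc \<Omega> p q P"
  by (simp add: Y_disc_def Y_uminus Q_uminus)

lemma Y_disc_subset: "Y_disc \<Omega> p q P \<subseteq> Y \<Omega>"
  by (auto simp: Y_disc_def)

text \<open>A single polynomial serves on all of (0, H) because one square covers all these times;
  on a subdivided column the moment would only be piecewise polynomial. Beyond H nothing is claimed,
  as \<theta> vanishes there.\<close>

lemma moment_polynomial:
  assumes v: "v \<in> Y_disc \<Omega> p q P"
  obtains e where "AE t in lebesgue_on \<Xi>. t < H \<longrightarrow>
    (LINT x|lebesgue_on \<Omega>. v (t, x) * indicator {\<beta> - H..\<beta>} x) = (\<Sum>i\<le>p. e i * t ^ i)"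
proof -
  let ?J = "{\<beta> - H..\<beta>}"
  have "v \<in> Q p q P" using v by (simp add: Y_disc_def)
  then obtain c :: "nat \<Rightarrow> nat \<Rightarrow> real" where
    c: "AE z in lebesgue_on ({0..H} \<times> ?J). v z = (\<Sum>i\<le>p. \<Sum>j\<le>q. c i j * fst z ^ i * snd z ^ j)"
    using coarse unfolding Q_def by blast
  define e where "e i = (\<Sum>j\<le>q. c i j * (LINT x|lebesgue_on ?J. x ^ j))" for i
  have "AE t in lebesgue_on {0..H}. AE x in lebesgue_on ?J. v (t, x) = (\<Sum>i\<le>p. \<Sum>j\<le>q. c i j * fst (t, x) ^ i * snd (t, x) ^ j)"
    by (rule AE_lebesgue_on_Times[OF _ _ c]) simp_all
  then have A: "AE t in lebesgue. t \<in> {0..H} \<longrightarrow> (AE x in lebesgue_on ?J. v (t, x) = (\<Sum>i\<le>p. \<Sum>j\<le>q. c i j * t ^ i * x ^ j))"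
    by (subst (asm) AE_restrict_space_iff) simp_all
  have "AE t in lebesgue. t \<in> \<Xi> \<longrightarrow> (t < H \<longrightarrow> (LINT x|lebesgue_on \<Omega>. v (t, x) * indicator ?J x) = (\<Sum>i\<le>p. e i * t ^ i))"
    using A
  proof eventually_elim
    case (elim t)
    show ?case
    proof (intro impI)
      assume t: "t \<in> \<Xi>" "t < H"
      then have eq: "AE x in lebesgue_on ?J. v (t, x) = (\<Sum>i\<le>p. \<Sum>j\<le>q. c i j * t ^ i * x ^ j)"
        using elim by (simp add: \<Xi>_def)
      have int: "integrable (lebesgue_on ?J) (\<lambda>x. x ^ j)" for j :: nat
        by (intro continuous_imp_integrable_real continuous_intros)
      have "(LINT x|lebesgue_on \<Omega>. v (t, x) * indicator ?J x) = (LINT x|lebesgue_on \<Omega>. (if x \<in> ?J then v (t, x) else 0))"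
        by (intro Bochner_Integration.integral_cong) (auto simp: indicator_def)
      also have "\<dots> = (LINT x|lebesgue_on ?J. v (t, x))"
      proof (rule Lebesgue_Measure.integral_restrict)
        show "?J \<subseteq> \<Omega>" using inside inside' by auto
      qed auto
      also have "\<dots> = (LINT x|lebesgue_on ?J. (\<Sum>i\<le>p. \<Sum>j\<le>q. c i j * t ^ i * x ^ j))"
        by (rule lebesgue_on_integral_cong_AE[OF _ eq]) simp
      also have "\<dots> = (\<Sum>i\<le>p. \<Sum>j\<le>q. c i j * t ^ i * (LINT x|lebesgue_on ?J. x ^ j))"
        using int by (simp add: Bochner_Integration.integral_sum)
      also have "\<dots> = (\<Sum>i\<le>p. e i * t ^ i)"
        unfolding e_def sum_distrib_right by (intro sum.cong) (simp_all only: mult_ac)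
      finally show "(LINT x|lebesgue_on \<Omega>. v (t, x) * indicator ?J x) = (\<Sum>i\<le>p. e i * t ^ i)" .
    qed
  qed
  then have "AE t in lebesgue_on \<Xi>. t < H \<longrightarrow> (LINT x|lebesgue_on \<Omega>. v (t, x) * indicator ?J x) = (\<Sum>i\<le>p. e i * t ^ i)"
    using Xi_lmeasurable(2) by (subst AE_restrict_space_iff) simp_all
  then show ?thesis by (rule that)
qed

text \<open>Hat and indicator both have mass H, so the difference has mean 0 and its absolute value
  integrates to at most 2 H. It is supported in [\<alpha> - H, \<beta>], whose length is the gap, at
  most C H, plus 3 H.\<close>

lemma hat_minus_mean:
  defines "k \<equiv> \<lambda>x. \<phi> x - indicator {\<beta> - H..\<beta>} x"
  shows "k \<in> L2 \<Omega>" "u \<in> H01 \<Omega> \<Longrightarrow> \<bar>LINT x|lebesgue_on \<Omega>. u x * k x\<bar> \<le> 2 * H * sqrt ((C + 3) * H) * H01_norm \<Omega> u"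
proof -
  let ?i = "indicat_real {\<beta> - H..\<beta>}"
  have hL: "\<phi> \<in> L2 \<Omega>" by (intro continuous_imp_L2 hat_continuous)
  have iL: "?i \<in> L2 \<Omega>"
    by (rule indicator_L2) auto
  show kL: "k \<in> L2 \<Omega>" unfolding k_def by (rule L2_diff[OF hL iL])
  have ih: "(LINT x|lebesgue_on \<Omega>. \<phi> x) = H" "integrable (lebesgue_on \<Omega>) \<phi>"
    using integral_hat[OF H(1), of \<alpha>] inside inside' by auto
  have ii: "(LINT x|lebesgue_on \<Omega>. ?i x) = H" "integrable (lebesgue_on \<Omega>) ?i"
    using integral_subinterval[of "\<beta> - H" \<beta>] inside inside' H by auto
  assume u: "u \<in> H01 \<Omega>"
  have "\<bar>LINT x|lebesgue_on \<Omega>. u x * k x\<bar> \<le> sqrt (\<beta> - (\<alpha> - H)) * (LINT x|lebesgue_on \<Omega>. \<bar>k x\<bar>) * H01_norm \<Omega> u"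
  proof (rule mean_zero_functional_bound[OF kL u])
    show "a \<le> \<alpha> - H" "\<alpha> - H \<le> \<beta>" "\<beta> \<le> b" using inside gap H by auto
    show "(LINT x|lebesgue_on \<Omega>. k x) = 0" unfolding k_def using ih ii by simp
    fix x assume "x \<in> \<Omega> - {\<alpha> - H..\<beta>}"
    then show "k x = 0" unfolding k_def using hat_zero[OF H(1), of x \<alpha>] gap H by (auto simp: indicator_def)
  qed
  also have "\<dots> \<le> sqrt ((C + 3) * H) * (2 * H) * H01_norm \<Omega> u"
  proof (intro mult_right_mono mult_mono)
    show "sqrt (\<beta> - (\<alpha> - H)) \<le> sqrt ((C + 3) * H)" using gap by (simp add: algebra_simps)
    have "(LINT x|lebesgue_on \<Omega>. \<bar>k x\<bar>) \<le> (LINT x|lebesgue_on \<Omega>. \<phi> x + ?i x)"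
    proof (rule integral_mono)
      show "integrable (lebesgue_on \<Omega>) (\<lambda>x. \<bar>k x\<bar>)" unfolding k_def using ih ii by auto
      show "\<bar>k x\<bar> \<le> \<phi> x + ?i x" for x
        unfolding k_def using hat_bounds(1)[OF H(1), of \<alpha> x] by (auto simp: indicator_def)
    qed (use ih ii in auto)
    also have "\<dots> = 2 * H" using ih ii by simp
    finally show "(LINT x|lebesgue_on \<Omega>. \<bar>k x\<bar>) \<le> 2 * H" .
  qed (use gap H in \<open>auto simp: algebra_simps\<close>)
  finally show "\<bar>LINT x|lebesgue_on \<Omega>. u x * k x\<bar> \<le> 2 * H * sqrt ((C + 3) * H) * H01_norm \<Omega> u"
    by (simp add: mult_ac)
qed

lemma d_t_disc_bound:
  assumes v: "v \<in> Y_disc \<Omega> p q P"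
  shows "\<bar>d_t \<Omega> w v\<bar> \<le> 2 * H * sqrt ((C + 3) * H) * T * Y_norm \<Omega> v"
proof -
  let ?i = "indicat_real {\<beta> - H..\<beta>}"
  let ?k = "\<lambda>x. \<phi> x - ?i x"
  have vY: "v \<in> Y \<Omega>" using v Y_disc_subset by blast
  obtain e where e: "AE t in lebesgue_on \<Xi>. t < H \<longrightarrow> (LINT x|lebesgue_on \<Omega>. v (t, x) * ?i x) = (\<Sum>i\<le>p. e i * t ^ i)"
    using moment_polynomial[OF v] .
  have iL: "?i \<in> L2 \<Omega>"
    by (rule indicator_L2) auto
  \<comment> \<open>f keeps the part tested against the mean-zero difference; g, defined next, is
    the part moved to J, which integrates to 0 by orthogonality. \<open>integral_add_null\<close>
    later drops g without a proof that f is integrable.\<close>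
  define f where "f t = \<theta> t * (LINT x|lebesgue_on \<Omega>. v (t, x) * ?k x)" for t
  define g where "g t = (\<Sum>i\<le>p. e i * (\<theta> t * t ^ i))" for t
  have g: "integrable (lebesgue_on \<Xi>) g" "(LINT t|lebesgue_on \<Xi>. g t) = 0"
    unfolding g_def using altstep_orthogonal[OF h _ inside'(3)]
    by (auto simp: Bochner_Integration.integral_sum intro!: Bochner_Integration.integrable_sum sum.neutral)
  have "AE t in lebesgue_on \<Xi>. (LINT x|lebesgue_on \<Omega>. \<theta> t * \<phi> x * v (t, x)) = f t + g t"
    using e Y_slice[OF vY]
  proof eventually_elim
    case (elim t)
    have gt: "g t = \<theta> t * (\<Sum>i\<le>p. e i * t ^ i)"
      unfolding g_def sum_distrib_left by (intro sum.cong) (simp_all only: mult_ac)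
    show ?case
    proof (cases "t < H")
      case True
      have sL: "slice v t \<in> L2 \<Omega>" by (rule H01D(1)[OF elim(2)])
      have i1: "integrable (lebesgue_on \<Omega>) (\<lambda>x. v (t, x) * ?k x)" by (rule L2_mult_integrable[OF sL hat_minus_mean(1)])
      have i2: "integrable (lebesgue_on \<Omega>) (\<lambda>x. v (t, x) * ?i x)" by (rule L2_mult_integrable[OF sL iL])
      have "(LINT x|lebesgue_on \<Omega>. \<theta> t * \<phi> x * v (t, x)) = (LINT x|lebesgue_on \<Omega>. \<theta> t * (v (t, x) * ?k x + v (t, x) * ?i x))"
        by (intro Bochner_Integration.integral_cong) (auto simp: algebra_simps)
      also have "\<dots> = \<theta> t * ((LINT x|lebesgue_on \<Omega>. v (t, x) * ?k x) + (LINT x|lebesgue_on \<Omega>. v (t, x) * ?i x))"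
        unfolding integral_mult_right_zero Bochner_Integration.integral_add[OF i1 i2] ..
      also have "\<dots> = f t + g t"
        using elim(1) True by (simp only: f_def gt distrib_left)
      finally show ?thesis .
    next
      case False
      then have "\<theta> t = 0" using altstep_zero[OF h, of t p] H(3) by auto
      then show ?thesis by (simp add: f_def gt)
    qed
  qed
  from lebesgue_on_integral_cong_AE[OF Xi_lmeasurable(2) this]
  have d: "d_t \<Omega> w v = (LINT t|lebesgue_on \<Xi>. f t)"
    unfolding d_t_w[OF vY] integral_add_null[OF g] .
  have Cp: "0 \<le> 2 * H * sqrt ((C + 3) * H)" using gap H by (auto simp: algebra_simps)
  have "AE t in lebesgue_on \<Xi>. \<bar>f t\<bar> \<le> 2 * H * sqrt ((C + 3) * H) * (\<bar>\<theta> t\<bar> * \<bar>H01_norm \<Omega> (slice v t)\<bar>)"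
    using Y_slice[OF vY]
  proof eventually_elim
    case (elim t)
    have "\<bar>\<theta> t\<bar> * \<bar>LINT x|lebesgue_on \<Omega>. v (t, x) * ?k x\<bar> \<le> \<bar>\<theta> t\<bar> * (2 * H * sqrt ((C + 3) * H) * H01_norm \<Omega> (slice v t))"
      by (rule mult_left_mono[OF hat_minus_mean(2)[OF elim]]) simp
    then show ?case by (simp add: f_def abs_mult mult_ac)
  qed
  from weighted_Cauchy_Schwarz[OF altstep_L2[OF h] Y_slice_norm(1)[OF vY] Cp this]
  show ?thesis unfolding d Y_slice_norm(2)[OF vY] by (simp only: mult.assoc)
qed

text \<open>The pairing splits into T squared times the integral of the hat against g, and the hat
  has mass H. The norm of v contains T only once, so the quotient is at least of order T H.\<close>

lemma d_t_lower:
  assumes g: "g \<in> test_functions \<Omega>" and m: "\<And>x. x \<in> {\<alpha> - H..\<alpha> + H} \<Longrightarrow> m \<le> g x"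
  defines "v \<equiv> \<lambda>(t, x). \<theta> t * g x"
  shows "v \<in> Y \<Omega>" "Y_norm \<Omega> v = T * H01_norm \<Omega> g" "T\<^sup>2 * (H * m) \<le> d_t \<Omega> w v"
proof -
  obtain B where B: "\<And>x. \<bar>g x\<bar> \<le> B" "\<And>x. \<bar>deriv g x\<bar> \<le> B" using test_function_bounded[OF g ab] by blast
  have b: "g \<in> borel_measurable borel" "deriv g \<in> borel_measurable borel"
    by (intro borel_measurable_continuous_onI smooth_continuous smooth_deriv test_functions_smooth[OF g])+
  note Y = tensor_Y[OF altstep_borel[OF h] altstep_abs_le[OF h] H01_test[OF g] b(1) B(1) weak_deriv_test[OF g] b(2) B(2)]
  show vY: "v \<in> Y \<Omega>" "Y_norm \<Omega> v = T * H01_norm \<Omega> g" unfolding v_def by (rule Y)+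
  let ?I = "LINT x|lebesgue_on \<Omega>. \<phi> x * g x"
  have ih: "(LINT x|lebesgue_on \<Omega>. \<phi> x) = H" "integrable (lebesgue_on \<Omega>) \<phi>"
    using integral_hat[OF H(1), of \<alpha>] inside inside' by auto
  have I: "H * m \<le> ?I"
  proof -
    have "H * m = (LINT x|lebesgue_on \<Omega>. \<phi> x * m)" using ih by simp
    also have "\<dots> \<le> ?I"
    proof (rule integral_mono)
      show "integrable (lebesgue_on \<Omega>) (\<lambda>x. \<phi> x * g x)"
        by (intro L2_mult_integrable continuous_imp_L2 hat_continuous smooth_continuous test_functions_smooth[OF g])
      show "\<phi> x * m \<le> \<phi> x * g x" for x
      proof (cases "x \<in> {\<alpha> - H..\<alpha> + H}")
        case True
        then show ?thesis by (intro mult_left_mono m hat_bounds H)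
      next
        case False
        then show ?thesis using hat_zero[OF H(1), of x \<alpha>] by auto
      qed
    qed (use ih in auto)
    finally show ?thesis .
  qed
  have "d_t \<Omega> w v = (LINT t|lebesgue_on \<Xi>. LINT x|lebesgue_on \<Omega>. \<theta> t * \<phi> x * v (t, x))" by (rule d_t_w[OF vY(1)])
  also have "\<dots> = (LINT t|lebesgue_on \<Xi>. (\<theta> t)\<^sup>2 * ?I)"
  proof (intro Bochner_Integration.integral_cong refl)
    fix t
    have "(LINT x|lebesgue_on \<Omega>. \<theta> t * \<phi> x * v (t, x)) = (LINT x|lebesgue_on \<Omega>. (\<theta> t)\<^sup>2 * (\<phi> x * g x))"
      by (intro Bochner_Integration.integral_cong) (auto simp: v_def power2_eq_square mult_ac)
    then show "(LINT x|lebesgue_on \<Omega>. \<theta> t * \<phi> x * v (t, x)) = (\<theta> t)\<^sup>2 * ?I" by simp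
  qed
  also have "\<dots> = T\<^sup>2 * ?I" by (simp add: L2_norm_power2)
  finally show "T\<^sup>2 * (H * m) \<le> d_t \<Omega> w v" using I by (simp add: mult_left_mono)
qed

text \<open>Required for every trial function, not only for w: the infimum is at most its value at w
  only if the quotients have a common lower bound.\<close>

lemma dual_norm_d_t_nonneg:
  assumes u: "u \<in> X_disc \<Omega> P" and S: "S = Y_disc \<Omega> p q P \<or> S = Y \<Omega>"
  shows "0 \<le> dual_norm \<Omega> S (d_t \<Omega> u)"
proof -
  obtain g where g: "weak_time_deriv \<Omega> u g" using X_disc_weak_time_deriv[OF P squares u] by blast
  obtain K where K: "0 \<le> K" "\<And>v. v \<in> Y \<Omega> \<Longrightarrow> \<bar>d_t \<Omega> u v\<bar> \<le> K * Y_norm \<Omega> v" using d_t_bound[OF g] by blast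
  let ?v = "\<lambda>(t, x). \<theta> t * \<phi> x"
  have sub: "S \<subseteq> Y \<Omega>" using S Y_disc_subset by blast
  have vS: "?v \<in> S" "(\<lambda>z. - ?v z) \<in> S" using S step_Y_disc step_Y Y_disc_uminus[OF step_Y_disc(1)] Y_uminus[OF step_Y] by blast+
  show ?thesis
  proof (rule dual_norm_nonneg[OF sub _ K(1) vS(1) step_Y_disc(2) vS(2)])
    show "d_t \<Omega> u v \<le> K * Y_norm \<Omega> v" if "v \<in> S" for v using K(2)[of v] that sub by fastforce
    show "d_t \<Omega> u (\<lambda>z. - ?v z) = - d_t \<Omega> u ?v" by (rule d_t_uminus[OF g step_Y])
  qed
qed

text \<open>A discrete norm of order H^(3/2) T is divided by a continuous one of order H T: T
  cancels and sqrt(H) remains.\<close>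

lemma gamma_dt_bounds:
  assumes g: "g \<in> test_functions \<Omega>" and m: "\<And>x. x \<in> {\<alpha> - H..\<alpha> + H} \<Longrightarrow> m \<le> g x" "0 < m"
  shows "0 \<le> gamma_dt \<Omega> p q P" "gamma_dt \<Omega> p q P \<le> 2 * sqrt ((C + 3) * H) * H01_norm \<Omega> g / m"
proof -
  let ?X = "{u \<in> X_disc \<Omega> P. \<exists>v\<in>Y \<Omega>. d_t \<Omega> u v \<noteq> 0}"
  let ?r = "\<lambda>u. dual_norm \<Omega> (Y_disc \<Omega> p q P) (d_t \<Omega> u) / dual_norm \<Omega> (Y \<Omega>) (d_t \<Omega> u)"
  have nonneg: "0 \<le> ?r u" if "u \<in> ?X" for u
    using that by (intro divide_nonneg_nonneg dual_norm_d_t_nonneg) auto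
  let ?v = "\<lambda>(t, x). \<theta> t * g x"
  note v = d_t_lower[OF g m(1)]
  have pos: "0 < T\<^sup>2 * (H * m)" using T_pos H(1) m(2) by simp
  then have wX: "w \<in> ?X" using w_X_disc v by force
  show "0 \<le> gamma_dt \<Omega> p q P"
    unfolding gamma_dt_def using wX nonneg by (intro cINF_greatest) auto
  let ?D = "dual_norm \<Omega> (Y_disc \<Omega> p q P) (d_t \<Omega> w)" and ?N = "dual_norm \<Omega> (Y \<Omega>) (d_t \<Omega> w)"
  let ?s = "sqrt ((C + 3) * H)"
  have s: "0 \<le> ?s" using gap H by (auto simp: algebra_simps)
  have D: "?D \<le> 2 * H * ?s * T"
  proof (rule dual_norm_least[OF Y_disc_subset _ _ step_Y_disc])
    show "d_t \<Omega> w v \<le> 2 * H * ?s * T * Y_norm \<Omega> v" if "v \<in> Y_disc \<Omega> p q P" for v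
      using d_t_disc_bound[OF that] by linarith
    show "0 \<le> 2 * H * ?s * T" using H s by simp
  qed
  obtain K where K: "0 \<le> K" "\<And>v. v \<in> Y \<Omega> \<Longrightarrow> \<bar>d_t \<Omega> w v\<bar> \<le> K * Y_norm \<Omega> v" using d_t_bound[OF w_weak_time_deriv] by blast
  have "d_t \<Omega> w ?v \<le> ?N * Y_norm \<Omega> ?v"
  proof (rule dual_norm_upper[OF subset_refl _ K(1) v(1)])
    show "d_t \<Omega> w v \<le> K * Y_norm \<Omega> v" if "v \<in> Y \<Omega>" for v using K(2)[OF that] by linarith
  qed
  then have N: "T\<^sup>2 * (H * m) \<le> ?N * (T * H01_norm \<Omega> g)" using v by simp
  then have "T * (T * (H * m)) \<le> T * (?N * H01_norm \<Omega> g)" by (simp add: power2_eq_square mult_ac)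
  then have N': "T * (H * m) \<le> ?N * H01_norm \<Omega> g" using T_pos by simp
  have N0: "0 \<le> ?N" using w_X_disc(1) by (intro dual_norm_d_t_nonneg) auto
  moreover have "?N \<noteq> 0" using N pos by auto
  ultimately have Np: "0 < ?N" by simp
  have "?D * m \<le> 2 * H * ?s * T * m" using D m(2) by (intro mult_right_mono) auto
  also have "\<dots> = 2 * ?s * (T * (H * m))" by (simp add: mult_ac)
  also have "\<dots> \<le> 2 * ?s * (?N * H01_norm \<Omega> g)" using N' s by (intro mult_left_mono) auto
  finally have "?r w \<le> 2 * ?s * H01_norm \<Omega> g / m" using Np m(2) by (simp add: field_simps)
  moreover have "gamma_dt \<Omega> p q P \<le> ?r w"
    unfolding gamma_dt_def using nonneg by (intro cINF_lower[OF _ wX] bdd_belowI2[of _ 0]) auto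
  ultimately show "gamma_dt \<Omega> p q P \<le> 2 * ?s * H01_norm \<Omega> g / m" by linarith
qed

text \<open>r bounds M times the norm of w in units of T H, with the constants of
  \<open>w_Y\<close>. The condition \<open>small\<close> keeps the lower bound for the continuous
  dual norm positive after the perturbation by A.\<close>

lemma gamma_Be_bounds:
  assumes g: "g \<in> test_functions \<Omega>" and m: "\<And>x. x \<in> {\<alpha> - H..\<alpha> + H} \<Longrightarrow> m \<le> g x" "0 < m"
    and M: "0 \<le> M" "\<And>w v. w \<in> Y \<Omega> \<Longrightarrow> v \<in> Y \<Omega> \<Longrightarrow> \<bar>A_op A w v\<bar> \<le> M * (Y_norm \<Omega> w * Y_norm \<Omega> v)"
    and A: "\<And>w v. w \<in> Y \<Omega> \<Longrightarrow> v \<in> Y \<Omega> \<Longrightarrow> A_op A w (\<lambda>z. - v z) = - A_op A w v"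
  defines "r \<equiv> M * (2 ^ Suc p * sqrt (real (p + 2)) * sqrt 2) * (h / (H * sqrt H))"
  assumes small: "r * H01_norm \<Omega> g < m"
  shows "0 \<le> gamma_Be \<Omega> A p q P"
    "gamma_Be \<Omega> A p q P \<le> (2 * sqrt ((C + 3) * H) + r) * H01_norm \<Omega> g / (m - r * H01_norm \<Omega> g)"
proof -
  let ?X = "{u \<in> X_disc \<Omega> P. \<not> ae_zero (\<Sigma> \<Omega>) u}"
  let ?B = "B_op \<Omega> A"
  let ?r = "\<lambda>u. ((dual_norm \<Omega> (Y_disc \<Omega> p q P) (?B u))\<^sup>2 + (L2_norm \<Omega> (gamma_0 u))\<^sup>2) /
     ((dual_norm \<Omega> (Y \<Omega>) (?B u))\<^sup>2 + (L2_norm \<Omega> (gamma_0 u))\<^sup>2)"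
  let ?D = "dual_norm \<Omega> (Y_disc \<Omega> p q P) (?B w)" and ?N = "dual_norm \<Omega> (Y \<Omega>) (?B w)"
  let ?s = "sqrt ((C + 3) * H)" and ?G = "H01_norm \<Omega> g"
  \<comment> \<open>The quotient is built from squares, so its sign is clear for every u, in
    contrast to the quotient in \<open>gamma_dt\<close>.\<close>
  have nonneg: "0 \<le> ?r u" for u by simp
  have wX: "w \<in> ?X" using w_X_disc by simp
  have "0 \<le> (INF u\<in>?X. ?r u)" using wX nonneg by (intro cINF_greatest) auto
  then show "0 \<le> gamma_Be \<Omega> A p q P" unfolding gamma_Be_def by (rule real_sqrt_ge_zero)
  have s: "0 \<le> ?s" using gap H by (auto simp: algebra_simps)
  have MW: "M * Y_norm \<Omega> w \<le> T * H * r"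
  proof -
    have "h * sqrt (2 / H) = sqrt 2 * (h / (H * sqrt H)) * H" using H(1) by (simp add: real_sqrt_divide field_simps)
    then have "2 ^ Suc p * sqrt (real (p + 2)) * h * T * sqrt (2 / H) =
        2 ^ Suc p * sqrt (real (p + 2)) * T * (sqrt 2 * (h / (H * sqrt H)) * H)" by (metis mult.assoc mult.commute)
    then have "Y_norm \<Omega> w \<le> 2 ^ Suc p * sqrt (real (p + 2)) * T * (sqrt 2 * (h / (H * sqrt H)) * H)" using w_Y(2) by linarith
    from mult_left_mono[OF this M(1)] show ?thesis unfolding r_def by (simp only: mult_ac)
  qed
  have r: "0 \<le> r" unfolding r_def using M(1) h H(1) by simp
  have Aw: "\<bar>A_op A w v\<bar> \<le> T * H * r * Y_norm \<Omega> v" if v: "v \<in> Y \<Omega>" for v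
    using M(2)[OF w_Y(1) v] mult_right_mono[OF MW Y_norm_nonneg[of v]] by (simp only: mult.assoc)
  obtain K where K: "0 \<le> K" "\<And>v. v \<in> Y \<Omega> \<Longrightarrow> \<bar>d_t \<Omega> w v\<bar> \<le> K * Y_norm \<Omega> v" using d_t_bound[OF w_weak_time_deriv] by blast
  let ?K = "K + T * H * r"
  have K': "?B w v \<le> ?K * Y_norm \<Omega> v" if "v \<in> Y \<Omega>" for v
    using K(2)[OF that] Aw[OF that] unfolding B_op_def distrib_right by linarith
  have K0: "0 \<le> ?K" using K(1) H r by simp
  have Bneg: "?B w (\<lambda>z. - v z) = - ?B w v" if "v \<in> Y \<Omega>" for v
    using d_t_uminus[OF w_weak_time_deriv that] A[OF w_Y(1) that] by (simp add: B_op_def)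
  have D0: "0 \<le> ?D"
    by (rule dual_norm_nonneg[OF Y_disc_subset _ K0 step_Y_disc Y_disc_uminus[OF step_Y_disc(1)] Bneg[OF step_Y]])
       (use K' Y_disc_subset in blast)
  have D: "?D \<le> T * H * (2 * ?s + r)"
  proof (rule dual_norm_least[OF Y_disc_subset _ _ step_Y_disc])
    show "?B w v \<le> T * H * (2 * ?s + r) * Y_norm \<Omega> v" if v: "v \<in> Y_disc \<Omega> p q P" for v
    proof -
      have "v \<in> Y \<Omega>" using v Y_disc_subset by blast
      then have "?B w v \<le> 2 * H * ?s * T * Y_norm \<Omega> v + T * H * r * Y_norm \<Omega> v"
        using d_t_disc_bound[OF v] Aw[of v] unfolding B_op_def by linarith
      also have "\<dots> = T * H * (2 * ?s + r) * Y_norm \<Omega> v" by (simp add: algebra_simps)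
      finally show ?thesis .
    qed
    show "0 \<le> T * H * (2 * ?s + r)" using H s r by simp
  qed
  let ?v = "\<lambda>(t, x). \<theta> t * g x"
  note v = d_t_lower[OF g m(1)]
  have "T\<^sup>2 * (H * m) - T * H * r * (T * ?G) \<le> ?B w ?v"
    using v(2,3) Aw[OF v(1)] unfolding B_op_def by simp
  also have "\<dots> \<le> ?N * Y_norm \<Omega> ?v" by (rule dual_norm_upper[OF subset_refl K' K0 v(1)])
  also have "\<dots> = ?N * (T * ?G)" using v(2) by simp
  finally have "T * (T * H * (m - r * ?G)) \<le> T * (?N * ?G)" by (simp add: power2_eq_square algebra_simps)
  then have N: "T * H * (m - r * ?G) \<le> ?N * ?G" using T_pos by (simp only: mult_le_cancel_left_pos)
  have pos: "0 < T * H * (m - r * ?G)" using T_pos H(1) small by simp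
  have N0: "0 < ?N"
  proof (rule ccontr)
    assume "\<not> 0 < ?N"
    then have "?N * ?G \<le> 0" by (intro mult_nonpos_nonneg) auto
    then show False using N pos by linarith
  qed
  have "?D * (m - r * ?G) \<le> T * H * (2 * ?s + r) * (m - r * ?G)" using D small by (intro mult_right_mono) auto
  also have "\<dots> = (2 * ?s + r) * (T * H * (m - r * ?G))" by (simp only: mult_ac)
  also have "\<dots> \<le> (2 * ?s + r) * (?N * ?G)" using N s r by (intro mult_left_mono) auto
  finally have "?D / ?N \<le> (2 * ?s + r) * ?G / (m - r * ?G)"
    using N0 small by (simp only: pos_divide_le_eq pos_le_divide_eq diff_gt_0_iff_gt times_divide_eq_left) (simp only: mult_ac)
  moreover have "gamma_Be \<Omega> A p q P \<le> ?D / ?N"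
  proof -
    \<comment> \<open>w vanishes at t = 0, so the trace terms drop out and the quotient is a perfect
      square.\<close>
    have "gamma_0 w = (\<lambda>x. 0)" using altspline_zero[OF h, of 0 p] by (simp add: gamma_0_def)
    then have rw: "?r w = (?D / ?N)\<^sup>2" by (simp add: L2_norm_def power_divide)
    have "(INF u\<in>?X. ?r u) \<le> ?r w" using nonneg by (intro cINF_lower[OF _ wX] bdd_belowI2[of _ 0]) auto
    then have "gamma_Be \<Omega> A p q P \<le> sqrt ((?D / ?N)\<^sup>2)" unfolding gamma_Be_def rw by (rule real_sqrt_le_mono)
    also have "\<dots> = ?D / ?N" using D0 N0 by simp
    finally show ?thesis .
  qed
  ultimately show "gamma_Be \<Omega> A p q P \<le> (2 * ?s + r) * ?G / (m - r * ?G)" by linarith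
qed

end

section \<open>Passage to the limit along the family of meshes\<close>

theorem mainTheorem8:
  fixes a b C c :: real and \<Omega> :: "real set" and p q :: nat
    and A :: "real \<Rightarrow> (real \<Rightarrow> real) \<Rightarrow> (real \<Rightarrow> real) \<Rightarrow> real"
    and P :: "'i \<Rightarrow> (real \<times> real) set set"
    and h H \<alpha> \<beta> :: "'i \<Rightarrow> real"
  assumes "a < b" and "\<Omega> = {a<..<b}" and "q \<ge> 1"
    and "bounded_coercive \<Omega> A"
    and "C > 0" and "c > 0"
    and "\<And>\<delta>. P \<delta> division_of closure (\<Sigma> \<Omega>)"
    and "\<And>\<delta> K. K \<in> P \<delta> \<Longrightarrow>
           \<exists>t x l. h \<delta> \<le> l \<and> l \<le> H \<delta> \<and> K = {t..t + l} \<times> {x..x + l}"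
    and "\<And>\<delta>. h \<delta> > 0"
    and "\<And>\<delta>. real p + 2 \<le> H \<delta> / h \<delta>" and "\<And>\<delta>. H \<delta> / h \<delta> \<in> \<nat>"
    and "\<And>\<delta>. \<alpha> \<delta> \<in> \<Omega>" and "\<And>\<delta>. \<beta> \<delta> \<in> \<Omega>"
    and "\<And>\<delta> i j :: nat. real i < H \<delta> / h \<delta> \<Longrightarrow> real j < 2 * H \<delta> / h \<delta> \<Longrightarrow>
           {real i * h \<delta>..real (i + 1) * h \<delta>} \<times>
           {\<alpha> \<delta> - H \<delta> + real j * h \<delta>..\<alpha> \<delta> - H \<delta> + real (j + 1) * h \<delta>} \<in> P \<delta>"
    and "\<And>\<delta>. {0..H \<delta>} \<times> {\<beta> \<delta> - H \<delta>..\<beta> \<delta>} \<in> P \<delta>"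
    and "\<And>\<delta>. {0..H \<delta>} \<times> {\<beta> \<delta>..\<beta> \<delta> + H \<delta>} \<in> P \<delta>"
    and "\<And>\<delta>. 0 < (\<beta> \<delta> - H \<delta>) - (\<alpha> \<delta> + H \<delta>)"
    and "\<And>\<delta>. (\<beta> \<delta> - H \<delta>) - (\<alpha> \<delta> + H \<delta>) \<le> C * H \<delta>"
    and "\<And>\<delta>. infdist (\<alpha> \<delta>) (frontier \<Omega>) \<ge> c"
  shows "((\<lambda>\<delta>. gamma_dt \<Omega> p q (P \<delta>)) \<longlongrightarrow> 0) (filtercomap H (at_right 0)) \<and>
         ((\<lambda>\<delta>. gamma_Be \<Omega> A p q (P \<delta>)) \<longlongrightarrow> 0)
           (inf (filtercomap H (at_right 0))
                (filtercomap (\<lambda>\<delta>. h \<delta> / (H \<delta> * sqrt (H \<delta>))) (at_right 0)))"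
proof -
  note Om = assms(2)
  note asm = assms(3,4,7-19)[unfolded Om]
  interpret bounded_interval a b by unfold_locales (rule assms(1))
  have dist: "c \<le> \<alpha> \<delta> - a" "c \<le> b - \<alpha> \<delta>" for \<delta>
  proof -
    have "frontier {a<..<b} = {a, b}" using assms(1) by (auto simp: frontier_def)
    then have "infdist (\<alpha> \<delta>) {a, b} \<ge> c" using asm(15)[of \<delta>] by simp
    moreover have "infdist (\<alpha> \<delta>) {a, b} \<le> dist (\<alpha> \<delta>) a" "infdist (\<alpha> \<delta>) {a, b} \<le> dist (\<alpha> \<delta>) b" by (auto intro: infdist_le)
    ultimately show "c \<le> \<alpha> \<delta> - a" "c \<le> b - \<alpha> \<delta>" using asm(8)[of \<delta>] by (auto simp: dist_real_def)
  qed
  \<comment> \<open>One bump for all meshes. If H < c/2, then [\<alpha> - H, \<alpha> + H] keeps a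
    distance of at least c/2 from a and b, hence c/4 from the ends of the support of g; m is the
    resulting lower bound.\<close>
  define g where "g = bump 1 (a + c / 4) (b - c / 4)"
  define m where "m = (flat 0 (c / 4))\<^sup>2"
  define G where "G = H01_norm {a<..<b} g"
  have gT: "g \<in> test_functions {a<..<b}" unfolding g_def using assms(6) by (intro bump_test) auto
  have m: "0 < m" using assms(6) by (simp add: m_def flat_def)
  have mesh: "\<exists>n. local_mesh a b (P \<delta>) (h \<delta>) (H \<delta>) (\<alpha> \<delta>) (\<beta> \<delta>) C p q n" if small: "H \<delta> < c / 2" for \<delta>
  proof -
    obtain n where n: "H \<delta> / h \<delta> = real n" using asm(7)[of \<delta>] by (auto simp: Nats_def)
    have hp: "0 < h \<delta>" by (rule asm(5))
    have nh: "real n * h \<delta> = H \<delta>" using n hp by (simp add: field_simps)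
    show ?thesis
    proof (intro exI, unfold_locales)
      show "\<exists>t x l. 0 < l \<and> K = {t..t + l} \<times> {x..x + l}" if K: "K \<in> P \<delta>" for K
      proof -
        obtain t x l where "h \<delta> \<le> l" "K = {t..t + l} \<times> {x..x + l}" using asm(4)[OF K] by blast
        then have "0 < l \<and> K = {t..t + l} \<times> {x..x + l}" using hp by simp
        then show ?thesis by (intro exI)
      qed
      show "p + 2 \<le> n" using asm(6)[of \<delta>] unfolding n by linarith
      show "real n * h \<delta> = H \<delta>" by (rule nh)
      show "{real i * h \<delta>..real (i + 1) * h \<delta>} \<times> {\<alpha> \<delta> - H \<delta> + real j * h \<delta>..\<alpha> \<delta> - H \<delta> + real (j + 1) * h \<delta>} \<in> P \<delta>"
        if "i < n" "j < 2 * n" for i j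
      proof (rule asm(10))
        show "real i < H \<delta> / h \<delta>" using that n by simp
        have "2 * H \<delta> / h \<delta> = real (2 * n)" using n by simp
        then show "real j < 2 * H \<delta> / h \<delta>" using that by (simp only: of_nat_less_iff)
      qed
      show "a < \<alpha> \<delta> - H \<delta>" using dist[of \<delta>] small assms(6) by linarith
      show "\<beta> \<delta> < b" using asm(9)[of \<delta>] by simp
    qed (use asm in auto)
  qed
  have mg: "m \<le> g x" if "H \<delta> < c / 2" "x \<in> {\<alpha> \<delta> - H \<delta>..\<alpha> \<delta> + H \<delta>}" for \<delta> x
  proof -
    have "(flat 0 (1 * (c / 4)))\<^sup>2 \<le> g x"
      unfolding g_def using that dist[of \<delta>] assms(6) by (intro bump_lower) auto
    then show ?thesis by (simp add: m_def)
  qed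
  let ?F1 = "filtercomap H (at_right 0)"
  let ?q = "\<lambda>\<delta>. h \<delta> / (H \<delta> * sqrt (H \<delta>))"
  let ?F2 = "inf ?F1 (filtercomap ?q (at_right 0))"
  have lim1: "filterlim H (at_right 0) ?F1" by (rule filterlim_filtercomap)
  have H1: "(H \<longlongrightarrow> 0) ?F1" using lim1 by (simp add: filterlim_at)
  have ev1: "\<forall>\<^sub>F \<delta> in ?F1. H \<delta> < c / 2" using order_tendstoD(2)[OF H1, of "c / 2"] assms(6) by simp
  have dt: "0 \<le> gamma_dt {a<..<b} p q (P \<delta>) \<and> gamma_dt {a<..<b} p q (P \<delta>) \<le> 2 * sqrt ((C + 3) * H \<delta>) * G / m"
    if small: "H \<delta> < c / 2" for \<delta>
  proof -
    obtain n where "local_mesh a b (P \<delta>) (h \<delta>) (H \<delta>) (\<alpha> \<delta>) (\<beta> \<delta>) C p q n" using mesh[OF small] by blast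
    then interpret M: local_mesh a b "P \<delta>" "h \<delta>" "H \<delta>" "\<alpha> \<delta>" "\<beta> \<delta>" C p q n .
    show ?thesis using M.gamma_dt_bounds[OF gT mg[OF small] m] by (simp add: G_def)
  qed
  have "((\<lambda>\<delta>. gamma_dt {a<..<b} p q (P \<delta>)) \<longlongrightarrow> 0) ?F1"
  proof (rule tendsto_sandwich[of "\<lambda>_. 0"])
    show "\<forall>\<^sub>F \<delta> in ?F1. 0 \<le> gamma_dt {a<..<b} p q (P \<delta>)" using ev1 by eventually_elim (use dt in blast)
    show "\<forall>\<^sub>F \<delta> in ?F1. gamma_dt {a<..<b} p q (P \<delta>) \<le> 2 * sqrt ((C + 3) * H \<delta>) * G / m" using ev1 by eventually_elim (use dt in blast)
    have "((\<lambda>\<delta>. 2 * sqrt ((C + 3) * H \<delta>) * G / m) \<longlongrightarrow> 2 * sqrt ((C + 3) * 0) * G / m) ?F1"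
      using m by (intro tendsto_intros H1) auto
    then show "((\<lambda>\<delta>. 2 * sqrt ((C + 3) * H \<delta>) * G / m) \<longlongrightarrow> 0) ?F1" by simp
  qed simp
  moreover have "((\<lambda>\<delta>. gamma_Be {a<..<b} A p q (P \<delta>)) \<longlongrightarrow> 0) ?F2"
  proof -
    obtain M where M: "0 \<le> M" "\<And>w v. w \<in> Y {a<..<b} \<Longrightarrow> v \<in> Y {a<..<b} \<Longrightarrow> \<bar>A_op A w v\<bar> \<le> M * (Y_norm {a<..<b} w * Y_norm {a<..<b} v)"
      "\<And>w v. w \<in> Y {a<..<b} \<Longrightarrow> v \<in> Y {a<..<b} \<Longrightarrow> A_op A w (\<lambda>z. - v z) = - A_op A w v"
      using A_op_bound[OF asm(2)] by metis
    define r where "r \<delta> = M * (2 ^ Suc p * sqrt (real (p + 2)) * sqrt 2) * ?q \<delta>" for \<delta>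
    have H2: "(H \<longlongrightarrow> 0) ?F2" using H1 by (rule tendsto_mono[rotated]) simp
    have "filterlim ?q (at_right 0) (filtercomap ?q (at_right 0))" by (rule filterlim_filtercomap)
    then have "(?q \<longlongrightarrow> 0) (filtercomap ?q (at_right 0))" by (simp add: filterlim_at)
    then have q2: "(?q \<longlongrightarrow> 0) ?F2" by (rule tendsto_mono[rotated]) simp
    have r2: "(r \<longlongrightarrow> 0) ?F2" unfolding r_def using tendsto_mult_right_zero[OF q2] by blast
    have ev2: "\<forall>\<^sub>F \<delta> in ?F2. H \<delta> < c / 2" using order_tendstoD(2)[OF H2, of "c / 2"] assms(6) by simp
    have "((\<lambda>\<delta>. r \<delta> * G) \<longlongrightarrow> 0) ?F2" using tendsto_mult_left_zero[OF r2] .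
    \<comment> \<open>Smallness of h / H^(3/2) makes r tend to 0, so the smallness condition of
      \<open>gamma_Be_bounds\<close> holds eventually.\<close>
    then have ev3: "\<forall>\<^sub>F \<delta> in ?F2. r \<delta> * G < m" using m by (rule order_tendstoD(2))
    have Be: "0 \<le> gamma_Be {a<..<b} A p q (P \<delta>) \<and>
        gamma_Be {a<..<b} A p q (P \<delta>) \<le> (2 * sqrt ((C + 3) * H \<delta>) + r \<delta>) * G / (m - r \<delta> * G)"
      if small: "H \<delta> < c / 2" "r \<delta> * G < m" for \<delta>
    proof -
      obtain n where "local_mesh a b (P \<delta>) (h \<delta>) (H \<delta>) (\<alpha> \<delta>) (\<beta> \<delta>) C p q n" using mesh[OF small(1)] by blast
      then interpret M: local_mesh a b "P \<delta>" "h \<delta>" "H \<delta>" "\<alpha> \<delta>" "\<beta> \<delta>" C p q n .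
      show ?thesis using M.gamma_Be_bounds[OF gT mg[OF small(1)] m M small(2)[unfolded r_def G_def]]
        unfolding r_def G_def by blast
    qed
    show ?thesis
    proof (rule tendsto_sandwich[of "\<lambda>_. 0"])
      show "\<forall>\<^sub>F \<delta> in ?F2. 0 \<le> gamma_Be {a<..<b} A p q (P \<delta>)" using ev2 ev3 by eventually_elim (use Be in blast)
      show "\<forall>\<^sub>F \<delta> in ?F2. gamma_Be {a<..<b} A p q (P \<delta>) \<le> (2 * sqrt ((C + 3) * H \<delta>) + r \<delta>) * G / (m - r \<delta> * G)"
        using ev2 ev3 by eventually_elim (use Be in blast)
      have "((\<lambda>\<delta>. (2 * sqrt ((C + 3) * H \<delta>) + r \<delta>) * G / (m - r \<delta> * G)) \<longlongrightarrow> (2 * sqrt ((C + 3) * 0) + 0) * G / (m - 0 * G)) ?F2"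
        using m by (intro tendsto_intros H2 r2) auto
      then show "((\<lambda>\<delta>. (2 * sqrt ((C + 3) * H \<delta>) + r \<delta>) * G / (m - r \<delta> * G)) \<longlongrightarrow> 0) ?F2" by simp
    qed simp
  qed
  ultimately show ?thesis unfolding Om by blast
qed

end
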